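(* Let $\mu\ge1$ be an integer, $\theta>-1$, $\beta>-1$ and $0<\gamma<1$. There is a constant $C>0$, independent of $M$ and $v$, such that for every integer $M\ge1$, with $\widehat\mu:=\min\{\mu,M+1\}$, and every $v\in C(\Lambda)\cap\mathcal{A}_{\theta,\beta,\gamma}^{\mu}(\Lambda)$ with $\mathscr{D}_{\beta,\gamma}v\in\mathcal{A}_{\theta,\beta,\gamma}^{\mu-1}(\Lambda)$, $$\big\|\mathcal{I}_M^{\theta,\beta,\gamma}v-v\big\|_{\varrho^{\theta,\beta,\gamma}}\le C\left[\frac{(M+1-\widehat\mu)!}{M!}\right]^{1/2}\Big[\big\|\mathscr{D}_{\beta,\gamma}^{\,\widehat\mu}v\big\|_{\varrho^{\theta+\widehat\mu-1,\beta,\gamma}}+2\sqrt{\log M}\,\big\|\mathscr{D}_{\beta,\gamma}^{\,\widehat\mu}v\big\|_{\varrho^{\theta+\widehat\mu,\beta,\gamma}}\Big].$$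
   Context: $\Lambda=(0,\infty)$. For $\theta>-1$, $\beta>-1$, $0<\gamma<1$ set $\varrho^{\theta,\beta,\gamma}(x):=(\beta+1)^{\theta+1}\gamma\,x^{\gamma(\theta+1)-1}e^{-(\beta+1)x^\gamma}$ for $x\in\Lambda$. For a weight $\varrho$, $L^2_\varrho(\Lambda)$ is the weighted space with norm $\|v\|_\varrho=(\int_0^\infty|v|^2\varrho\,dx)^{1/2}$ (real-valued functions). The mapped derivative is $\mathscr{D}_{\beta,\gamma}u(x):=\frac{x^{1-\gamma}}{(\beta+1)\gamma}\,\partial_xu(x)$, with $\partial_x$ understood in the weak sense; $\mathscr{D}_{\beta,\gamma}^{\,r}$ is its $r$-fold iterate. For an integer $\mu\ge0$, $$\mathcal{A}_{\theta,\beta,\gamma}^{\mu}(\Lambda):=\big\{v\in L^2_{\varrho^{\theta,\beta,\gamma}}(\Lambda):\ \mathscr{D}_{\beta,\gamma}^{\,r}v\in L^2_{\varrho^{\theta+r,\beta,\gamma}}(\Lambda),\ 1\le r\le\mu\big\}.$$ $L_m^{(\theta)}(y)=\sum_{r=0}^m\frac{(-1)^r}{r!}\binom{m+\theta}{m-r}y^r$ is the generalized Laguerre polynomial of degree $m$. Let $y_0^{(\theta)},\dots,y_M^{(\theta)}\in(0,\infty)$ be the zeros of $L_{M+1}^{(\theta)}$ and $x_i^{(\theta,\beta,\gamma)}:=\big(y_i^{(\theta)}/(\beta+1)\big)^{1/\gamma}$, $0\le i\le M$. Let $\mathbb{P}_M^\gamma:=\operatorname{span}\{1,x^\gamma,\dots,x^{M\gamma}\}$.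 The interpolation operator $\mathcal{I}_M^{\theta,\beta,\gamma}:C(\Lambda)\to\mathbb{P}_M^\gamma$ sends $v$ to the unique element of $\mathbb{P}_M^\gamma$ with $\mathcal{I}_M^{\theta,\beta,\gamma}v(x_i^{(\theta,\beta,\gamma)})=v(x_i^{(\theta,\beta,\gamma)})$ for $0\le i\le M$; explicitly $$\mathcal{I}_M^{\theta,\beta,\gamma}v(x)=\sum_{i=0}^Mv\big(x_i^{(\theta,\beta,\gamma)}\big)\prod_{\substack{r=0\\ r\ne i}}^M\frac{x^\gamma-(x_r^{(\theta,\beta,\gamma)})^\gamma}{(x_i^{(\theta,\beta,\gamma)})^\gamma-(x_r^{(\theta,\beta,\gamma)})^\gamma}.$$ *)

theory Defs
  imports "HOL-Analysis.Analysis"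
begin

definition gl_weight :: "real \<Rightarrow> real \<Rightarrow> real \<Rightarrow> real \<Rightarrow> real" where
  "gl_weight \<theta> \<beta> \<gamma> x =
     (\<beta> + 1) powr (\<theta> + 1) * \<gamma> * x powr (\<gamma> * (\<theta> + 1) - 1) * exp (- (\<beta> + 1) * x powr \<gamma>)"

text \<open>Elements of function spaces on the half-line are represented by total functions
  \<^typ>\<open>real \<Rightarrow> real\<close>, not by equivalence classes modulo null sets; the values outside
  \<^term>\<open>{0<..} :: real set\<close> play no role.\<close>

definition weighted_L2 :: "(real \<Rightarrow> real) \<Rightarrow> (real \<Rightarrow> real) set" where
  "weighted_L2 \<rho> = {v. set_borel_measurable lebesgue {0<..} v \<and>
     set_integrable lebesgue {0<..} (\<lambda>x. \<bar>v x\<bar>\<^sup>2 * \<rho> x)}"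

definition weighted_norm :: "(real \<Rightarrow> real) \<Rightarrow> (real \<Rightarrow> real) \<Rightarrow> real" where
  "weighted_norm \<rho> v = sqrt (LINT x:{0<..}|lebesgue. \<bar>v x\<bar>\<^sup>2 * \<rho> x)"

definition test_function :: "(real \<Rightarrow> real) \<Rightarrow> bool" where
  "test_function \<phi> \<longleftrightarrow>
     (\<forall>k x. (deriv ^^ k) \<phi> differentiable (at x)) \<and>
     compact (closure {x. \<phi> x \<noteq> 0}) \<and> closure {x. \<phi> x \<noteq> 0} \<subseteq> {0<..}"

definition locally_integrable :: "(real \<Rightarrow> real) \<Rightarrow> bool" where
  "locally_integrable u \<longleftrightarrow> (\<forall>K. compact K \<and> K \<subseteq> {0<..} \<longrightarrow> set_integrable lebesgue K u)"

definition has_weak_deriv :: "(real \<Rightarrow> real) \<Rightarrow> (real \<Rightarrow> real) \<Rightarrow> bool" where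
  "has_weak_deriv u g \<longleftrightarrow> locally_integrable u \<and> locally_integrable g \<and>
     (\<forall>\<phi>. test_function \<phi> \<longrightarrow>
        (LINT x:{0<..}|lebesgue. u x * deriv \<phi> x) = - (LINT x:{0<..}|lebesgue. g x * \<phi> x))"

definition weakly_differentiable :: "(real \<Rightarrow> real) \<Rightarrow> bool" where
  "weakly_differentiable u \<longleftrightarrow> (\<exists>g. has_weak_deriv u g)"

text \<open>A representative of the weak derivative, which is unique up to null sets. It is meaningful
  only for weakly differentiable functions, so the spaces below demand weak differentiability
  explicitly.\<close>

definition weak_deriv :: "(real \<Rightarrow> real) \<Rightarrow> real \<Rightarrow> real" where
  "weak_deriv u = (SOME g. has_weak_deriv u g)"

definition mapped_deriv :: "real \<Rightarrow> real \<Rightarrow> (real \<Rightarrow> real) \<Rightarrow> real \<Rightarrow> real" where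
  "mapped_deriv \<beta> \<gamma> u x = x powr (1 - \<gamma>) / ((\<beta> + 1) * \<gamma>) * weak_deriv u x"

definition mapped_sobolev :: "nat \<Rightarrow> real \<Rightarrow> real \<Rightarrow> real \<Rightarrow> (real \<Rightarrow> real) set" where
  "mapped_sobolev \<mu> \<theta> \<beta> \<gamma> =
     {v \<in> weighted_L2 (gl_weight \<theta> \<beta> \<gamma>). \<forall>r\<in>{1..\<mu>}.
        weakly_differentiable ((mapped_deriv \<beta> \<gamma> ^^ (r - 1)) v) \<and>
        (mapped_deriv \<beta> \<gamma> ^^ r) v \<in> weighted_L2 (gl_weight (\<theta> + real r) \<beta> \<gamma>)}"

definition laguerre :: "nat \<Rightarrow> real \<Rightarrow> real \<Rightarrow> real" where
  "laguerre m \<theta> y = (\<Sum>r=0..m. (-1) ^ r / fact r * ((real m + \<theta>) gchoose (m - r)) * y ^ r)"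

text \<open>The zeros of the Laguerre polynomial of degree \<^term>\<open>M + 1\<close> (there are exactly
  \<^term>\<open>M + 1\<close> of them for \<open>\<theta> > -1\<close>), enumerated in increasing order for
  \<open>i = 0, \<dots>, M\<close>.\<close>

definition laguerre_zero :: "nat \<Rightarrow> real \<Rightarrow> nat \<Rightarrow> real" where
  "laguerre_zero M \<theta> i = sorted_list_of_set {y. 0 < y \<and> laguerre (M + 1) \<theta> y = 0} ! i"

definition interp_node :: "nat \<Rightarrow> real \<Rightarrow> real \<Rightarrow> real \<Rightarrow> nat \<Rightarrow> real" where
  "interp_node M \<theta> \<beta> \<gamma> i = (laguerre_zero M \<theta> i / (\<beta> + 1)) powr (1 / \<gamma>)"

definition interpolant :: "nat \<Rightarrow> real \<Rightarrow> real \<Rightarrow> real \<Rightarrow> (real \<Rightarrow> real) \<Rightarrow> real \<Rightarrow> real" where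
  "interpolant M \<theta> \<beta> \<gamma> v x =
     (\<Sum>i=0..M. v (interp_node M \<theta> \<beta> \<gamma> i) *
        (\<Prod>r\<in>{0..M} - {i}.
           (x powr \<gamma> - interp_node M \<theta> \<beta> \<gamma> r powr \<gamma>) /
           (interp_node M \<theta> \<beta> \<gamma> i powr \<gamma> - interp_node M \<theta> \<beta> \<gamma> r powr \<gamma>)))"

end

theory Submission
  imports Defs
begin

text \<open>In the variable \<open>y = (\<beta> + 1) x\<^sup>\<gamma>\<close> the statement concerns interpolation at the zeros of a
  Laguerre polynomial in \<open>L\<^sup>2\<close> with weight \<open>y\<^sup>\<theta> e\<^sup>-\<^sup>y\<close>. Let \<open>v\<close> be the residual of the orthogonal
  projection onto polynomials of degree \<open>M\<close>. A spectral gap for differentiation bounds \<open>v\<close> and \<open>v'\<close>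
  by \<open>A = ((M + 1 - m)! / M!)\<^sup>1\<^sup>/\<^sup>2\<close> times the norm of the \<open>m\<close>-th derivative. By Gauss
  quadrature the interpolant of \<open>v\<close> has squared norm \<open>\<Sum> v(y\<^sub>i)\<^sup>2 \<omega>\<^sub>i\<close>, and
  \<open>v(y)\<^sup>2 y\<^sup>\<theta>\<^sup>+\<^sup>1 e\<^sup>-\<^sup>y\<close> is bounded by a multiple of \<open>A\<^sup>2\<close>. What remains is
  \<open>\<Sum> \<omega>\<^sub>i y\<^sub>i\<^sup>-\<^sup>\<theta>\<^sup>-\<^sup>1 e\<^bsup>y\<^sub>i\<^esup> = O(log M)\<close>: on each of the \<open>O(log M)\<close> dyadic intervals that meet the nodes,
  the summand is dominated by a function whose quadrature sum is at most its integral, and these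
  integrals are bounded uniformly. For \<open>M = 1\<close> the logarithm vanishes, and a Poincare
  inequality for functions vanishing at a point replaces the projection.\<close>


section \<open>Locally absolutely continuous functions on the half-line\<close>

text \<open>The hypotheses provide weak derivatives only, so a function is paired with a derivative
  through the integral identity \<open>ac_deriv\<close>. The derivative then matters up to null
  sets, and the product rule, boundary terms and the substitution can all be handled at that level.
  The gap comes from duality, not from an expansion in Laguerre polynomials: for \<open>v\<close> of
  mean zero the equation adjoint to differentiation has an explicit solution. In the node sum the
  weights are never estimated one by one. A function with nonnegative coefficients in y, or in 1/(a
  + y), leaves a nonnegative quotient on division by the squared node polynomial; this is why its
  quadrature sum cannot exceed its integral. The exponential e^y itself is not integrable against
  y^\<theta> e^-y, but the rate 1 - 1/a is admissible and loses at most a factor e^2 on [a, 2a]. The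
  two norms of the bound share the work: the logarithmic one carries M >= 2, the other one M =
  1.\<close>

definition ac_deriv :: "(real \<Rightarrow> real) \<Rightarrow> (real \<Rightarrow> real) \<Rightarrow> bool" where
  "ac_deriv u g \<longleftrightarrow> (\<forall>a b. 0 < a \<longrightarrow> a \<le> b \<longrightarrow>
     g absolutely_integrable_on {a..b} \<and> u b - u a = integral {a..b} g)"

lemma ac_derivD:
  assumes "ac_deriv u g" "0 < a" "a \<le> b"
  shows "g absolutely_integrable_on {a..b}" "u b - u a = integral {a..b} g" "g integrable_on {a..b}"
  using assms unfolding ac_deriv_def by (auto simp: set_lebesgue_integral_eq_integral(1))

lemma ac_deriv_continuous:
  assumes "ac_deriv u g"
  shows "continuous_on {0<..} u"
proof (rule continuous_at_imp_continuous_on, rule ballI)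
  fix x :: real assume "x \<in> {0<..}"
  then have x: "x > 0" by simp
  have "continuous_on {x/2..x+1} (\<lambda>t. u (x/2) + integral {x/2..t} g)"
    using ac_derivD(3)[OF assms, of "x/2" "x+1"] x
    by (intro continuous_intros indefinite_integral_continuous_1) auto
  moreover have "u (x/2) + integral {x/2..t} g = u t" if "t \<in> {x/2..x+1}" for t
    using ac_derivD(2)[OF assms, of "x/2" t] x that by auto
  ultimately have "continuous_on {x/2..x+1} u"
    by (metis (mono_tags, lifting) continuous_on_cong)
  then have "continuous_on {x/2<..<x+1} u"
    by (rule continuous_on_subset) auto
  then show "isCont u x"
    using x by (simp add: continuous_on_eq_continuous_at)
qed

lemma ac_deriv_C1:
  assumes "\<And>x. x > 0 \<Longrightarrow> (u has_real_derivative g x) (at x)" "continuous_on {0<..} g"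
  shows "ac_deriv u g"
  unfolding ac_deriv_def
proof (intro allI impI conjI)
  fix a b :: real assume ab: "0 < a" "a \<le> b"
  show "g absolutely_integrable_on {a..b}"
    by (rule absolutely_integrable_continuous_real, rule continuous_on_subset[OF assms(2)]) (use ab in auto)
  have "(g has_integral (u b - u a)) {a..b}"
    by (rule fundamental_theorem_of_calculus)
       (use ab assms(1) in \<open>auto simp: has_real_derivative_iff_has_vector_derivative[symmetric] intro: has_field_derivative_at_within\<close>)
  then show "u b - u a = integral {a..b} g" by (simp add: integral_unique)
qed

lemma ac_deriv_has_real_derivative:
  assumes "ac_deriv u g" "continuous_on {0<..} g" "x > 0"
  shows "(u has_real_derivative g x) (at x)"
proof -
  have "((\<lambda>t. integral {x/2..t} g) has_real_derivative g x) (at x within {x/2..x+1})"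
    by (rule integral_has_real_derivative)
       (use assms in \<open>auto intro: continuous_on_subset\<close>)
  then have "((\<lambda>t. u (x/2) + integral {x/2..t} g) has_real_derivative g x) (at x within {x/2..x+1})"
    by (auto intro!: derivative_eq_intros)
  then have "(u has_real_derivative g x) (at x within {x/2..x+1})"
  proof (rule has_field_derivative_transform_within[where d=1])
    show "u (x/2) + integral {x/2..t} g = u t" if "t \<in> {x/2..x+1}" for t
      using ac_derivD(2)[OF assms(1), of "x/2" t] assms(3) that by auto
  qed (use assms(3) in auto)
  then show ?thesis
    using assms(3) by (simp add: at_within_Icc_at)
qed

lemma ac_deriv_add:
  assumes "ac_deriv u g" "ac_deriv v h"
  shows "ac_deriv (\<lambda>x. u x + v x) (\<lambda>x. g x + h x)"
  unfolding ac_deriv_def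
proof (intro allI impI conjI)
  fix a b :: real assume ab: "0 < a" "a \<le> b"
  note g = ac_derivD[OF assms(1) ab] and h = ac_derivD[OF assms(2) ab]
  show "(\<lambda>x. g x + h x) absolutely_integrable_on {a..b}" by (rule set_integral_add(1)[OF g(1) h(1)])
  show "u b + v b - (u a + v a) = integral {a..b} (\<lambda>x. g x + h x)"
    using g h by (simp add: integral_add)
qed

lemma ac_deriv_cmult:
  assumes "ac_deriv u g"
  shows "ac_deriv (\<lambda>x. c * u x) (\<lambda>x. c * g x)"
  using assms unfolding ac_deriv_def
  by (auto simp: right_diff_distrib[symmetric])

lemma ac_deriv_diff:
  assumes "ac_deriv u g" "ac_deriv v h"
  shows "ac_deriv (\<lambda>x. u x - v x) (\<lambda>x. g x - h x)"
  using ac_deriv_add[OF assms(1) ac_deriv_cmult[OF assms(2), of "-1"]] by simp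

lemma ac_deriv_minus_const:
  assumes "ac_deriv u g"
  shows "ac_deriv (\<lambda>x. u x - c) g"
  using assms unfolding ac_deriv_def by auto

lemma abs_int_mult_continuous:
  fixes g u :: "real \<Rightarrow> real"
  assumes g: "g absolutely_integrable_on {a..b}" and u: "continuous_on {a..b} u"
  shows "(\<lambda>x. g x * u x) absolutely_integrable_on {a..b}"
proof -
  have "(\<lambda>x. u x * g x) absolutely_integrable_on {a..b}"
  proof (rule absolutely_integrable_bounded_measurable_product_real)
    show "u \<in> borel_measurable (lebesgue_on {a..b})"
      using u by (simp add: continuous_imp_measurable_on_sets_lebesgue)
    show "bounded (u ` {a..b})"
      by (simp add: compact_continuous_image compact_imp_bounded u)
  qed (use g in auto)
  then show ?thesis by (simp add: mult.commute)
qed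

text \<open>On short intervals, where \<open>u\<close> and \<open>v\<close> oscillate by at most \<open>e\<close>, the defect in the
  product rule is at most \<open>e * \<integral>(\<bar>g\<bar> + \<bar>h\<bar>)\<close>; both sides are additive in the interval.\<close>

lemma ac_deriv_mult:
  assumes u: "ac_deriv u g" and v: "ac_deriv v h"
  shows "ac_deriv (\<lambda>x. u x * v x) (\<lambda>x. g x * v x + u x * h x)"
  unfolding ac_deriv_def
proof (intro allI impI conjI)
  fix a b :: real assume a: "0 < a" and ab: "a \<le> b"
  let ?f = "\<lambda>x. g x * v x + u x * h x"
  have cu: "continuous_on {s..t} u" and cv: "continuous_on {s..t} v" if "s > 0" for s t
    using ac_deriv_continuous[OF u] ac_deriv_continuous[OF v] that
    by (auto elim!: continuous_on_subset)
  have f1: "(\<lambda>x. g x * v x) absolutely_integrable_on {s..t}"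
    and f2: "(\<lambda>x. u x * h x) absolutely_integrable_on {s..t}" if "s > 0" "s \<le> t" for s t
    using abs_int_mult_continuous[OF ac_derivD(1)[OF u that] cv[OF that(1)]]
      abs_int_mult_continuous[OF ac_derivD(1)[OF v that] cu[OF that(1)]] by (auto simp: mult.commute)
  have f: "?f absolutely_integrable_on {s..t}" if "s > 0" "s \<le> t" for s t
    using set_integral_add(1)[OF f1[OF that] f2[OF that]] .
  show "?f absolutely_integrable_on {a..b}" using f[OF a ab] .
  let ?n = "\<lambda>x. \<bar>g x\<bar> + \<bar>h x\<bar>"
  have n: "?n integrable_on {s..t}" if "s > 0" "s \<le> t" for s t
    using ac_derivD(1)[OF u that] ac_derivD(1)[OF v that]
    by (auto intro!: integrable_add simp: absolutely_integrable_on_def)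
  define N where "N = integral {a..b} ?n"
  have N0: "N \<ge> 0" unfolding N_def by (rule integral_nonneg[OF n[OF a ab]]) auto
  define D where "D s t = u t * v t - u s * v s - integral {s..t} ?f" for s t
  have key: "\<bar>D a b\<bar> \<le> e * N" if e: "e > 0" for e
  proof -
    have unif: "uniformly_continuous_on {a..b} u" "uniformly_continuous_on {a..b} v"
      using cu[OF a] cv[OF a] by (auto intro: compact_uniformly_continuous)
    obtain d1 where d1: "d1 > 0" "\<And>x y. x \<in> {a..b} \<Longrightarrow> y \<in> {a..b} \<Longrightarrow> dist y x < d1 \<Longrightarrow> dist (u y) (u x) < e"
      using unif(1) e unfolding uniformly_continuous_on_def by meson
    obtain d2 where d2: "d2 > 0" "\<And>x y. x \<in> {a..b} \<Longrightarrow> y \<in> {a..b} \<Longrightarrow> dist y x < d2 \<Longrightarrow> dist (v y) (v x) < e"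
      using unif(2) e unfolding uniformly_continuous_on_def by meson
    have loc: "\<bar>D s t\<bar> \<le> e * integral {s..t} ?n"
      if st: "a \<le> s" "s \<le> t" "t \<le> b" "t - s < min d1 d2" for s t
    proof -
      have s: "s > 0" using st a by simp
      note gi = ac_derivD[OF u s st(2)] and hi = ac_derivD[OF v s st(2)]
      have gv: "(\<lambda>x. g x * (v t - v x)) absolutely_integrable_on {s..t}"
        by (rule abs_int_mult_continuous[OF gi(1)]) (intro continuous_intros cv s)
      have hu: "(\<lambda>x. h x * (u s - u x)) absolutely_integrable_on {s..t}"
        by (rule abs_int_mult_continuous[OF hi(1)]) (intro continuous_intros cu s)
      \<comment> \<open>Freezing \<open>v\<close> at the right end and \<open>u\<close> at the left
        end leaves only the errors \<open>v t - v x\<close> and \<open>u s - u x\<close>, both at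
        most \<open>e\<close> on a short interval.\<close>
      have "u t * v t - u s * v s = (u t - u s) * v t + u s * (v t - v s)" by (simp add: algebra_simps)
      also have "\<dots> = integral {s..t} (\<lambda>x. g x * v t) + integral {s..t} (\<lambda>x. u s * h x)"
        using gi hi by simp
      also have "\<dots> = integral {s..t} (\<lambda>x. g x * v t + u s * h x)"
        by (rule integral_add[symmetric]) (auto intro: integrable_on_mult_right integrable_on_mult_left gi hi)
      finally have uv: "u t * v t - u s * v s = integral {s..t} (\<lambda>x. g x * v t + u s * h x)" .
      have "D s t = integral {s..t} (\<lambda>x. g x * v t + u s * h x) - integral {s..t} ?f"
        unfolding D_def uv ..
      also have "\<dots> = integral {s..t} (\<lambda>x. (g x * v t + u s * h x) - ?f x)"
      proof (rule integral_diff[symmetric])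
        show "(\<lambda>x. g x * v t + u s * h x) integrable_on {s..t}"
          by (intro integrable_add integrable_on_mult_right integrable_on_mult_left gi hi)
        show "?f integrable_on {s..t}"
          by (rule set_lebesgue_integral_eq_integral(1)[OF f[OF s st(2)]])
      qed
      also have "\<dots> = integral {s..t} (\<lambda>x. g x * (v t - v x) + h x * (u s - u x))"
      proof (rule integral_cong)
        have "p * c + d * r - (p * c' + d' * r) = p * (c - c') + r * (d - d')" for p c d r c' d' :: real
          by (simp add: algebra_simps)
        then show "(g x * v t + u s * h x) - ?f x = g x * (v t - v x) + h x * (u s - u x)" for x .
      qed
      finally have D: "D s t = integral {s..t} (\<lambda>x. g x * (v t - v x) + h x * (u s - u x))" .
      have "norm (integral {s..t} (\<lambda>x. g x * (v t - v x) + h x * (u s - u x))) \<le> integral {s..t} (\<lambda>x. e * ?n x)"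
      proof (rule integral_norm_bound_integral)
        show "(\<lambda>x. g x * (v t - v x) + h x * (u s - u x)) integrable_on {s..t}"
          using gv hu by (intro integrable_add) (auto simp: set_lebesgue_integral_eq_integral(1))
        show "(\<lambda>x. e * ?n x) integrable_on {s..t}"
          using n[OF s st(2)] by (intro integrable_on_mult_right)
        fix x assume x: "x \<in> {s..t}"
        have "\<bar>v t - v x\<bar> \<le> e" "\<bar>u s - u x\<bar> \<le> e"
          using d1(2)[of x s] d2(2)[of x t] x st by (auto simp: dist_real_def)
        then have "\<bar>g x\<bar> * \<bar>v t - v x\<bar> + \<bar>h x\<bar> * \<bar>u s - u x\<bar> \<le> \<bar>g x\<bar> * e + \<bar>h x\<bar> * e"
          by (intro add_mono mult_left_mono) auto
        then show "norm (g x * (v t - v x) + h x * (u s - u x)) \<le> e * ?n x"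
          using abs_triangle_ineq[of "g x * (v t - v x)" "h x * (u s - u x)"]
          unfolding real_norm_def abs_mult distrib_left by (simp only: mult.commute[of e])
      qed
      then show ?thesis unfolding D by simp
    qed
    have add: "D s t + D t r = D s r" "integral {s..t} ?n + integral {t..r} ?n = integral {s..r} ?n"
      if "a \<le> s" "s \<le> t" "t \<le> r" "r \<le> b" for s t r
      using that a Henstock_Kurzweil_Integration.integral_combine[OF that(2,3), of ?n]
        Henstock_Kurzweil_Integration.integral_combine[OF that(2,3), of ?f] n[of s r] f[of s r]
      by (auto simp: D_def set_lebesgue_integral_eq_integral(1))
    \<comment> \<open>Bisection: the estimate holds on short intervals and passes to the union of
      two adjacent ones. The guards, trivial in the result, keep all intervals inside [a, b], where
      uniform continuity is available.\<close>
    have "a \<le> a \<and> b \<le> b \<longrightarrow> \<bar>D a b\<bar> \<le> e * integral {a..b} ?n"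
    proof (induction rule: Bolzano[OF ab, where P = "\<lambda>s t. a \<le> s \<and> t \<le> b \<longrightarrow> \<bar>D s t\<bar> \<le> e * integral {s..t} ?n"])
      case (1 s t r)
      then show ?case using add[of s t r]
        by (auto simp: distrib_left add[of s t r, symmetric])
    next
      case (2 x)
      show ?case
        by (rule exI[of _ "min d1 d2"]) (use d1 d2 loc in auto)
    qed
    then show ?thesis by (simp add: N_def)
  qed
  have "\<bar>D a b\<bar> \<le> 0"
  proof (rule field_le_epsilon)
    fix e :: real assume e: "e > 0"
    have "\<bar>D a b\<bar> \<le> e / (N + 1) * N" using key[of "e/(N+1)"] e N0 by simp
    also have "\<dots> \<le> e" using e N0 by (simp add: field_simps)
    finally show "\<bar>D a b\<bar> \<le> 0 + e" by simp
  qed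
  then show "u b * v b - u a * v a = integral {a..b} ?f" by (simp add: D_def)
qed

section \<open>Exhaustion of the half-line and vanishing boundary terms\<close>

lemma continuous_measurable_pos:
  fixes u :: "real \<Rightarrow> real"
  assumes "continuous_on {0<..} u"
  shows "u \<in> borel_measurable (lebesgue_on {0<..})"
  using assms by (simp add: continuous_imp_measurable_on_sets_lebesgue)

text \<open>The restrictions to [1/n, n] are measurable and converge pointwise. This serves the
  highest derivative, which need not have a continuous representative.\<close>

lemma locally_abs_int_measurable:
  fixes g :: "real \<Rightarrow> real"
  assumes "\<And>a b. 0 < a \<Longrightarrow> a \<le> b \<Longrightarrow> g absolutely_integrable_on {a..b}"
  shows "g \<in> borel_measurable (lebesgue_on {0<..})"
proof -
  have "(\<lambda>x. indicator {1 / real (Suc n)..real (Suc n)} x *\<^sub>R g x) \<in> borel_measurable lebesgue" for n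
    using assms[of "1 / real (Suc n)" "real (Suc n)"] unfolding set_integrable_def
    by (auto simp: field_simps)
  then have "(\<lambda>x. indicator {0<..} x *\<^sub>R g x) \<in> borel_measurable lebesgue"
  proof (rule borel_measurable_LIMSEQ_real[rotated])
    fix x :: real
    show "(\<lambda>n. indicator {1 / real (Suc n)..real (Suc n)} x *\<^sub>R g x) \<longlonglongrightarrow> indicator {0<..} x *\<^sub>R g x"
    proof (cases "x > 0")
      case True
      obtain k :: nat where k: "real k > x" "real k > 1 / x" using reals_Archimedean2[of "max x (1/x)"] by auto
      have "indicator {1 / real (Suc n)..real (Suc n)} x *\<^sub>R g x = indicator {0<..} x *\<^sub>R g x" if "n \<ge> k" for n
      proof -
        have "x \<in> {1 / real (Suc n)..real (Suc n)}"
          using k that True by (auto simp: field_simps) (smt (verit, best) mult_left_mono of_nat_mono)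
        then show ?thesis using True by simp
      qed
      then show ?thesis by (intro tendsto_eventually eventually_sequentiallyI[of k]) auto
    next
      case False
      then have "indicator {1 / real (Suc n)..real (Suc n)} x *\<^sub>R g x = 0" for n
        by (auto simp: indicator_def) (smt (verit) divide_pos_pos of_nat_0_le_iff)
      then show ?thesis using False by (simp only: indicator_simps greaterThan_iff not_False_eq_True scaleR_zero_left tendsto_const)
    qed
  qed
  then show ?thesis
    by (subst borel_measurable_restrict_space_iff) auto
qed

text \<open>Dominated convergence. The end points are arbitrary sequences because they will be
  placed where boundary terms happen to be small.\<close>

lemma integral_exhaust:
  fixes f :: "real \<Rightarrow> real"
  assumes f: "f absolutely_integrable_on {0<..}"
    and a: "a \<longlonglongrightarrow> 0" "\<And>n. a n > 0" and b: "filterlim b at_top sequentially"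
  shows "(\<lambda>n. integral {a n..b n} f) \<longlonglongrightarrow> integral {0<..} f"
proof -
  have sub: "f absolutely_integrable_on {a n..b n}" for n
    by (rule set_integrable_subset[OF f]) (use a(2)[of n] in auto)
  have "(\<lambda>n. LINT x|lebesgue. indicator {a n..b n} x *\<^sub>R f x) \<longlonglongrightarrow> (LINT x|lebesgue. indicator {0<..} x *\<^sub>R f x)"
  proof (rule integral_dominated_convergence[where w="\<lambda>x. norm (indicator {0<..} x *\<^sub>R f x)"])
    show "integrable lebesgue (\<lambda>x. norm (indicator {0<..} x *\<^sub>R f x))"
      using f unfolding set_integrable_def by auto
    show "(\<lambda>x. indicator {0<..} x *\<^sub>R f x) \<in> borel_measurable lebesgue"
      using f unfolding set_integrable_def by auto
    show "(\<lambda>x. indicator {a n..b n} x *\<^sub>R f x) \<in> borel_measurable lebesgue" for n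
      using sub[of n] unfolding set_integrable_def by auto
    show "AE x in lebesgue. norm (indicator {a n..b n} x *\<^sub>R f x) \<le> norm (indicator {0<..} x *\<^sub>R f x)" for n
      using a(2)[of n] by (auto simp: indicator_def)
    have "(\<lambda>n. indicator {a n..b n} x *\<^sub>R f x) \<longlonglongrightarrow> indicator {0<..} x *\<^sub>R f x" for x
    proof (cases "x > 0")
      case True
      have "eventually (\<lambda>n. a n < x) sequentially" using a(1) True by (rule order_tendstoD)
      moreover have "eventually (\<lambda>n. b n > x) sequentially" using b by (simp add: filterlim_at_top_dense)
      ultimately have "eventually (\<lambda>n. indicator {a n..b n} x *\<^sub>R f x = indicator {0<..} x *\<^sub>R f x) sequentially"
        by eventually_elim (use True in auto)
      then show ?thesis by (rule tendsto_eventually)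
    next
      case False
      then have "indicator {a n..b n} x *\<^sub>R f x = 0" for n using a(2)[of n] by (auto simp: indicator_def)
      then show ?thesis using False by (simp only: indicator_simps greaterThan_iff not_False_eq_True scaleR_zero_left tendsto_const)
    qed
    then show "AE x in lebesgue. (\<lambda>n. indicator {a n..b n} x *\<^sub>R f x) \<longlonglongrightarrow> indicator {0<..} x *\<^sub>R f x"
      by simp
  qed
  then show ?thesis
    using set_lebesgue_integral_eq_integral(2)[OF f] set_lebesgue_integral_eq_integral(2)[OF sub]
    by (simp add: set_lebesgue_integral_def)
qed

text \<open>The measure dy/y has infinite mass near 0 and near infinity: if \<open>q\<close> stayed
  above \<open>e\<close> on the whole of either end, the integral would grow like
  \<open>e * ln (t / s)\<close> without bound.\<close>

lemma not_integrable_inverse_pos: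
  fixes q :: "real \<Rightarrow> real"
  assumes q: "(\<lambda>y. q y / y) absolutely_integrable_on {0<..}" and e: "e > 0" and B: "B > 0"
  shows "\<exists>b>B. q b < e" "\<exists>b. 0 < b \<and> b < B \<and> q b < e"
proof -
  have I: "e * (ln t - ln s) \<le> integral {0<..} (\<lambda>y. \<bar>q y / y\<bar>)"
    if st: "0 < s" "s \<le> t" and ge: "\<And>y. y \<in> {s<..<t} \<Longrightarrow> q y \<ge> e" for s t
  proof -
    have i1: "((\<lambda>y. e * (1 / y)) has_integral e * (ln t - ln s)) {s..t}"
      by (rule has_integral_mult_right, rule fundamental_theorem_of_calculus)
         (use st in \<open>auto simp: has_real_derivative_iff_has_vector_derivative[symmetric] intro!: derivative_eq_intros\<close>)
    have ab: "(\<lambda>y. \<bar>q y / y\<bar>) absolutely_integrable_on {0<..}"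
      using set_integrable_abs[OF q] .
    have i2: "(\<lambda>y. \<bar>q y / y\<bar>) integrable_on {s..t}"
      by (rule set_lebesgue_integral_eq_integral(1), rule set_integrable_subset[OF ab]) (use st in auto)
    have "e * (ln t - ln s) = integral {s<..<t} (\<lambda>y. e * (1 / y))"
      using integral_unique[OF i1] by (simp only: integral_open_interval_real)
    also have "\<dots> \<le> integral {s<..<t} (\<lambda>y. \<bar>q y / y\<bar>)"
    proof (rule integral_le)
      show "(\<lambda>y. e * (1 / y)) integrable_on {s<..<t}" "(\<lambda>y. \<bar>q y / y\<bar>) integrable_on {s<..<t}"
        using i1 i2 integrable_on_open_interval_real by (blast dest: has_integral_integrable)+
      fix y assume "y \<in> {s<..<t}"
      then show "e * (1 / y) \<le> \<bar>q y / y\<bar>"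
        using ge[of y] st e by (simp add: abs_if divide_simps)
    qed
    also have "\<dots> = integral {s..t} (\<lambda>y. \<bar>q y / y\<bar>)" by (simp add: integral_open_interval_real)
    also have "\<dots> \<le> integral {0<..} (\<lambda>y. \<bar>q y / y\<bar>)"
      by (rule integral_subset_le) (use st i2 set_lebesgue_integral_eq_integral(1)[OF ab] in auto)
    finally show ?thesis .
  qed
  define K where "K = integral {0<..} (\<lambda>y. \<bar>q y / y\<bar>)"
  \<comment> \<open>Chosen so that \<open>e * ln R = \<bar>K\<bar> + e\<close>, which exceeds the
    available total \<open>K\<close>.\<close>
  define R where "R = exp (\<bar>K\<bar> / e + 1)"
  have "e * ln R = \<bar>K\<bar> + e" using e by (simp add: R_def field_simps)
  then have R: "R \<ge> 1" "e * ln R > K" using e by (auto simp: R_def)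
  show "\<exists>b>B. q b < e"
  proof (rule ccontr)
    assume A: "\<not> ?thesis"
    have "e * (ln (B * R) - ln B) \<le> K"
      unfolding K_def
    proof (intro I)
      show "e \<le> q y" if "y \<in> {B<..<B * R}" for y using A that by (metis greaterThanLessThan_iff not_less)
    qed (use B R in auto)
    then show False using R B by (simp add: ln_mult)
  qed
  show "\<exists>b. 0 < b \<and> b < B \<and> q b < e"
  proof (rule ccontr)
    assume A: "\<not> ?thesis"
    have "e * (ln B - ln (B / R)) \<le> K"
      unfolding K_def
    proof (intro I)
      fix y assume "y \<in> {B / R<..<B}"
      moreover from this have "y > 0" using B R by (smt (verit) divide_pos_pos greaterThanLessThan_iff)
      ultimately show "e \<le> q y" using A by (metis greaterThanLessThan_iff not_less)
    qed (use B R in \<open>auto simp: field_simps\<close>)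
    then show False using R B by (simp add: ln_div)
  qed
qed

text \<open>Integrability of \<open>\<bar>\<phi>\<bar> ^ k / y\<close> forces \<phi> to be small at
  some points arbitrarily close to 0 and at some points arbitrarily far out. Evaluating the integral
  of \<psi> between such points gives 0 in the limit. The power \<open>k\<close> is left free since
  boundary terms are controlled sometimes linearly, sometimes in square.\<close>

lemma ac_deriv_integral_eq_0:
  assumes phi: "ac_deriv \<phi> \<psi>" and psi: "\<psi> absolutely_integrable_on {0<..}"
    and q: "(\<lambda>y. \<bar>\<phi> y\<bar> ^ k / y) absolutely_integrable_on {0<..}" and k: "k > 0"
  shows "integral {0<..} \<psi> = 0"
proof -
  have "\<exists>a. 0 < a \<and> a < 1 / real (Suc n) \<and> \<bar>\<phi> a\<bar> ^ k < (1 / real (Suc n)) ^ k" for n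
    by (rule not_integrable_inverse_pos(2)[OF q]) auto
  then obtain a where a: "\<And>n. 0 < a n \<and> a n < 1 / real (Suc n) \<and> \<bar>\<phi> (a n)\<bar> ^ k < (1 / real (Suc n)) ^ k"
    by metis
  have "\<exists>b>real (Suc n). \<bar>\<phi> b\<bar> ^ k < (1 / real (Suc n)) ^ k" for n
    by (rule not_integrable_inverse_pos(1)[OF q]) auto
  then obtain b where b: "\<And>n. b n > real (Suc n) \<and> \<bar>\<phi> (b n)\<bar> ^ k < (1 / real (Suc n)) ^ k"
    by metis
  have z: "(\<lambda>n. 1 / real (Suc n)) \<longlonglongrightarrow> 0" by (rule LIMSEQ_Suc[OF lim_1_over_n])
  have fa: "\<bar>\<phi> (a n)\<bar> < 1 / real (Suc n)" and fb: "\<bar>\<phi> (b n)\<bar> < 1 / real (Suc n)" for n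
    using a[of n] b[of n] by (auto intro: power_less_imp_less_base)
  have fal: "(\<lambda>n. \<phi> (a n)) \<longlonglongrightarrow> 0" and fbl: "(\<lambda>n. \<phi> (b n)) \<longlonglongrightarrow> 0"
    by (rule Lim_null_comparison[OF _ z]; use fa fb in \<open>auto intro!: always_eventually less_imp_le\<close>)+
  have al: "a \<longlonglongrightarrow> 0"
    by (rule tendsto_sandwich[OF _ _ tendsto_const z]) (use a in \<open>auto intro!: always_eventually less_imp_le\<close>)
  have bl: "filterlim b at_top sequentially"
  proof (rule filterlim_at_top_mono[OF filterlim_real_sequentially])
    show "eventually (\<lambda>n. real n \<le> b n) sequentially"
    proof (intro always_eventually allI)
      show "real n \<le> b n" for n using b[of n] by simp
    qed
  qed
  have "(\<lambda>n. integral {a n..b n} \<psi>) \<longlonglongrightarrow> integral {0<..} \<psi>"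
    by (rule integral_exhaust[OF psi al _ bl]) (use a in auto)
  moreover have "integral {a n..b n} \<psi> = \<phi> (b n) - \<phi> (a n)" for n
  proof -
    have "a n \<le> b n" using a[of n] b[of n] by (smt (verit) divide_le_eq_1 of_nat_0_le_iff of_nat_Suc)
    then show ?thesis using ac_derivD(2)[OF phi, of "a n" "b n"] a[of n] by simp
  qed
  moreover have "(\<lambda>n. \<phi> (b n) - \<phi> (a n)) \<longlonglongrightarrow> 0" using tendsto_diff[OF fbl fal] by simp
  ultimately show ?thesis using LIMSEQ_unique by auto
qed

section \<open>Laguerre-weighted spaces\<close>

definition L2 :: "'a measure \<Rightarrow> ('a \<Rightarrow> real) set" where
  "L2 M = {f \<in> borel_measurable M. integrable M (\<lambda>x. (f x)\<^sup>2)}"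

definition ip :: "'a measure \<Rightarrow> ('a \<Rightarrow> real) \<Rightarrow> ('a \<Rightarrow> real) \<Rightarrow> real" where
  "ip M f g = (LINT x|M. f x * g x)"

definition sq :: "'a measure \<Rightarrow> ('a \<Rightarrow> real) \<Rightarrow> real" where
  "sq M f = (LINT x|M. (f x)\<^sup>2)"

lemma L2_integrable: "f \<in> L2 M \<Longrightarrow> integrable M (\<lambda>x. (f x)\<^sup>2)"
  by (auto simp: L2_def)

lemma sq_nonneg [simp]: "sq M f \<ge> 0"
  by (simp add: sq_def)

lemma L2_mult_integrable:
  assumes "f \<in> L2 M" "g \<in> L2 M"
  shows "integrable M (\<lambda>x. f x * g x)"
proof (rule Bochner_Integration.integrable_bound)
  show "integrable M (\<lambda>x. (f x)\<^sup>2 + (g x)\<^sup>2)"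
    using assms by (intro Bochner_Integration.integrable_add L2_integrable)
  show "(\<lambda>x. f x * g x) \<in> borel_measurable M"
    using assms by (auto simp: L2_def)
  have "\<bar>a * b\<bar> \<le> a\<^sup>2 + b\<^sup>2" for a b :: real
    using sum_squares_bound[of "\<bar>a\<bar>" "\<bar>b\<bar>"] abs_ge_zero[of "a*b"] unfolding abs_mult power2_abs by linarith
  then show "AE x in M. norm (f x * g x) \<le> norm ((f x)\<^sup>2 + (g x)\<^sup>2)"
    by (intro AE_I2) auto
qed

lemma L2_add:
  assumes "f \<in> L2 M" "g \<in> L2 M"
  shows "(\<lambda>x. f x + g x) \<in> L2 M"
  using assms L2_mult_integrable[OF assms] by (auto simp: L2_def power2_sum mult.assoc)

lemma L2_cmult:
  assumes "f \<in> L2 M"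
  shows "(\<lambda>x. c * f x) \<in> L2 M"
  using assms unfolding L2_def by (auto simp: power_mult_distrib)

lemma L2_diff:
  assumes "f \<in> L2 M" "g \<in> L2 M"
  shows "(\<lambda>x. f x - g x) \<in> L2 M"
  using L2_add[OF assms(1) L2_cmult[OF assms(2), of "-1"]] by simp

lemma sq_add:
  assumes "f \<in> L2 M" "g \<in> L2 M"
  shows "sq M (\<lambda>x. f x + g x) = sq M f + 2 * ip M f g + sq M g"
  using L2_mult_integrable[OF assms] L2_integrable[OF assms(1)] L2_integrable[OF assms(2)]
  unfolding sq_def ip_def power2_sum by (simp add: mult.assoc)

lemma sq_cmult: "sq M (\<lambda>x. c * f x) = c\<^sup>2 * sq M f"
  by (simp add: sq_def power_mult_distrib)

lemma ip_cmult: "ip M f (\<lambda>x. c * g x) = c * ip M f g"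
  by (simp add: ip_def mult.left_commute)

lemma ip_commute: "ip M f g = ip M g f"
  by (simp add: ip_def mult.commute)

lemma ip_add:
  assumes "f \<in> L2 M" "g \<in> L2 M" "h \<in> L2 M"
  shows "ip M f (\<lambda>x. g x + h x) = ip M f g + ip M f h"
  using L2_mult_integrable[OF assms(1,2)] L2_mult_integrable[OF assms(1,3)]
  by (simp add: ip_def distrib_left)

lemma ip_diff:
  assumes "f \<in> L2 M" "g \<in> L2 M" "h \<in> L2 M"
  shows "ip M f (\<lambda>x. g x - h x) = ip M f g - ip M f h"
  using L2_mult_integrable[OF assms(1,2)] L2_mult_integrable[OF assms(1,3)]
  by (simp add: ip_def right_diff_distrib)

lemma L2_Cauchy_Schwarz:
  assumes "f \<in> L2 M" "g \<in> L2 M"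
  shows "(ip M f g)\<^sup>2 \<le> sq M f * sq M g"
proof -
  have q: "0 \<le> sq M f + 2 * t * ip M f g + t\<^sup>2 * sq M g" for t
    using sq_add[OF assms(1) L2_cmult[OF assms(2), of t]] sq_nonneg[of M "\<lambda>x. f x + t * g x"]
    by (simp add: ip_cmult sq_cmult)
  show ?thesis
  proof (cases "sq M g = 0")
    case True
    have "ip M f g = 0"
    proof (rule ccontr)
      assume n: "ip M f g \<noteq> 0"
      \<comment> \<open>With this value of \<open>t\<close> the nonnegative quadratic
        \<open>q\<close> would equal -1.\<close>
      have "2 * (- (sq M f + 1) / (2 * ip M f g)) * ip M f g = - (sq M f + 1)" using n by simp
      then show False using q[of "- (sq M f + 1) / (2 * ip M f g)"] True by simp
    qed
    then show ?thesis using True by simp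
  next
    case False
    then have p: "sq M g > 0" using sq_nonneg[of M g] by linarith
    have "0 \<le> sq M g * (sq M f + 2 * (- ip M f g / sq M g) * ip M f g + (- ip M f g / sq M g)\<^sup>2 * sq M g)"
      using q[of "- ip M f g / sq M g"] p by (intro mult_nonneg_nonneg) auto
    also have "\<dots> = sq M f * sq M g - (ip M f g)\<^sup>2"
      using p by (simp add: field_simps power2_eq_square)
    finally show ?thesis by simp
  qed
qed

lemma L2_triangle:
  assumes "f \<in> L2 M" "g \<in> L2 M"
  shows "sqrt (sq M (\<lambda>x. f x + g x)) \<le> sqrt (sq M f) + sqrt (sq M g)"
proof (rule real_le_lsqrt)
  have "ip M f g \<le> sqrt (sq M f * sq M g)"
    using L2_Cauchy_Schwarz[OF assms] by (simp add: real_le_rsqrt)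
  then show "sq M (\<lambda>x. f x + g x) \<le> (sqrt (sq M f) + sqrt (sq M g))\<^sup>2"
    by (simp add: sq_add[OF assms] power2_sum real_sqrt_mult)
qed auto

section \<open>The Laguerre weight and its measure\<close>

definition wt :: "real \<Rightarrow> real \<Rightarrow> real" where
  "wt \<theta> y = y powr \<theta> * exp (- y)"

definition lagm :: "real \<Rightarrow> real measure" where
  "lagm \<theta> = density (lebesgue_on {0<..}) (\<lambda>y. ennreal (wt \<theta> y))"

lemma wt_nonneg [simp]: "wt \<theta> y \<ge> 0" by (simp add: wt_def)

lemma wt_pos: "y > 0 \<Longrightarrow> wt \<theta> y > 0" by (simp add: wt_def)

lemma wt_plus1: "y > 0 \<Longrightarrow> wt (\<theta> + 1) y = y * wt \<theta> y"
  by (simp add: wt_def powr_add)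

lemma wt_plus2: "y > 0 \<Longrightarrow> wt (\<theta> + 2) y = y\<^sup>2 * wt \<theta> y"
  using wt_plus1[of y "\<theta> + 1"] wt_plus1[of y \<theta>] by (simp add: power2_eq_square add.assoc)

lemma wt_continuous: "continuous_on {0<..} (wt \<theta>)"
  unfolding wt_def by (intro continuous_intros) auto

lemma wt_deriv: "y > 0 \<Longrightarrow> (wt \<theta> has_real_derivative (\<theta> / y - 1) * wt \<theta> y) (at y)"
  unfolding wt_def
  by (auto intro!: derivative_eq_intros simp: powr_diff field_simps)

text \<open>The Pearson equation of the Laguerre weight: raising \<theta> by one absorbs the factor
  y, so that the derivative is a linear polynomial times the old weight. It is why each
  differentiation shifts \<theta> by one.\<close>

lemma wt_deriv1: "y > 0 \<Longrightarrow> (wt (\<theta> + 1) has_real_derivative (\<theta> + 1 - y) * wt \<theta> y) (at y)"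
  by (rule DERIV_cong[OF wt_deriv]) (simp_all add: wt_plus1, simp add: field_simps)

lemma wt_measurable [measurable]: "wt \<theta> \<in> borel_measurable (lebesgue_on {0<..})"
  by (rule continuous_measurable_pos[OF wt_continuous])

lemma sets_lagm [simp, measurable_cong]: "sets (lagm \<theta>) = sets (lebesgue_on {0<..})"
  and space_lagm [simp]: "space (lagm \<theta>) = {0<..}"
  by (auto simp: lagm_def)

lemma measurable_lagm [simp]: "borel_measurable (lagm \<theta>) = borel_measurable (lebesgue_on {0<..})"
  by (intro measurable_cong_sets) auto

lemma lagm_integrable_iff:
  assumes "f \<in> borel_measurable (lebesgue_on {0<..})"
  shows "integrable (lagm \<theta>) f \<longleftrightarrow> (\<lambda>y. wt \<theta> y * f y) absolutely_integrable_on {0<..}"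
  unfolding lagm_def using assms
  by (subst integrable_density) (auto simp: set_integrable_def integrable_restrict_space)

lemma lagm_integral:
  assumes "integrable (lagm \<theta>) f"
  shows "(LINT y|lagm \<theta>. f y) = integral {0<..} (\<lambda>y. wt \<theta> y * f y)"
proof -
  have m: "f \<in> borel_measurable (lebesgue_on {0<..})"
    using borel_measurable_integrable[OF assms] by simp
  have "(LINT y|lagm \<theta>. f y) = (LINT y:{0<..}|lebesgue. wt \<theta> y * f y)"
    unfolding lagm_def using m
    by (subst integral_density) (auto simp: set_lebesgue_integral_def integral_restrict_space)
  also have "\<dots> = integral {0<..} (\<lambda>y. wt \<theta> y * f y)"
    by (rule set_lebesgue_integral_eq_integral(2)) (use assms lagm_integrable_iff[OF m] in auto)
  finally show ?thesis .
qed

lemma absolutely_integrable_wt: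
  assumes "\<theta> > -1"
  shows "wt \<theta> absolutely_integrable_on {0<..}" "integral {0<..} (wt \<theta>) = Gamma (\<theta> + 1)"
proof -
  have "((\<lambda>t. t powr (\<theta> + 1 - 1) / exp t) has_integral Gamma (\<theta> + 1)) {0..}"
    by (rule Gamma_integral_real) (use assms in auto)
  then have "(wt \<theta> has_integral Gamma (\<theta> + 1)) {0..}"
    by (simp add: wt_def[abs_def] exp_minus divide_inverse)
  then have *: "(wt \<theta> has_integral Gamma (\<theta> + 1)) {0<..}"
    by (rule iffD1[OF has_integral_spike_set_eq, rotated 2])
       (auto intro: negligible_subset[OF negligible_sing[of "0::real"]])
  then show "integral {0<..} (wt \<theta>) = Gamma (\<theta> + 1)" by (rule integral_unique)
  show "wt \<theta> absolutely_integrable_on {0<..}"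
    by (rule nonnegative_absolutely_integrable_1) (use * in auto)
qed

lemma lagm_power_integrable:
  assumes "\<theta> > -1"
  shows "integrable (lagm \<theta>) (\<lambda>y. y ^ k)" "(LINT y|lagm \<theta>. y ^ k) = Gamma (\<theta> + real k + 1)"
proof -
  have m: "(\<lambda>y::real. y ^ k) \<in> borel_measurable (lebesgue_on {0<..})"
    by (intro continuous_measurable_pos continuous_intros)
  have eq: "wt (\<theta> + real k) y = wt \<theta> y * y ^ k" if "y > 0" for y
    using that by (simp add: wt_def powr_add powr_realpow)
  have "(\<lambda>y. wt \<theta> y * y ^ k) absolutely_integrable_on {0<..} \<longleftrightarrow> wt (\<theta> + real k) absolutely_integrable_on {0<..}"
    by (rule set_integrable_cong) (auto simp: eq)
  then show *: "integrable (lagm \<theta>) (\<lambda>y. y ^ k)"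
    using absolutely_integrable_wt[of "\<theta> + real k"] assms by (simp add: lagm_integrable_iff[OF m])
  have "(LINT y|lagm \<theta>. y ^ k) = integral {0<..} (wt (\<theta> + real k))"
    unfolding lagm_integral[OF *] by (rule integral_cong) (simp add: eq)
  then show "(LINT y|lagm \<theta>. y ^ k) = Gamma (\<theta> + real k + 1)"
    using absolutely_integrable_wt[of "\<theta> + real k"] assms by simp
qed

lemma poly_measurable_pos [measurable]: "poly (p :: real poly) \<in> borel_measurable (lebesgue_on {0<..})"
  by (intro continuous_measurable_pos continuous_intros)

lemma poly_integrable:
  assumes "\<theta> > -1"
  shows "integrable (lagm \<theta>) (poly p)"
  unfolding poly_altdef[abs_def] using lagm_power_integrable[OF assms] by auto

lemma poly_L2:
  assumes "\<theta> > -1"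
  shows "poly p \<in> L2 (lagm \<theta>)"
  using poly_integrable[OF assms, of "p * p"] by (simp add: L2_def power2_eq_square poly_mult[abs_def])

lemma L2_continuousI:
  assumes "continuous_on {0<..} f" "integrable (lagm \<theta>) (\<lambda>y. (f y)\<^sup>2)"
  shows "f \<in> L2 (lagm \<theta>)"
  using assms continuous_measurable_pos by (auto simp: L2_def)

section \<open>Half-line integrals from bounds on compact intervals\<close>

lemma filterlim_Suc_real: "filterlim (\<lambda>n. real (Suc n)) at_top sequentially"
  by (rule filterlim_compose[OF filterlim_real_sequentially filterlim_Suc])

lemma integral_exhaust_le:
  fixes f :: "real \<Rightarrow> real"
  assumes f: "f absolutely_integrable_on {0<..}"
    and le: "\<And>a b. 0 < a \<Longrightarrow> a \<le> b \<Longrightarrow> integral {a..b} f \<le> K"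
  shows "integral {0<..} f \<le> K"
proof (rule LIMSEQ_le_const2)
  show "(\<lambda>n. integral {1 / real (Suc n)..real (Suc n)} f) \<longlonglongrightarrow> integral {0<..} f"
    by (rule integral_exhaust[OF f LIMSEQ_Suc[OF lim_1_over_n] _ filterlim_Suc_real]) auto
  show "\<exists>N. \<forall>n\<ge>N. integral {1 / real (Suc n)..real (Suc n)} f \<le> K"
    by (intro exI allI impI le) (auto simp: field_simps intro: mult_mono[of 1 _ 1, simplified])
qed

text \<open>Monotone convergence, giving integrability and the bound together. The bounds
  \<open>K n\<close> may vary because they contain boundary terms that disappear only in the
  limit.\<close>

lemma nonneg_abs_integrable_exhaust:
  fixes f :: "real \<Rightarrow> real"
  assumes nn: "\<And>y. y > 0 \<Longrightarrow> f y \<ge> 0"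
    and loc: "\<And>a b. 0 < a \<Longrightarrow> a \<le> b \<Longrightarrow> f absolutely_integrable_on {a..b}"
    and le: "\<And>n. integral {1 / real (Suc n)..real (Suc n)} f \<le> K n" and K: "K \<longlonglongrightarrow> L"
  shows "f absolutely_integrable_on {0<..}" "integral {0<..} f \<le> L"
proof -
  let ?I = "\<lambda>n. {1 / real (Suc n)..real (Suc n)}"
  let ?f = "\<lambda>n y. if y \<in> ?I n then f y else 0"
  have sub: "?I n \<subseteq> {0<..}" for n
    by (auto intro: less_le_trans[rotated])
  have one: "1 / real (Suc n) \<le> real (Suc n)" for n
    by (simp add: field_simps)
  have int_f: "f integrable_on ?I n" for n
    using loc[of "1 / real (Suc n)" "real (Suc n)", OF _ one] by (auto simp: set_lebesgue_integral_eq_integral(1))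
  have int: "?f n integrable_on {0<..}" for n
    using int_f[of n] sub[of n] by (subst integrable_restrict_Int) (simp add: Int_absorb1 Int_absorb2)
  have eq: "integral {0<..} (?f n) = integral (?I n) f" for n
    using sub[of n] by (simp only: integral_restrict_Int Int_absorb1 Int_absorb2)
  have bdd: "bounded (range (\<lambda>n. integral {0<..} (?f n)))"
  proof -
    obtain B where B: "\<And>n. \<bar>K n\<bar> \<le> B"
      using convergent_imp_Bseq[OF convergentI[OF K]] by (auto simp: Bseq_def)
    have "\<bar>integral {0<..} (?f n)\<bar> \<le> B" for n
    proof -
      have "integral (?I n) f \<ge> 0" by (rule integral_nonneg[OF int_f], rule nn) (use sub[of n] in blast)
      then show ?thesis using le[of n] B[of n] eq[of n] by linarith
    qed
    then show ?thesis by (auto simp: bounded_iff)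
  qed
  have mc: "f integrable_on {0<..} \<and> (\<lambda>n. integral {0<..} (?f n)) \<longlonglongrightarrow> integral {0<..} f"
  proof (rule monotone_convergence_increasing[OF int _ _ bdd])
    fix n y assume y: "y \<in> {0::real<..}" 
    have "?I n \<subseteq> ?I (Suc n)" by (auto simp: field_simps)
    then show "?f n y \<le> ?f (Suc n) y" using nn[of y] y by auto
  next
    fix y :: real assume y: "y \<in> {0<..}"
    obtain k :: nat where k: "real k > y" "real k > 1 / y" using reals_Archimedean2[of "max y (1/y)"] by auto
    have "?f n y = f y" if "n \<ge> k" for n
    proof -
      have "y \<in> ?I n"
        using k that y by (auto simp: field_simps) (smt (verit, best) mult_left_mono of_nat_mono)
      then show ?thesis by simp
    qed
    then show "(\<lambda>n. ?f n y) \<longlonglongrightarrow> f y" by (intro tendsto_eventually eventually_sequentiallyI[of k]) auto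
  qed
  then show "f absolutely_integrable_on {0<..}"
    using nn by (intro nonnegative_absolutely_integrable_1) auto
  show "integral {0<..} f \<le> L"
    by (rule LIMSEQ_le[OF conjunct2[OF mc] K]) (use le eq in auto)
qed

section \<open>The spectral gap\<close>

lemma indicator_measurable_pos [measurable]:
  fixes X :: "real set"
  assumes "X \<in> sets borel"
  shows "(indicator X :: real \<Rightarrow> real) \<in> borel_measurable (lebesgue_on {0<..})"
  using assms by (intro measurable_restrict_space1 borel_measurable_indicator) auto

lemma integral_cut:
  fixes f :: "real \<Rightarrow> real"
  assumes f: "f absolutely_integrable_on {0<..}" and nn: "\<And>t. t > 0 \<Longrightarrow> f t \<ge> 0" and y: "y > 0"
  shows "(\<And>a. 0 < a \<Longrightarrow> a \<le> y \<Longrightarrow> integral {a..y} f \<le> K) \<Longrightarrow> integral {0<..} (\<lambda>t. f t * indicator {..y} t) \<le> K"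
    and "(\<And>b. y \<le> b \<Longrightarrow> integral {y..b} f \<le> K) \<Longrightarrow> integral {0<..} (\<lambda>t. f t * indicator {y<..} t) \<le> K"
proof -
  have [measurable]: "indicator X \<in> borel_measurable (lebesgue :: real measure)" if "X \<in> sets borel" for X :: "real set"
    using that by (intro borel_measurable_indicator) auto
  have ai: "(\<lambda>t. f t * indicator X t) absolutely_integrable_on {0<..}" if [measurable]: "X \<in> sets borel" for X
  proof (rule set_integrable_bound[OF f])
    show "set_borel_measurable lebesgue {0<..} (\<lambda>t. f t * indicator X t)"
      using f unfolding set_borel_measurable_def set_integrable_def
      by (auto intro!: borel_measurable_times dest!: borel_measurable_integrable simp: mult.assoc[symmetric])
  qed (auto simp: indicator_def)
  have sub: "f absolutely_integrable_on {a..b}" if "a > 0" for a b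
    by (rule set_integrable_subset[OF f]) (use that in auto)
  have fi: "f integrable_on {a..b}" if "a > 0" for a b
    using sub[OF that] by (rule set_lebesgue_integral_eq_integral(1))
  have eq: "(\<lambda>t. f t * indicator X t) = (\<lambda>t. if t \<in> X then f t else 0)" for X
    by (auto simp: indicator_def)
  have ge0: "integral {a..b} f \<ge> 0" if "a > 0" for a b
    by (rule integral_nonneg[OF fi[OF that]]) (use nn that in auto)
  show "integral {0<..} (\<lambda>t. f t * indicator {..y} t) \<le> K"
    if K: "\<And>a. 0 < a \<Longrightarrow> a \<le> y \<Longrightarrow> integral {a..y} f \<le> K"
  proof (rule integral_exhaust_le[OF ai])
    fix a b :: real assume ab: "0 < a" "a \<le> b"
    have "integral {a..b} (\<lambda>t. f t * indicator {..y} t) = integral ({..y} \<inter> {a..b}) f"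
      unfolding eq by (rule integral_restrict_Int)
    also have "{..y} \<inter> {a..b} = {a..min b y}" by auto
    also have "integral {a..min b y} f \<le> integral {a..max a y} f"
      by (rule integral_subset_le) (use ab nn fi in auto)
    also have "\<dots> \<le> K"
      using K[of a] K[of y] y ab(1) by (cases "a \<le> y") (auto simp: max_def)
    finally show "integral {a..b} (\<lambda>t. f t * indicator {..y} t) \<le> K" .
  qed auto
  show "integral {0<..} (\<lambda>t. f t * indicator {y<..} t) \<le> K"
    if K: "\<And>b. y \<le> b \<Longrightarrow> integral {y..b} f \<le> K"
  proof (rule integral_exhaust_le[OF ai])
    fix a b :: real assume ab: "0 < a" "a \<le> b"
    have "integral {a..b} (\<lambda>t. f t * indicator {y<..} t) = integral ({y<..} \<inter> {a..b}) f"
      unfolding eq by (rule integral_restrict_Int)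
    also have "\<dots> \<le> integral {y..max b y} f"
    proof (rule integral_subset_le)
      have "f absolutely_integrable_on {y<..} \<inter> {a..b}"
        by (rule set_integrable_subset[OF sub[OF ab(1)]]) auto
      then show "f integrable_on {y<..} \<inter> {a..b}" by (rule set_lebesgue_integral_eq_integral(1))
    qed (use y nn fi in auto)
    also have "\<dots> \<le> K" using K by auto
    finally show "integral {a..b} (\<lambda>t. f t * indicator {y<..} t) \<le> K" .
  qed auto
qed

lemma has_integral_real_derivative:
  fixes u :: "real \<Rightarrow> real"
  assumes "a \<le> b" "\<And>x. a \<le> x \<Longrightarrow> x \<le> b \<Longrightarrow> (u has_real_derivative g x) (at x)"
  shows "(g has_integral u b - u a) {a..b}"
  by (rule fundamental_theorem_of_calculus[OF assms(1)])
     (use assms(2) in \<open>auto simp: has_real_derivative_iff_has_vector_derivative[symmetric] intro: has_field_derivative_at_within\<close>)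

text \<open>On this range \<open>\<theta> + 1 - t\<close> is at least (\<theta> + 1)/2, so the
  weight is dominated by 2/(\<theta> + 1) times the derivative of \<open>wt (\<theta> + 1)\<close>,
  which integrates exactly.\<close>

lemma lagm_head_mass:
  assumes th: "\<theta> > -1" and y: "0 < y" "y \<le> (\<theta> + 1) / 2"
  shows "(LINT t|lagm \<theta>. indicator {..y} t) \<le> 2 / (\<theta> + 1) * wt (\<theta> + 1) y"
proof -
  have [measurable]: "{..y} \<in> sets borel" by auto
  have "integrable (lagm \<theta>) (\<lambda>t. 1 :: real)" using lagm_power_integrable[OF th, of 0] by simp
  then have i: "integrable (lagm \<theta>) (indicator {..y} :: real \<Rightarrow> real)"
    by (rule Bochner_Integration.integrable_bound) (use indicator_measurable_pos[of "{..y}"] in \<open>auto simp: indicator_def\<close>)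
  have "integral {a..y} (wt \<theta>) \<le> 2 / (\<theta> + 1) * wt (\<theta> + 1) y" if a: "0 < a" "a \<le> y" for a
  proof -
    have d: "((\<lambda>t. 2 / (\<theta> + 1) * ((\<theta> + 1 - t) * wt \<theta> t)) has_integral
        2 / (\<theta> + 1) * wt (\<theta> + 1) y - 2 / (\<theta> + 1) * wt (\<theta> + 1) a) {a..y}"
      by (rule has_integral_real_derivative[OF a(2)], rule DERIV_cmult, rule wt_deriv1) (use a in auto)
    have "integral {a..y} (wt \<theta>) \<le> integral {a..y} (\<lambda>t. 2 / (\<theta> + 1) * ((\<theta> + 1 - t) * wt \<theta> t))"
    proof (rule integral_le)
      show "wt \<theta> integrable_on {a..y}"
        by (rule integrable_continuous_real, rule continuous_on_subset[OF wt_continuous]) (use a in auto)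
      fix t assume t: "t \<in> {a..y}"
      then have "1 * wt \<theta> t \<le> (2 / (\<theta> + 1) * (\<theta> + 1 - t)) * wt \<theta> t"
        using y th a by (intro mult_right_mono) (auto simp: field_simps)
      then show "wt \<theta> t \<le> 2 / (\<theta> + 1) * ((\<theta> + 1 - t) * wt \<theta> t)" by (simp only: mult.assoc mult_1)
    qed (use d in auto)
    also have "\<dots> \<le> 2 / (\<theta> + 1) * wt (\<theta> + 1) y"
      using integral_unique[OF d] th by simp
    finally show ?thesis .
  qed
  then have "integral {0<..} (\<lambda>t. wt \<theta> t * indicator {..y} t) \<le> 2 / (\<theta> + 1) * wt (\<theta> + 1) y"
    by (rule integral_cut(1)[OF absolutely_integrable_wt(1)[OF th] wt_nonneg y(1)])
  then show ?thesis unfolding lagm_integral[OF i] .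
qed

text \<open>For t >= 2 \<bar>\<theta>\<bar> the logarithmic derivative \<theta>/t - 1 is at most
  -1/2, so the weight is dominated by -2 times its own derivative.\<close>

lemma lagm_tail_mass:
  assumes th: "\<theta> > -1" and y: "0 < y" "2 * \<bar>\<theta>\<bar> \<le> y"
  shows "(LINT t|lagm \<theta>. indicator {y<..} t) \<le> 2 * wt \<theta> y"
proof -
  have "integrable (lagm \<theta>) (\<lambda>t. 1 :: real)" using lagm_power_integrable[OF th, of 0] by simp
  then have i: "integrable (lagm \<theta>) (indicator {y<..} :: real \<Rightarrow> real)"
    by (rule Bochner_Integration.integrable_bound) (use indicator_measurable_pos[of "{y<..}"] in \<open>auto simp: indicator_def\<close>)
  have "integral {y..b} (wt \<theta>) \<le> 2 * wt \<theta> y" if b: "y \<le> b" for b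
  proof -
    have d: "((\<lambda>t. (- 2) * ((\<theta> / t - 1) * wt \<theta> t)) has_integral (- 2) * wt \<theta> b - (- 2) * wt \<theta> y) {y..b}"
      by (rule has_integral_real_derivative[OF b], rule DERIV_cmult, rule wt_deriv) (use y in auto)
    have "integral {y..b} (wt \<theta>) \<le> integral {y..b} (\<lambda>t. (- 2) * ((\<theta> / t - 1) * wt \<theta> t))"
    proof (rule integral_le)
      show "wt \<theta> integrable_on {y..b}"
        by (rule integrable_continuous_real, rule continuous_on_subset[OF wt_continuous]) (use y in auto)
      fix t assume t: "t \<in> {y..b}"
      then have "\<theta> / t \<le> 1 / 2" using y by (auto simp: field_simps)
      then have "1 * wt \<theta> t \<le> ((- 2) * (\<theta> / t - 1)) * wt \<theta> t"
        by (intro mult_right_mono) (simp_all add: algebra_simps)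
      then show "wt \<theta> t \<le> (- 2) * ((\<theta> / t - 1) * wt \<theta> t)" by (simp only: mult.assoc mult_1)
    qed (use d in auto)
    also have "\<dots> \<le> 2 * wt \<theta> y"
      unfolding integral_unique[OF d] by simp
    finally show ?thesis .
  qed
  then have "integral {0<..} (\<lambda>t. wt \<theta> t * indicator {y<..} t) \<le> 2 * wt \<theta> y"
    by (rule integral_cut(2)[OF absolutely_integrable_wt(1)[OF th] wt_nonneg y(1)])
  then show ?thesis unfolding lagm_integral[OF i] .
qed

lemma abs_integrable_nonneg_bound:
  fixes f g :: "real \<Rightarrow> real"
  assumes "g absolutely_integrable_on {0<..}" "continuous_on {0<..} f" "\<And>y. y > 0 \<Longrightarrow> \<bar>f y\<bar> \<le> \<bar>g y\<bar>"
  shows "f absolutely_integrable_on {0<..}"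
proof (rule set_integrable_bound[OF assms(1)])
  have "(\<lambda>x. indicator {0<..} x *\<^sub>R f x) \<in> borel_measurable borel"
    by (rule borel_measurable_continuous_on_indicator) (use assms(2) in auto)
  then show "set_borel_measurable lebesgue {0<..} f"
    unfolding set_borel_measurable_def by (simp add: measurable_completion)
qed (use assms(3) in auto)

lemma lagm_abs_integrable:
  assumes "integrable (lagm \<theta>) f"
  shows "(\<lambda>y. wt \<theta> y * f y) absolutely_integrable_on {0<..}"
proof -
  have "f \<in> borel_measurable (lebesgue_on {0<..})" using borel_measurable_integrable[OF assms] by simp
  then show ?thesis using assms lagm_integrable_iff by blast
qed

lemma L2_lagm:
  assumes "u \<in> L2 (lagm r)"
  shows L2_abs_integrable: "(\<lambda>t. wt r t * (u t)\<^sup>2) absolutely_integrable_on {0<..}"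
    and L2_sq_eq: "sq (lagm r) u = integral {0<..} (\<lambda>t. wt r t * (u t)\<^sup>2)"
    and L2_integrable_Icc: "0 < a \<Longrightarrow> (\<lambda>t. wt r t * (u t)\<^sup>2) integrable_on {a..b}"
    and L2_integral_Icc_le: "0 < a \<Longrightarrow> integral {a..b} (\<lambda>t. wt r t * (u t)\<^sup>2) \<le> sq (lagm r) u"
proof -
  show abs: "(\<lambda>t. wt r t * (u t)\<^sup>2) absolutely_integrable_on {0<..}"
    by (rule lagm_abs_integrable[OF L2_integrable[OF assms]])
  show eq: "sq (lagm r) u = integral {0<..} (\<lambda>t. wt r t * (u t)\<^sup>2)"
    unfolding sq_def by (rule lagm_integral[OF L2_integrable[OF assms]])
  assume "0 < a"
  then have sub: "{a..b} \<subseteq> {0<..}" by auto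
  show i: "(\<lambda>t. wt r t * (u t)\<^sup>2) integrable_on {a..b}"
    using set_integrable_subset[OF abs _ sub] by (auto intro: set_lebesgue_integral_eq_integral(1))
  show "integral {a..b} (\<lambda>t. wt r t * (u t)\<^sup>2) \<le> sq (lagm r) u"
    unfolding eq by (rule integral_subset_le[OF sub i set_lebesgue_integral_eq_integral(1)[OF abs]]) auto
qed

lemma lagm_integrable_indicator:
  fixes v :: "real \<Rightarrow> real"
  assumes v: "integrable (lagm \<theta>) v" and X: "X \<in> sets borel"
  shows "integrable (lagm \<theta>) (\<lambda>t. v t * indicator X t)"
proof (rule Bochner_Integration.integrable_bound[OF v])
  show "(\<lambda>t. v t * indicator X t) \<in> borel_measurable (lagm \<theta>)"
    using borel_measurable_integrable[OF v] indicator_measurable_pos[OF X] by (simp add: borel_measurable_times)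
qed (auto simp: indicator_def)

section \<open>The dual equation and the gap\<close>

lemma ac_deriv_cumulative:
  fixes v :: "real \<Rightarrow> real"
  assumes v: "integrable (lagm \<theta>) v" and cv: "continuous_on {0<..} v"
  shows "ac_deriv (\<lambda>y. LINT t|lagm \<theta>. v t * indicator {..y} t) (\<lambda>y. wt \<theta> y * v y)"
  unfolding ac_deriv_def
proof (intro allI impI conjI)
  fix a b :: real assume ab: "0 < a" "a \<le> b"
  show "(\<lambda>y. wt \<theta> y * v y) absolutely_integrable_on {a..b}"
    by (rule absolutely_integrable_continuous_real, rule continuous_on_subset[of "{0<..}"])
       (use ab in \<open>auto intro!: continuous_intros wt_continuous cv\<close>)
  have "(LINT t|lagm \<theta>. v t * indicator {..b} t) - (LINT t|lagm \<theta>. v t * indicator {..a} t) = (LINT t|lagm \<theta>. v t * indicator {..b} t - v t * indicator {..a} t)"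
    by (rule Bochner_Integration.integral_diff[symmetric]) (auto intro!: lagm_integrable_indicator v)
  also have "\<dots> = (LINT t|lagm \<theta>. v t * indicator {a<..b} t)"
    by (intro Bochner_Integration.integral_cong) (use ab in \<open>auto simp: indicator_def\<close>)
  also have "\<dots> = integral {0<..} (\<lambda>t. wt \<theta> t * (v t * indicator {a<..b} t))"
    by (rule lagm_integral[OF lagm_integrable_indicator[OF v]]) auto
  also have "\<dots> = integral {0<..} (\<lambda>t. if t \<in> {a<..b} then wt \<theta> t * v t else 0)"
    by (intro integral_cong) (auto simp: indicator_def)
  also have "\<dots> = integral ({a<..b} \<inter> {0<..}) (\<lambda>t. wt \<theta> t * v t)"
    by (rule integral_restrict_Int)
  also have "{a<..b} \<inter> {0<..} = {a<..b}" using ab by auto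
  also have "integral {a<..b} (\<lambda>t. wt \<theta> t * v t) = integral {a..b} (\<lambda>t. wt \<theta> t * v t)"
    by (rule integral_spike_set) (auto intro: negligible_subset[OF negligible_sing[of a]])
  finally show "(LINT t|lagm \<theta>. v t * indicator {..b} t) - (LINT t|lagm \<theta>. v t * indicator {..a} t) = integral {a..b} (\<lambda>y. wt \<theta> y * v y)" .
qed

text \<open>Mean zero allows the cumulative integral \<open>F\<close> of
  \<open>wt \<theta> * v\<close> to be read from either end, so Cauchy-Schwarz with the small head
  or tail mass makes it decay at both ends. The norm inequality is then an exact derivative identity
  with vanishing boundary terms, and the pairing identities are integrations by parts against
  \<open>F\<close>.\<close>

lemma gap_dual:
  assumes th: "\<theta> > -1" and v: "ac_deriv v v'"
    and vL: "v \<in> L2 (lagm \<theta>)" and vL': "v' \<in> L2 (lagm (\<theta> + 1))"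
    and mean: "(LINT y|lagm \<theta>. v y) = 0"
  shows "\<exists>f f'. ac_deriv f f' \<and> f \<in> L2 (lagm (\<theta> + 1)) \<and> f' \<in> L2 (lagm (\<theta> + 2)) \<and>
    sq (lagm (\<theta> + 1)) f + sq (lagm (\<theta> + 2)) f' \<le> sq (lagm \<theta>) v \<and>
    ip (lagm (\<theta> + 1)) f v' = sq (lagm \<theta>) v \<and>
    (\<forall>p. ip (lagm \<theta>) v (poly p) = 0 \<longrightarrow> ip (lagm (\<theta> + 1)) f (poly (pderiv p)) = 0)"
proof -
  let ?N = "lagm \<theta>"
  define S where "S = sq ?N v"
  have cv: "continuous_on {0<..} v" by (rule ac_deriv_continuous[OF v])
  have one: "(\<lambda>_. 1) \<in> L2 ?N" using poly_L2[OF th, of 1] by (simp add: poly_1[abs_def])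
  have vi: "integrable ?N v" using L2_mult_integrable[OF vL one] by simp
  have v2i: "integrable ?N (\<lambda>y. (v y)\<^sup>2)" by (rule L2_integrable[OF vL])
  note iv = lagm_integrable_indicator[OF vi] and iv2 = lagm_integrable_indicator[OF v2i]
  have i1: "integrable ?N (indicator X :: real \<Rightarrow> real)" if "X \<in> sets borel" for X
    using lagm_integrable_indicator[OF L2_integrable[OF one] that] by simp
  define d where "d X = (LINT t|?N. (v t)\<^sup>2 * indicator X t)" for X
  have CS: "(LINT t|?N. v t * indicator X t)\<^sup>2 \<le> d X * (LINT t|?N. indicator X t)"
    if X: "X \<in> sets borel" for X
  proof -
    have sqi: "(indicator X t)\<^sup>2 = (indicator X t :: real)" for t :: real by (simp add: indicator_def)
    have a: "(\<lambda>t. v t * indicator X t) \<in> L2 ?N" "(indicator X :: real \<Rightarrow> real) \<in> L2 ?N"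
      using iv[OF X] iv2[OF X] i1[OF X] borel_measurable_integrable[OF iv[OF X]] borel_measurable_integrable[OF i1[OF X]]
      by (simp_all add: L2_def power_mult_distrib sqi)
    show ?thesis
      using L2_Cauchy_Schwarz[OF a] unfolding ip_def sq_def power_mult_distrib sqi mult.assoc d_def
      by (simp only: power2_eq_square[symmetric] sqi)
  qed
  have dS: "d X \<le> S" if "X \<in> sets borel" for X
    unfolding d_def S_def sq_def
    by (rule integral_mono[OF iv2[OF that] v2i]) (auto simp: indicator_def)
  have d0: "d X \<ge> 0" for X unfolding d_def by (intro Bochner_Integration.integral_nonneg) auto

  define F where "F y = (LINT t|?N. v t * indicator {..y} t)" for y
  have F_tail: "F y = - (LINT t|?N. v t * indicator {y<..} t)" for y
  proof -
    have "F y + (LINT t|?N. v t * indicator {y<..} t) = (LINT t|?N. v t * indicator {..y} t + v t * indicator {y<..} t)"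
      unfolding F_def by (rule Bochner_Integration.integral_add[symmetric]) (auto intro!: iv)
    also have "\<dots> = (LINT t|?N. v t)"
      by (intro Bochner_Integration.integral_cong) (auto simp: indicator_def)
    finally show ?thesis using mean by simp
  qed
  have F_ac: "ac_deriv F (\<lambda>y. wt \<theta> y * v y)"
    unfolding F_def by (rule ac_deriv_cumulative[OF vi cv])
  have F_deriv: "(F has_real_derivative wt \<theta> y * v y) (at y)" if "y > 0" for y
    by (rule ac_deriv_has_real_derivative[OF F_ac _ that])
       (intro continuous_intros wt_continuous cv)
  have cF: "continuous_on {0<..} F" by (rule ac_deriv_continuous[OF F_ac])
  \<comment> \<open>Solves \<open>- (wt (\<theta> + 1) * f)' = wt \<theta> * v\<close>. The product
    rule in this equation gives \<open>y * f' + (\<theta> + 1 - y) * f = - v\<close>, from which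
    \<open>f'\<close> is read off.\<close>
  define f where "f y = - F y / wt (\<theta> + 1) y" for y
  define f' where "f' y = - (v y + (\<theta> + 1 - y) * f y) / y" for y
  have nz: "wt r y \<noteq> 0" if "y > 0" for r y using wt_pos[OF that, of r] by simp
  have cf: "continuous_on {0<..} f"
    unfolding f_def by (intro continuous_intros cF wt_continuous) (use nz in auto)
  have cf': "continuous_on {0<..} f'"
    unfolding f'_def by (intro continuous_intros cf cv) auto
  have f_deriv: "(f has_real_derivative f' y) (at y)" if y: "y > 0" for y
  proof -
    have "(f has_real_derivative - (((wt \<theta> y * v y) * wt (\<theta> + 1) y - F y * ((\<theta> + 1 - y) * wt \<theta> y)) / (wt (\<theta> + 1) y * wt (\<theta> + 1) y))) (at y)"
      unfolding f_def minus_divide_left[symmetric]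
      by (intro DERIV_minus DERIV_divide F_deriv wt_deriv1 y nz)
    moreover have "- (((wt \<theta> y * v y) * wt (\<theta> + 1) y - F y * ((\<theta> + 1 - y) * wt \<theta> y)) / (wt (\<theta> + 1) y * wt (\<theta> + 1) y)) = f' y"
      unfolding f'_def f_def using y nz[OF y, of \<theta>] by (simp add: wt_plus1[OF y]) (simp add: field_simps)
    ultimately show ?thesis by simp
  qed
  have f_ac: "ac_deriv f f'" by (rule ac_deriv_C1[OF f_deriv cf'])
  \<comment> \<open>Squaring \<open>v = - (y * f' + (\<theta> + 1 - y) * f)\<close> produces a cross
    term in \<open>f * f'\<close>; it is part of the derivative of \<open>B\<close>, and what
    remains is exactly \<open>P\<close>.\<close>
  define P where "P y = wt (\<theta> + 2) y * (f' y)\<^sup>2 + wt (\<theta> + 1) y * (f y)\<^sup>2" for y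
  define B where "B y = (\<theta> + 1 - y) * ((f y)\<^sup>2 * wt (\<theta> + 1) y)" for y
  define G where "G y = (f y)\<^sup>2 * wt (\<theta> + 1) y" for y
  have G_F: "G y = (F y)\<^sup>2 / wt (\<theta> + 1) y" if "y > 0" for y
    unfolding G_def f_def using nz[OF that, of "\<theta> + 1"] by (simp add: field_simps power2_eq_square)
  have G0: "G y \<ge> 0" for y by (simp add: G_def)
  have B_deriv: "(B has_real_derivative wt \<theta> y * (v y)\<^sup>2 - P y) (at y)" if y: "y > 0" for y
  proof -
    have vy: "v y = - (y * f' y + (\<theta> + 1 - y) * f y)" unfolding f'_def using y by (simp add: field_simps)
    have "(B has_real_derivative (- 1) * ((f y)\<^sup>2 * wt (\<theta> + 1) y) +
        (2 * f y * f' y * wt (\<theta> + 1) y + ((\<theta> + 1 - y) * wt \<theta> y) * (f y)\<^sup>2) * (\<theta> + 1 - y)) (at y)"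
      unfolding B_def using f_deriv[OF y] wt_deriv1[OF y]
      by (auto intro!: derivative_eq_intros)
    moreover have "(- 1) * ((f y)\<^sup>2 * wt (\<theta> + 1) y) +
        (2 * f y * f' y * wt (\<theta> + 1) y + ((\<theta> + 1 - y) * wt \<theta> y) * (f y)\<^sup>2) * (\<theta> + 1 - y) = wt \<theta> y * (v y)\<^sup>2 - P y"
      unfolding P_def vy wt_plus1[OF y] wt_plus2[OF y] by algebra
    ultimately show ?thesis by simp
  qed
  have cP: "continuous_on {0<..} P"
    unfolding P_def by (intro continuous_intros cf cf' wt_continuous)
  have B_ac: "ac_deriv B (\<lambda>y. wt \<theta> y * (v y)\<^sup>2 - P y)"
    by (rule ac_deriv_C1[OF B_deriv]) (auto intro!: continuous_intros cP cv wt_continuous)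
  have P0: "P y \<ge> 0" for y by (simp add: P_def)

  \<comment> \<open>\<open>d {..y}\<close> is the share of the squared norm of \<open>v\<close>
    carried by the head. It tends to 0 with y, which is what makes the boundary term vanish and not
    merely stay bounded.\<close>
  have G_head: "G y \<le> 2 / (\<theta> + 1) * d {..y}" if y: "0 < y" "y \<le> (\<theta> + 1) / 2" for y
  proof -
    have "(F y)\<^sup>2 \<le> d {..y} * (LINT t|?N. indicator {..y} t)" unfolding F_def by (rule CS) auto
    also have "\<dots> \<le> d {..y} * (2 / (\<theta> + 1) * wt (\<theta> + 1) y)"
      by (intro mult_left_mono lagm_head_mass th y d0)
    finally show ?thesis unfolding G_F[OF y(1)] using wt_pos[OF y(1), of "\<theta> + 1"] by (simp add: field_simps)
  qed
  have G_tail: "G y \<le> 2 / y * d {y<..}" if y: "0 < y" "2 * \<bar>\<theta>\<bar> \<le> y" for y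
  proof -
    have "(F y)\<^sup>2 \<le> d {y<..} * (LINT t|?N. indicator {y<..} t)" unfolding F_tail power2_minus by (rule CS) auto
    also have "\<dots> \<le> d {y<..} * (2 * wt \<theta> y)"
      by (intro mult_left_mono lagm_tail_mass th y d0)
    finally show ?thesis unfolding G_F[OF y(1)] wt_plus1[OF y(1)] using wt_pos[OF y(1), of \<theta>] y(1) by (simp add: field_simps)
  qed
  \<comment> \<open>A uniform bound on \<open>G\<close>: head and tail estimates at the ends,
    continuity on the compact interval between. It is used to control the boundary term
    \<open>u * F\<close> below.\<close>
  obtain K where K: "\<And>y. y > 0 \<Longrightarrow> G y \<le> K"
  proof -
    define y1 where "y1 = (\<theta> + 1) / 2"
    define y2 where "y2 = max 1 (2 * \<bar>\<theta>\<bar>)"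
    have y1: "y1 > 0" using th by (simp add: y1_def)
    have "continuous_on {y1..y2} G"
      unfolding G_def by (rule continuous_on_subset[of "{0<..}"])
        (use y1 in \<open>auto intro!: continuous_intros cf wt_continuous\<close>)
    then have "bounded (G ` {y1..y2})"
      by (intro compact_imp_bounded compact_continuous_image) auto
    then obtain k where k: "\<And>y. y \<in> {y1..y2} \<Longrightarrow> \<bar>G y\<bar> \<le> k" unfolding bounded_iff by (metis image_eqI real_norm_def)
    show thesis
    proof (rule that[of "max k (max (2 / (\<theta> + 1) * S) (2 * S))"])
      fix y :: real assume y: "y > 0"
      consider "y \<le> y1" | "y \<in> {y1..y2}" | "y \<ge> y2" by (metis atLeastAtMost_iff linear)
      then show "G y \<le> max k (max (2 / (\<theta> + 1) * S) (2 * S))"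
      proof cases
        case 1
        have "G y \<le> 2 / (\<theta> + 1) * d {..y}" using G_head[OF y] 1 y1_def by simp
        also have "\<dots> \<le> 2 / (\<theta> + 1) * S" using dS[of "{..y}"] th by (intro mult_left_mono) auto
        finally show ?thesis by simp
      next
        case 2
        then show ?thesis using k[of y] by simp
      next
        case 3
        have "G y \<le> 2 / y * d {y<..}" using G_tail[OF y] 3 y2_def by simp
        also have "\<dots> \<le> 2 * S" using dS[of "{y<..}"] d0 3 y2_def by (intro mult_mono) (auto simp: divide_simps)
        finally show ?thesis by simp
      qed
    qed
  qed
  let ?a = "\<lambda>n. 1 / real (Suc n)" and ?b = "\<lambda>n. real (Suc n)"
  have za: "?a \<longlonglongrightarrow> 0" by (rule LIMSEQ_Suc[OF lim_1_over_n])
  \<comment> \<open>Sets that eventually miss every point carry vanishing shares of an integrable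
    function, by dominated convergence.\<close>
  have dlim: "(\<lambda>n. d (X n)) \<longlonglongrightarrow> 0"
    if X: "\<And>n. X n \<in> sets borel" and e: "\<And>t. t > 0 \<Longrightarrow> eventually (\<lambda>n. t \<notin> X n) sequentially" for X
  proof -
    have "(\<lambda>n. d (X n)) \<longlonglongrightarrow> (LINT t|?N. 0)"
      unfolding d_def
    proof (rule integral_dominated_convergence[OF _ _ v2i])
      show "AE t in ?N. (\<lambda>n. (v t)\<^sup>2 * indicator (X n) t) \<longlonglongrightarrow> 0"
      proof (rule AE_I2)
        fix t assume "t \<in> space ?N"
        then have ev: "eventually (\<lambda>n. t \<notin> X n) sequentially" using e[of t] by simp
        show "(\<lambda>n. (v t)\<^sup>2 * indicator (X n) t) \<longlonglongrightarrow> 0"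
          by (rule tendsto_eventually, rule eventually_mono[OF ev]) simp
      qed
    qed (use iv2[OF X] in \<open>auto simp: indicator_def dest: borel_measurable_integrable\<close>)
    then show ?thesis by simp
  qed
  have d_head: "(\<lambda>n. d {..?a n}) \<longlonglongrightarrow> 0"
  proof (rule dlim)
    fix t :: real assume "t > 0"
    then show "eventually (\<lambda>n. t \<notin> {..?a n}) sequentially"
      using order_tendstoD(2)[OF za, of t] by (auto simp: not_le)
  qed auto
  have d_tail: "(\<lambda>n. d {?b n<..}) \<longlonglongrightarrow> 0"
  proof (rule dlim)
    fix t :: real
    show "eventually (\<lambda>n. t \<notin> {?b n<..}) sequentially"
      using filterlim_Suc_real[unfolded filterlim_at_top, rule_format, of t] by (auto elim!: eventually_mono)
  qed auto
  have Ba: "(\<lambda>n. B (?a n)) \<longlonglongrightarrow> 0"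
  proof (rule Lim_null_comparison)
    show "(\<lambda>n. (\<theta> + 1) * (2 / (\<theta> + 1) * d {..?a n})) \<longlonglongrightarrow> 0"
      using tendsto_mult_right_zero[OF tendsto_mult_right_zero[OF d_head]] .
    have "eventually (\<lambda>n. ?a n < (\<theta> + 1) / 2) sequentially"
      using order_tendstoD(2)[OF za, of "(\<theta> + 1) / 2"] th by simp
    then show "eventually (\<lambda>n. norm (B (?a n)) \<le> (\<theta> + 1) * (2 / (\<theta> + 1) * d {..?a n})) sequentially"
    proof eventually_elim
      case (elim n)
      have p: "?a n > 0" by simp
      have "norm (B (?a n)) = \<bar>\<theta> + 1 - ?a n\<bar> * G (?a n)"
        unfolding B_def G_def[symmetric] real_norm_def abs_mult using G0[of "?a n"] by simp
      also have "\<dots> \<le> (\<theta> + 1) * (2 / (\<theta> + 1) * d {..?a n})"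
      proof (intro mult_mono G_head[OF p] G0)
        show "\<bar>\<theta> + 1 - ?a n\<bar> \<le> \<theta> + 1"
        proof -
          have "\<bar>\<theta> + 1 - x\<bar> \<le> \<theta> + 1" if "0 < x" "x < (\<theta> + 1) / 2" for x :: real
          proof -
            have "x * 2 < \<theta> + 1" using that(2) by simp
            then show ?thesis unfolding abs_le_iff using that(1) by simp
          qed
          then show ?thesis using elim p by blast
        qed
      qed (use elim th in auto)
      finally show ?case .
    qed
  qed
  \<comment> \<open>The factor \<theta> + 1 - y of \<open>B\<close> grows linearly; the gain 2/y in
    \<open>G_tail\<close> compensates it, and the tail share \<open>d\<close> supplies the
    convergence to 0.\<close>
  have Bb: "(\<lambda>n. B (?b n)) \<longlonglongrightarrow> 0"
  proof (rule Lim_null_comparison)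
    show "(\<lambda>n. 2 * (\<theta> + 2) * d {?b n<..}) \<longlonglongrightarrow> 0"
      using tendsto_mult_right_zero[OF d_tail] .
    have "eventually (\<lambda>n. ?b n \<ge> 2 * \<bar>\<theta>\<bar>) sequentially"
      using filterlim_Suc_real unfolding filterlim_at_top by blast
    then show "eventually (\<lambda>n. norm (B (?b n)) \<le> 2 * (\<theta> + 2) * d {?b n<..}) sequentially"
    proof eventually_elim
      case (elim n)
      have p: "?b n > 0" by simp
      have "norm (B (?b n)) = \<bar>\<theta> + 1 - ?b n\<bar> * G (?b n)"
        unfolding B_def G_def[symmetric] real_norm_def abs_mult using G0[of "?b n"] by simp
      also have "\<dots> \<le> ((\<theta> + 2) * ?b n) * (2 / ?b n * d {?b n<..})"
      proof (intro mult_mono G_tail[OF p elim] G0)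
        have "(\<theta> + 1) * 1 \<le> (\<theta> + 1) * ?b n" using th by (intro mult_left_mono) auto
        then show "\<bar>\<theta> + 1 - ?b n\<bar> \<le> (\<theta> + 2) * ?b n" using th by (auto simp: algebra_simps)
      qed (use th in auto)
      also have "\<dots> = 2 * (\<theta> + 2) * d {?b n<..}" by (simp add: field_simps)
      finally show ?case .
    qed
  qed
  have wv: "(\<lambda>y. wt \<theta> y * (v y)\<^sup>2) absolutely_integrable_on {0<..}" and S_eq: "S = integral {0<..} (\<lambda>y. wt \<theta> y * (v y)\<^sup>2)"
    using lagm_integrable_iff[of "\<lambda>y. (v y)\<^sup>2" \<theta>] lagm_integral[OF v2i] v2i
    by (auto simp: S_def sq_def dest: borel_measurable_integrable)
  have P_int: "P absolutely_integrable_on {0<..}" "integral {0<..} P \<le> S"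
  proof -
    have loc: "P absolutely_integrable_on {a..b}" if "0 < a" for a b
      by (rule absolutely_integrable_continuous_real, rule continuous_on_subset[OF cP]) (use that in auto)
    have le: "integral {?a n..?b n} P \<le> S + \<bar>B (?a n)\<bar> + \<bar>B (?b n)\<bar>" for n
    proof -
      have ab: "0 < ?a n" "?a n \<le> ?b n" by (auto simp: field_simps)
      have sub: "{?a n..?b n} \<subseteq> {0<..}"
      proof
        fix x assume "x \<in> {?a n..?b n}"
        then have "?a n \<le> x" by (simp only: atLeastAtMost_iff)
        with ab(1) have "0 < x" by (rule less_le_trans)
        then show "x \<in> {0<..}" by simp
      qed
      have i1: "(\<lambda>y. wt \<theta> y * (v y)\<^sup>2) integrable_on {?a n..?b n}"
        by (rule set_lebesgue_integral_eq_integral(1), rule set_integrable_subset[OF wv]) (use sub in auto)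
      have i2: "P integrable_on {?a n..?b n}"
        using loc[OF ab(1)] by (rule set_lebesgue_integral_eq_integral(1))
      have "B (?b n) - B (?a n) = integral {?a n..?b n} (\<lambda>y. wt \<theta> y * (v y)\<^sup>2) - integral {?a n..?b n} P"
        using ac_derivD(2)[OF B_ac ab] integral_diff[OF i1 i2] by simp
      moreover have "integral {?a n..?b n} (\<lambda>y. wt \<theta> y * (v y)\<^sup>2) \<le> S"
        unfolding S_eq
        by (rule integral_subset_le) (rule sub i1 set_lebesgue_integral_eq_integral(1)[OF wv] | simp)+
      ultimately show ?thesis by linarith
    qed
    have "(\<lambda>n. S + \<bar>B (?a n)\<bar> + \<bar>B (?b n)\<bar>) \<longlonglongrightarrow> S + \<bar>0\<bar> + \<bar>0\<bar>"
      by (intro tendsto_add tendsto_rabs tendsto_const Ba Bb)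
    then have "(\<lambda>n. S + \<bar>B (?a n)\<bar> + \<bar>B (?b n)\<bar>) \<longlonglongrightarrow> S" by simp
    from nonneg_abs_integrable_exhaust[OF P0 loc le this]
    show "P absolutely_integrable_on {0<..}" "integral {0<..} P \<le> S" by auto
  qed
  have if': "(\<lambda>y. wt (\<theta> + 2) y * (f' y)\<^sup>2) absolutely_integrable_on {0<..}"
    by (rule abs_integrable_nonneg_bound[OF P_int(1)])
       (auto intro!: continuous_intros cf' wt_continuous simp: P_def)
  have iff: "(\<lambda>y. wt (\<theta> + 1) y * (f y)\<^sup>2) absolutely_integrable_on {0<..}"
    by (rule abs_integrable_nonneg_bound[OF P_int(1)])
       (auto intro!: continuous_intros cf wt_continuous simp: P_def)
  have mf: "(\<lambda>y. (f y)\<^sup>2) \<in> borel_measurable (lebesgue_on {0<..})" "(\<lambda>y. (f' y)\<^sup>2) \<in> borel_measurable (lebesgue_on {0<..})"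
    by (intro continuous_measurable_pos continuous_intros cf cf')+
  have fL: "f \<in> L2 (lagm (\<theta> + 1))" and fL': "f' \<in> L2 (lagm (\<theta> + 2))"
    using if' iff mf by (auto intro!: L2_continuousI cf cf' simp: lagm_integrable_iff)
  have sqs: "sq (lagm (\<theta> + 1)) f + sq (lagm (\<theta> + 2)) f' \<le> sq (lagm \<theta>) v"
  proof -
    have "sq (lagm (\<theta> + 1)) f + sq (lagm (\<theta> + 2)) f' = integral {0<..} P"
      unfolding sq_def lagm_integral[OF L2_integrable[OF fL]] lagm_integral[OF L2_integrable[OF fL']] P_def
      using if' iff by (subst integral_add) (auto simp: set_lebesgue_integral_eq_integral(1))
    then show ?thesis using P_int(2) by (simp add: S_def)
  qed

  \<comment> \<open>The integrand is the derivative of \<open>u * F\<close>. Its boundary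
    contribution vanishes since \<open>(u * F)^2 / y = G * wt \<theta> * u^2\<close> is at most
    \<open>K\<close> times an integrable function.\<close>
  have BT: "integral {0<..} (\<lambda>y. u' y * F y + u y * (wt \<theta> y * v y)) = 0"
    if u: "ac_deriv u u'" and uL: "u \<in> L2 (lagm \<theta>)" and uL': "u' \<in> L2 (lagm (\<theta> + 1))" for u u'
  proof (rule ac_deriv_integral_eq_0[OF ac_deriv_mult[OF u F_ac], where k = 2])
    have "integrable (lagm (\<theta> + 1)) (\<lambda>y. u' y * f y)" by (rule L2_mult_integrable[OF uL' fL])
    then have "(\<lambda>y. wt (\<theta> + 1) y * (u' y * f y)) absolutely_integrable_on {0<..}"
      by (rule lagm_abs_integrable)
    then have "(\<lambda>y. (-1) * (wt (\<theta> + 1) y * (u' y * f y))) absolutely_integrable_on {0<..}"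
      by (rule set_integrable_mult_right) 
    moreover have "(-1) * (wt (\<theta> + 1) y * (u' y * f y)) = u' y * F y" if "y \<in> {0<..}" for y
      using nz[of y "\<theta> + 1"] that by (simp add: f_def)
    ultimately have 1: "(\<lambda>y. u' y * F y) absolutely_integrable_on {0<..}"
      by (subst set_integrable_cong[OF refl refl]) (auto intro: sym)
    have "integrable (lagm \<theta>) (\<lambda>y. u y * v y)" by (rule L2_mult_integrable[OF uL vL])
    then have "(\<lambda>y. wt \<theta> y * (u y * v y)) absolutely_integrable_on {0<..}"
      by (rule lagm_abs_integrable)
    then have 2: "(\<lambda>y. u y * (wt \<theta> y * v y)) absolutely_integrable_on {0<..}"
      by (simp add: mult.left_commute)
    show "(\<lambda>y. u' y * F y + u y * (wt \<theta> y * v y)) absolutely_integrable_on {0<..}"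
      by (rule set_integral_add(1)[OF 1 2])
    have u2: "(\<lambda>y. wt \<theta> y * (u y)\<^sup>2) absolutely_integrable_on {0<..}"
      using L2_integrable[OF uL] by (rule lagm_abs_integrable)
    show "(\<lambda>y. \<bar>u y * F y\<bar>\<^sup>2 / y) absolutely_integrable_on {0<..}"
    proof (rule abs_integrable_nonneg_bound)
      show "(\<lambda>y. K * (wt \<theta> y * (u y)\<^sup>2)) absolutely_integrable_on {0<..}"
        using u2 by (rule set_integrable_mult_right) 
      show "continuous_on {0<..} (\<lambda>y. \<bar>u y * F y\<bar>\<^sup>2 / y)"
        by (intro continuous_intros cF ac_deriv_continuous[OF u]) auto
      fix y :: real assume y: "y > 0"
      have "(F y)\<^sup>2 = G y * (y * wt \<theta> y)"
        using G_F[OF y] nz[OF y, of "\<theta> + 1"] by (simp add: wt_plus1[OF y])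
      then have "\<bar>u y * F y\<bar>\<^sup>2 / y = G y * (wt \<theta> y * (u y)\<^sup>2)"
        using y by (simp add: power_mult_distrib)
      also have "\<dots> \<le> K * (wt \<theta> y * (u y)\<^sup>2)"
        by (intro mult_right_mono K[OF y]) simp
      finally show "\<bar>\<bar>u y * F y\<bar>\<^sup>2 / y\<bar> \<le> \<bar>K * (wt \<theta> y * (u y)\<^sup>2)\<bar>"
        using y by simp
    qed
  qed simp
  have ipf: "ip (lagm (\<theta> + 1)) f u' = ip (lagm \<theta>) v u"
    if u: "ac_deriv u u'" and uL: "u \<in> L2 (lagm \<theta>)" and uL': "u' \<in> L2 (lagm (\<theta> + 1))" for u u'
  proof -
    have i1: "integrable (lagm (\<theta> + 1)) (\<lambda>y. f y * u' y)" by (rule L2_mult_integrable[OF fL uL'])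
    have i2: "integrable (lagm \<theta>) (\<lambda>y. v y * u y)" by (rule L2_mult_integrable[OF vL uL])
    have a1: "(\<lambda>y. wt (\<theta> + 1) y * (f y * u' y)) absolutely_integrable_on {0<..}"
      using i1 by (rule lagm_abs_integrable)
    have a2: "(\<lambda>y. wt \<theta> y * (v y * u y)) absolutely_integrable_on {0<..}"
      using i2 by (rule lagm_abs_integrable)
    have "integral {0<..} (\<lambda>y. wt (\<theta> + 1) y * (f y * u' y) - wt \<theta> y * (v y * u y)) =
        integral {0<..} (\<lambda>y. - (u' y * F y + u y * (wt \<theta> y * v y)))"
    proof (rule integral_cong)
      fix y :: real assume "y \<in> {0<..}"
      then have "wt (\<theta> + 1) y * f y = - F y" using nz[of y "\<theta> + 1"] by (simp add: f_def)
      then have "wt (\<theta> + 1) y * (f y * u' y) = - F y * u' y" by (simp only: mult.assoc[symmetric])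
      then show "wt (\<theta> + 1) y * (f y * u' y) - wt \<theta> y * (v y * u y) = - (u' y * F y + u y * (wt \<theta> y * v y))"
        by (simp add: algebra_simps)
    qed
    also have "\<dots> = 0" unfolding integral_neg BT[OF u uL uL'] by simp
    finally have "integral {0<..} (\<lambda>y. wt (\<theta> + 1) y * (f y * u' y)) - integral {0<..} (\<lambda>y. wt \<theta> y * (v y * u y)) = 0"
      using integral_diff[OF set_lebesgue_integral_eq_integral(1)[OF a1] set_lebesgue_integral_eq_integral(1)[OF a2]] by simp
    then show ?thesis
      unfolding ip_def lagm_integral[OF i1] lagm_integral[OF i2] by simp
  qed
  have "ip (lagm (\<theta> + 1)) f v' = sq (lagm \<theta>) v"
    unfolding ipf[OF v vL vL'] by (simp add: ip_def sq_def power2_eq_square)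
  moreover have "ip (lagm (\<theta> + 1)) f (poly (pderiv p)) = ip (lagm \<theta>) v (poly p)" for p
  proof (rule ipf)
    show "ac_deriv (poly p) (poly (pderiv p))"
      by (rule ac_deriv_C1[OF poly_DERIV]) (intro continuous_intros)
  qed (use th in \<open>auto intro: poly_L2\<close>)
  ultimately show ?thesis using f_ac fL fL' sqs by (intro exI[of _ f] exI[of _ f']) simp
qed

lemma poly_antiderivative:
  fixes q :: "real poly"
  shows "\<exists>p. pderiv p = q \<and> degree p \<le> Suc (degree q)"
proof -
  define p where "p = (\<Sum>i\<le>degree q. monom (coeff q i / real (Suc i)) (Suc i))"
  have "pderiv p = (\<Sum>i\<le>degree q. monom (coeff q i) i)"
    unfolding p_def by (simp add: higher_pderiv_sum[of 1, simplified] pderiv_monom)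
  also have "\<dots> = q" by (simp add: poly_as_sum_of_monoms)
  finally have "pderiv p = q" .
  moreover have "degree p \<le> Suc (degree q)"
    unfolding p_def by (intro degree_sum_le) (auto intro: order_trans[OF degree_monom_le])
  ultimately show ?thesis by blast
qed

text \<open>The dual function \<open>f\<close> solves \<open>T\<^sup>* f = v\<close> for the adjoint \<open>T\<^sup>*\<close> of
  differentiation, is orthogonal to one degree less, and the commutation \<open>T T\<^sup>* = T\<^sup>* T + 1\<close>
  (with \<open>\<theta>\<close> raised by one on the right) makes the gap grow by one with the degree.\<close>

lemma laguerre_gap:
  assumes "\<theta> > -1" "ac_deriv v v'" "v \<in> L2 (lagm \<theta>)" "v' \<in> L2 (lagm (\<theta> + 1))"
    and "\<And>p. degree p \<le> M \<Longrightarrow> ip (lagm \<theta>) v (poly p) = 0"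
  shows "(real M + 1) * sq (lagm \<theta>) v \<le> sq (lagm (\<theta> + 1)) v'"
  using assms
proof (induction M arbitrary: \<theta> v v')
  case (0 \<theta> v v')
  have "(LINT y|lagm \<theta>. v y) = 0" using 0(5)[of 1] by (simp add: ip_def)
  from gap_dual[OF 0(1-4) this] obtain f f' where
    f: "f \<in> L2 (lagm (\<theta> + 1))" "sq (lagm (\<theta> + 1)) f + sq (lagm (\<theta> + 2)) f' \<le> sq (lagm \<theta>) v"
      "ip (lagm (\<theta> + 1)) f v' = sq (lagm \<theta>) v" by blast
  have "(sq (lagm \<theta>) v)\<^sup>2 \<le> sq (lagm (\<theta> + 1)) f * sq (lagm (\<theta> + 1)) v'"
    using L2_Cauchy_Schwarz[OF f(1) 0(4)] f(3) by simp
  also have "\<dots> \<le> sq (lagm \<theta>) v * sq (lagm (\<theta> + 1)) v'"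
    using f(2) sq_nonneg[of "lagm (\<theta> + 2)" f'] by (intro mult_right_mono) (auto simp del: sq_nonneg, simp)
  finally have "sq (lagm \<theta>) v * sq (lagm \<theta>) v \<le> sq (lagm \<theta>) v * sq (lagm (\<theta> + 1)) v'"
    by (simp add: power2_eq_square)
  then show ?case
    using sq_nonneg[of "lagm \<theta>" v] sq_nonneg[of "lagm (\<theta> + 1)" v']
    by (cases "sq (lagm \<theta>) v = 0") (auto simp del: sq_nonneg)
next
  case (Suc M \<theta> v v')
  have "(LINT y|lagm \<theta>. v y) = 0" using Suc(6)[of 1] by (simp add: ip_def)
  from gap_dual[OF Suc(2-5) this] obtain f f' where
    f: "ac_deriv f f'" "f \<in> L2 (lagm (\<theta> + 1))" "f' \<in> L2 (lagm (\<theta> + 2))"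
      "sq (lagm (\<theta> + 1)) f + sq (lagm (\<theta> + 2)) f' \<le> sq (lagm \<theta>) v"
      "ip (lagm (\<theta> + 1)) f v' = sq (lagm \<theta>) v"
      "\<And>p. ip (lagm \<theta>) v (poly p) = 0 \<Longrightarrow> ip (lagm (\<theta> + 1)) f (poly (pderiv p)) = 0" by blast
  have orth: "ip (lagm (\<theta> + 1)) f (poly q) = 0" if "degree q \<le> M" for q
    using poly_antiderivative[of q] f(6) Suc(6) that by (metis Suc_le_mono order_trans)
  have t2: "\<theta> + 1 + 1 = \<theta> + 2" by simp
  have "(real M + 1) * sq (lagm (\<theta> + 1)) f \<le> sq (lagm (\<theta> + 2)) f'"
    using Suc.IH[of "\<theta> + 1" f f', unfolded t2] f orth Suc(2) by auto
  \<comment> \<open>The induction hypothesis bounds \<open>f'\<close> from below by M + 1 times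
    \<open>f\<close>, and the square of \<open>f\<close> itself adds one more. Cauchy-Schwarz on
    \<open>ip f v' = sq v\<close> then converts smallness of \<open>f\<close> into the gap for
    \<open>v\<close>.\<close>
  then have fM: "(real (Suc M) + 1) * sq (lagm (\<theta> + 1)) f \<le> sq (lagm \<theta>) v"
    using f(4) by (simp add: algebra_simps)
  have "(sq (lagm \<theta>) v)\<^sup>2 \<le> sq (lagm (\<theta> + 1)) f * sq (lagm (\<theta> + 1)) v'"
    using L2_Cauchy_Schwarz[OF f(2) Suc(5)] f(5) by simp
  then have "(real (Suc M) + 1) * (sq (lagm \<theta>) v)\<^sup>2 \<le> (real (Suc M) + 1) * (sq (lagm (\<theta> + 1)) f * sq (lagm (\<theta> + 1)) v')"
    by (intro mult_left_mono) auto
  also have "\<dots> \<le> sq (lagm \<theta>) v * sq (lagm (\<theta> + 1)) v'"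
    using mult_right_mono[OF fM, of "sq (lagm (\<theta> + 1)) v'"] by (simp add: mult.assoc)
  finally have "sq (lagm \<theta>) v * ((real (Suc M) + 1) * sq (lagm \<theta>) v) \<le> sq (lagm \<theta>) v * sq (lagm (\<theta> + 1)) v'"
    by (simp add: power2_eq_square mult.left_commute)
  then show ?case
    using sq_nonneg[of "lagm \<theta>" v] sq_nonneg[of "lagm (\<theta> + 1)" v']
    by (cases "sq (lagm \<theta>) v = 0") (auto simp del: sq_nonneg)
qed

section \<open>Laguerre polynomials\<close>

lemma poly_ac_deriv: "ac_deriv (poly p) (poly (pderiv p))"
  by (rule ac_deriv_C1[OF poly_DERIV]) (intro continuous_intros)

lemma L2_mult_poly_integrable:
  assumes "\<theta> > -1" "f \<in> L2 (lagm \<theta>)"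
  shows "integrable (lagm \<theta>) (\<lambda>y. f y * poly p y)"
  by (rule L2_mult_integrable[OF assms(2) poly_L2[OF assms(1)]])

text \<open>The adjoint of differentiation between the weights \<open>wt \<theta>\<close> and
  \<open>wt (\<theta> + 1)\<close>, that is \<open>- (wt (\<theta> + 1) * q)' / wt \<theta>\<close>,
  which by the Pearson equation is again a polynomial.\<close>

definition adjoint :: "real \<Rightarrow> real poly \<Rightarrow> real poly" where
  "adjoint \<theta> q = [:- (\<theta> + 1), 1:] * q - [:0, 1:] * pderiv q"

lemma poly_adjoint: "poly (adjoint \<theta> q) y = (y - (\<theta> + 1)) * poly q y - y * poly (pderiv q) y"
  by (simp add: adjoint_def algebra_simps)

lemma degree_adjoint: "degree (adjoint \<theta> q) \<le> Suc (degree q)"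
proof -
  have "degree ([:- (\<theta> + 1), 1:] * q) \<le> Suc (degree q)"
    using degree_mult_le[of "[:- (\<theta> + 1), 1:]" q] by (simp del: mult_pCons_left)
  moreover have "degree ([:0, 1:] * pderiv q) \<le> Suc (degree q)"
    using degree_mult_le[of "[:0, 1:]" "pderiv q"] by (simp add: degree_pderiv del: mult_pCons_left)
  ultimately show ?thesis unfolding adjoint_def by (rule degree_diff_le)
qed

text \<open>Integration by parts. The boundary product \<open>v * q * wt (\<theta> + 1)\<close>
  divided by y is \<open>wt \<theta> * v * q\<close>, which is integrable, so the boundary criterion
  applies with \<open>k = 1\<close>.\<close>

lemma ip_deriv:
  assumes th: "\<theta> > -1" and v: "ac_deriv v v'" and vL: "v \<in> L2 (lagm \<theta>)" and vL': "v' \<in> L2 (lagm (\<theta> + 1))"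
  shows "ip (lagm (\<theta> + 1)) v' (poly q) = ip (lagm \<theta>) v (poly (adjoint \<theta> q))"
proof -
  have th': "\<theta> + 1 > -1" using th by simp
  define k where "k y = poly q y * wt (\<theta> + 1) y" for y
  define k' where "k' y = - (wt \<theta> y * poly (adjoint \<theta> q) y)" for y
  have k: "ac_deriv k k'"
  proof (rule ac_deriv_C1)
    fix y :: real assume y: "y > 0"
    have "(k has_real_derivative poly (pderiv q) y * wt (\<theta> + 1) y + ((\<theta> + 1 - y) * wt \<theta> y) * poly q y) (at y)"
      unfolding k_def by (intro DERIV_mult poly_DERIV wt_deriv1 y)
    moreover have "poly (pderiv q) y * wt (\<theta> + 1) y + ((\<theta> + 1 - y) * wt \<theta> y) * poly q y = k' y"
      unfolding k'_def poly_adjoint wt_plus1[OF y] by (simp add: algebra_simps)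
    ultimately show "(k has_real_derivative k' y) (at y)" by simp
  qed (unfold k'_def, intro continuous_intros wt_continuous)
  have i1: "integrable (lagm (\<theta> + 1)) (\<lambda>y. v' y * poly q y)" by (rule L2_mult_poly_integrable[OF th' vL'])
  have i2: "integrable (lagm \<theta>) (\<lambda>y. v y * poly (adjoint \<theta> q) y)" by (rule L2_mult_poly_integrable[OF th vL])
  have i3: "integrable (lagm \<theta>) (\<lambda>y. v y * poly q y)" by (rule L2_mult_poly_integrable[OF th vL])
  note a1 = lagm_abs_integrable[OF i1] and a2 = lagm_abs_integrable[OF i2] and a3 = lagm_abs_integrable[OF i3]
  have eq: "v' y * k y + v y * k' y = wt (\<theta> + 1) y * (v' y * poly q y) - wt \<theta> y * (v y * poly (adjoint \<theta> q) y)" for y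
    by (simp add: k_def k'_def algebra_simps)
  have "integral {0<..} (\<lambda>y. v' y * k y + v y * k' y) = 0"
  proof (rule ac_deriv_integral_eq_0[OF ac_deriv_mult[OF v k], where k = 1])
    show "(\<lambda>y. v' y * k y + v y * k' y) absolutely_integrable_on {0<..}"
      unfolding eq by (rule set_integral_diff(1)[OF a1 a2])
    have "(\<lambda>y. \<bar>wt \<theta> y * (v y * poly q y)\<bar>) absolutely_integrable_on {0<..}"
      by (rule set_integrable_abs[OF a3])
    moreover have "\<bar>wt \<theta> y * (v y * poly q y)\<bar> = \<bar>v y * k y\<bar> ^ 1 / y" if "y \<in> {0<..}" for y
      using that by (simp add: k_def wt_plus1 abs_mult)
    ultimately show "(\<lambda>y. \<bar>v y * k y\<bar> ^ 1 / y) absolutely_integrable_on {0<..}"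
      by (subst set_integrable_cong[OF refl refl]) (auto intro: sym)
  qed simp
  then show ?thesis
    unfolding eq ip_def lagm_integral[OF i1] lagm_integral[OF i2]
    using integral_diff[OF set_lebesgue_integral_eq_integral(1)[OF a1] set_lebesgue_integral_eq_integral(1)[OF a2]]
    by simp
qed

section \<open>Recurrences and orthogonality of the Laguerre polynomials\<close>

definition lagpoly :: "nat \<Rightarrow> real \<Rightarrow> real poly" where
  "lagpoly n \<theta> = (\<Sum>r=0..n. monom ((-1) ^ r / fact r * ((real n + \<theta>) gchoose (n - r))) r)"

lemma poly_lagpoly: "poly (lagpoly n \<theta>) y = laguerre n \<theta> y"
  by (simp add: lagpoly_def laguerre_def poly_sum poly_monom)

lemma coeff_lagpoly:
  "coeff (lagpoly n \<theta>) r = (if r \<le> n then (-1) ^ r / fact r * ((real n + \<theta>) gchoose (n - r)) else 0)"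
proof -
  have "coeff (lagpoly n \<theta>) r = (\<Sum>i=0..n. if i = r then (-1) ^ i / fact i * ((real n + \<theta>) gchoose (n - i)) else 0)"
    unfolding lagpoly_def coeff_sum coeff_monom ..
  then show ?thesis by (simp add: sum.delta)
qed

lemma lagpoly_0 [simp]: "lagpoly 0 \<theta> = 1"
  by (rule poly_eqI) (auto simp: coeff_lagpoly coeff_1)

lemma degree_lagpoly [simp]: "degree (lagpoly n \<theta>) = n"
proof (rule antisym)
  show "degree (lagpoly n \<theta>) \<le> n" by (rule degree_le) (auto simp: coeff_lagpoly)
  show "n \<le> degree (lagpoly n \<theta>)" by (rule le_degree) (auto simp: coeff_lagpoly)
qed

lemma lagpoly_nonzero [simp]: "lagpoly n \<theta> \<noteq> 0"
  by (metis coeff_0 coeff_lagpoly diff_self_eq_0 divide_eq_0_iff fact_nonzero gbinomial_0(1) le_refl mult_cancel_left1 power_eq_0_iff zero_neq_neg_one mult_eq_0_iff zero_neq_one)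

lemma pderiv_lagpoly: "pderiv (lagpoly (Suc n) \<theta>) = - lagpoly n (\<theta> + 1)"
proof (rule poly_eqI)
  fix r
  have A: "real (Suc n) + \<theta> = real n + (\<theta> + 1)" by simp
  have "real (Suc r) * ((-1) ^ Suc r / fact (Suc r) * a) = - ((-1) ^ r / fact r * a)" for a :: real
    by (simp add: field_simps del: of_nat_Suc)
  then show "coeff (pderiv (lagpoly (Suc n) \<theta>)) r = coeff (- lagpoly n (\<theta> + 1)) r"
    unfolding coeff_pderiv coeff_minus coeff_lagpoly A by (simp del: fact_Suc of_nat_Suc power_Suc)
qed

text \<open>One step of the Rodrigues formula, raising the degree and lowering the parameter.
  Together with the derivative rule it drives orthogonality and the bounds on the zeros.\<close>

lemma lagpoly_Suc: "smult (real (Suc n)) (lagpoly (Suc n) \<theta>) = - adjoint \<theta> (lagpoly n (\<theta> + 1))"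
proof (rule poly_eqI)
  fix r
  define c where "c r = coeff (lagpoly n (\<theta> + 1)) r" for r
  define A where "A = real n + \<theta> + 1"
  have A: "real (Suc n) + \<theta> = A" "real n + (\<theta> + 1) = A" by (auto simp: A_def)
  have R: "coeff (- adjoint \<theta> (lagpoly n (\<theta> + 1))) r = (\<theta> + 1) * c r - (if r = 0 then 0 else c (r - 1)) + real r * c r"
    by (cases r) (auto simp: adjoint_def c_def coeff_pderiv coeff_pCons algebra_simps)
  have cl: "coeff (lagpoly (Suc n) \<theta>) r = (if r \<le> Suc n then (-1) ^ r / fact r * (A gchoose (Suc n - r)) else 0)"
    and cr: "c r = (if r \<le> n then (-1) ^ r / fact r * (A gchoose (n - r)) else 0)" for r
    unfolding coeff_lagpoly c_def A by auto
  consider "r \<le> n" | "r = Suc n" | "r > Suc n" by linarith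
  then show "coeff (smult (real (Suc n)) (lagpoly (Suc n) \<theta>)) r = coeff (- adjoint \<theta> (lagpoly n (\<theta> + 1))) r"
  proof cases
    case 1
    \<comment> \<open>The absorption identity for binomials; the factor \<theta> + 1 + r is
      \<open>A - (n - r)\<close>.\<close>
    have abs: "(real n - real r + 1) * (A gchoose (Suc n - r)) = (\<theta> + 1 + real r) * (A gchoose (n - r))"
      using gbinomial_mult_1[of A "n - r"] 1 by (simp add: Suc_diff_le A_def of_nat_diff algebra_simps)
    have prev: "(if r = 0 then 0 else c (r - 1)) = - ((-1) ^ r / fact r) * (real r * (A gchoose (Suc n - r)))"
    proof (cases r)
      case (Suc k)
      have k: "Suc n - r = n - k" "k \<le> n" using Suc 1 by auto
      have "- ((-1) ^ Suc k / fact (Suc k)) * (real (Suc k) * a) = (-1) ^ k / fact k * a" for a :: real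
        by (simp add: field_simps del: of_nat_Suc)
      then show ?thesis using Suc k by (simp add: cr del: fact_Suc of_nat_Suc power_Suc)
    qed simp
    have "coeff (smult (real (Suc n)) (lagpoly (Suc n) \<theta>)) r = (-1) ^ r / fact r * ((real n - real r + 1) * (A gchoose (Suc n - r)) + real r * (A gchoose (Suc n - r)))"
      using 1 by (simp add: cl algebra_simps add_divide_distrib)
    also have "\<dots> = coeff (- adjoint \<theta> (lagpoly n (\<theta> + 1))) r"
      unfolding R prev abs using 1 by (simp add: cr algebra_simps add_divide_distrib)
    finally show ?thesis .
  next
    case 2
    then show ?thesis unfolding R by (simp add: cl cr field_simps del: of_nat_Suc)
  next
    case 3
    then show ?thesis unfolding R by (auto simp: cl cr)
  qed
qed

text \<open>The raising relation moves the adjoint onto \<open>p\<close> as a derivative. Both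
  degrees drop by one and \<theta> rises by one, so the induction must range over all
  \<theta>.\<close>

lemma lagpoly_orthogonal:
  assumes "\<theta> > -1" "degree p < n"
  shows "ip (lagm \<theta>) (poly p) (poly (lagpoly n \<theta>)) = 0"
  using assms
proof (induction n arbitrary: \<theta> p)
  case (Suc n)
  have z: "ip (lagm (\<theta> + 1)) (poly (pderiv p)) (poly (lagpoly n (\<theta> + 1))) = 0"
  proof (cases "degree p = 0")
    case True
    then have "pderiv p = 0" by (simp add: pderiv_eq_0_iff)
    then show ?thesis by (simp add: ip_def)
  next
    case False
    then show ?thesis using Suc.prems by (intro Suc.IH) (auto simp: degree_pderiv)
  qed
  have "real (Suc n) * ip (lagm \<theta>) (poly p) (poly (lagpoly (Suc n) \<theta>)) = ip (lagm \<theta>) (poly p) (poly (smult (real (Suc n)) (lagpoly (Suc n) \<theta>)))"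
    by (simp add: ip_cmult[symmetric] poly_smult[abs_def] del: of_nat_Suc)
  also have "\<dots> = ip (lagm \<theta>) (poly p) (\<lambda>y. (-1) * poly (adjoint \<theta> (lagpoly n (\<theta> + 1))) y)"
    unfolding lagpoly_Suc by (simp add: poly_minus[abs_def])
  also have "\<dots> = - ip (lagm \<theta>) (poly p) (poly (adjoint \<theta> (lagpoly n (\<theta> + 1))))"
    unfolding ip_cmult by simp
  also have "\<dots> = - ip (lagm (\<theta> + 1)) (poly (pderiv p)) (poly (lagpoly n (\<theta> + 1)))"
    using ip_deriv[OF Suc.prems(1) poly_ac_deriv poly_L2 poly_L2, of p "lagpoly n (\<theta> + 1)"] Suc.prems(1) by simp
  finally show ?case using z by simp
qed simp

section \<open>Number and location of the zeros\<close>

lemma poly_nonneg_integral_pos: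
  assumes th: "\<theta> > -1" and p: "p \<noteq> 0" "\<And>y. y > 0 \<Longrightarrow> poly p y \<ge> 0"
  shows "(LINT y|lagm \<theta>. poly p y) > 0"
proof -
  have fin: "finite {y. poly p y = 0}" by (rule poly_roots_finite[OF p(1)])
  obtain R where R: "\<And>y. poly p y = 0 \<Longrightarrow> y \<le> R"
    using bdd_above_finite[OF fin] unfolding bdd_above_def by auto
  \<comment> \<open>To the right of every root, where the polynomial is strictly positive on a whole
    interval.\<close>
  define a where "a = max R 0 + 1"
  have a: "a > 0" "a > R" by (auto simp: a_def)
  have pos: "wt \<theta> y * poly p y > 0" if "y \<in> {a..a+1}" for y
    using that a p(2)[of y] R[of y] wt_pos[of y \<theta>] by (intro mult_pos_pos) (auto simp: less_le)
  have cont: "continuous_on {a..a+1} (\<lambda>y. wt \<theta> y * poly p y)"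
    by (intro continuous_intros continuous_on_subset[OF wt_continuous]) (use a in auto)
  obtain x where x: "x \<in> {a..a+1}" "\<And>y. y \<in> {a..a+1} \<Longrightarrow> wt \<theta> x * poly p x \<le> wt \<theta> y * poly p y"
    using continuous_attains_inf[OF _ _ cont] by auto
  have i: "integrable (lagm \<theta>) (poly p)" by (rule poly_integrable[OF th])
  have "0 < integral {a..a+1} (\<lambda>_. wt \<theta> x * poly p x)" using pos[OF x(1)] by simp
  also have "\<dots> \<le> integral {a..a+1} (\<lambda>y. wt \<theta> y * poly p y)"
    by (rule integral_le) (use x(2) cont in \<open>auto intro: integrable_continuous_real\<close>)
  also have "\<dots> \<le> integral {0<..} (\<lambda>y. wt \<theta> y * poly p y)"
    by (rule integral_subset_le)
       (use a cont p(2) set_lebesgue_integral_eq_integral(1)[OF lagm_abs_integrable[OF i]] in \<open>auto intro: integrable_continuous_real\<close>)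
  finally show ?thesis by (simp add: lagm_integral[OF i])
qed

lemma ip_poly_self_pos:
  assumes "\<theta> > -1" "p \<noteq> 0"
  shows "ip (lagm \<theta>) (poly p) (poly p) > 0"
  using poly_nonneg_integral_pos[OF assms(1), of "p * p"] assms(2) by (simp add: ip_def poly_mult[abs_def])

text \<open>\<open>Z\<close> collects the positive roots of odd multiplicity: each extracted factor
  toggles the membership of its root, so that every root occurs an even number of times in the
  product.\<close>

lemma poly_sign_change_set:
  fixes p :: "real poly"
  assumes "p \<noteq> 0"
  shows "\<exists>Z s. finite Z \<and> Z \<subseteq> {y. 0 < y \<and> poly p y = 0} \<and> (s = 1 \<or> s = -1) \<and>
    (\<forall>y>0. s * poly (p * (\<Prod>z\<in>Z. [:-z, 1:])) y \<ge> 0)"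
  using assms
proof (induction "degree p" arbitrary: p rule: less_induct)
  case less
  show ?case
  proof (cases "\<exists>z>0. poly p z = 0")
    case False
    have "(\<forall>y>0. poly p y \<ge> 0) \<or> (\<forall>y>0. poly p y \<le> 0)"
    proof (rule ccontr)
      assume "\<not> ?thesis"
      then obtain a b where ab: "a > 0" "poly p a < 0" "b > 0" "poly p b > 0" by (auto simp: not_le)
      have "\<exists>x>0. poly p x = 0"
      proof (cases "a < b")
        case True
        then show ?thesis using poly_IVT_pos[OF True ab(2,4)] ab(1) less_trans by blast
      next
        case False
        then have "b < a" using ab by (cases "a = b") auto
        then show ?thesis using poly_IVT_neg[OF _ ab(4,2)] ab(3) less_trans by blast
      qed
      then show False using \<open>\<not> (\<exists>z>0. poly p z = 0)\<close> by blast
    qed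
    then show ?thesis
    proof
      assume "\<forall>y>0. poly p y \<ge> 0"
      then show ?thesis by (intro exI[of _ "{}"] exI[of _ 1]) auto
    next
      assume "\<forall>y>0. poly p y \<le> 0"
      then show ?thesis by (intro exI[of _ "{}"] exI[of _ "-1"]) auto
    qed
  next
    case True
    then obtain z where z: "z > 0" "poly p z = 0" by blast
    then obtain q where q: "p = [:-z, 1:] * q" by (auto simp: poly_eq_0_iff_dvd)
    have q0: "q \<noteq> 0" using less.prems q by auto
    have "degree q < degree p" unfolding q using q0 by (subst degree_mult_eq) auto
    from less.hyps[OF this q0] obtain Z s where Z: "finite Z" "Z \<subseteq> {y. 0 < y \<and> poly q y = 0}" "s = 1 \<or> s = -1"
      "\<And>y. y > 0 \<Longrightarrow> s * poly (q * (\<Prod>z\<in>Z. [:-z, 1:])) y \<ge> 0" by blast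
    show ?thesis
    proof (cases "z \<in> Z")
      case True
      have "(\<Prod>z\<in>Z. [:-z, 1:]) = [:-z, 1:] * (\<Prod>z\<in>Z - {z}. [:-z, 1:])"
        by (rule prod.remove[OF Z(1) True])
      then have "p * (\<Prod>z\<in>Z - {z}. [:-z, 1:]) = q * (\<Prod>z\<in>Z. [:-z, 1:])" unfolding q by (simp only: mult_ac)
      then show ?thesis using Z by (intro exI[of _ "Z - {z}"] exI[of _ s]) (auto simp: q)
    next
      case False
      have eq: "p * (\<Prod>z\<in>insert z Z. [:-z, 1:]) = [:-z, 1:] * [:-z, 1:] * (q * (\<Prod>z\<in>Z. [:-z, 1:]))"
        unfolding q prod.insert[OF Z(1) False] by (simp only: mult_ac)
      have "s * poly (p * (\<Prod>z\<in>insert z Z. [:-z, 1:])) y \<ge> 0" if "y > 0" for y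
      proof -
        have "s * poly (p * (\<Prod>z\<in>insert z Z. [:-z, 1:])) y = (y - z)\<^sup>2 * (s * poly (q * (\<Prod>z\<in>Z. [:-z, 1:])) y)"
          unfolding eq poly_mult by (simp add: power2_eq_square algebra_simps)
        moreover have "\<dots> \<ge> 0" by (intro mult_nonneg_nonneg Z(4)[OF that]) simp
        ultimately show ?thesis by linarith
      qed
      then show ?thesis using Z z by (intro exI[of _ "insert z Z"] exI[of _ s]) (auto simp: q)
    qed
  qed
qed

lemma degree_prod_linear: "finite Z \<Longrightarrow> degree (\<Prod>z\<in>Z. [:-z, 1 :: real:]) = card Z"
  by (subst degree_prod_eq_sum_degree) auto

text \<open>With fewer than n sign changes, a polynomial of degree below n would match the sign of
  the Laguerre polynomial on the half-line. Their product would have positive integral, against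
  orthogonality.\<close>

lemma card_laguerre_zeros:
  assumes th: "\<theta> > -1"
  shows "finite {y. 0 < y \<and> laguerre n \<theta> y = 0}" "card {y. 0 < y \<and> laguerre n \<theta> y = 0} = n"
proof -
  let ?X = "{y. 0 < y \<and> poly (lagpoly n \<theta>) y = 0}"
  have fin: "finite ?X"
    by (rule finite_subset[OF _ poly_roots_finite[OF lagpoly_nonzero[of n \<theta>]]]) auto
  have "card ?X \<le> card {y. poly (lagpoly n \<theta>) y = 0}"
    by (intro card_mono poly_roots_finite) auto
  also have "\<dots> \<le> n" using card_poly_roots_bound[of "lagpoly n \<theta>"] by simp
  finally have le: "card ?X \<le> n" .
  obtain Z s where Z: "finite Z" "Z \<subseteq> ?X" "s = 1 \<or> s = -1"
    "\<And>y. y > 0 \<Longrightarrow> s * poly (lagpoly n \<theta> * (\<Prod>z\<in>Z. [:-z, 1:])) y \<ge> 0"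
    using poly_sign_change_set[of "lagpoly n \<theta>"] by auto
  have "n \<le> card Z"
  proof (rule ccontr)
    assume "\<not> n \<le> card Z"
    then have d: "degree (smult s (\<Prod>z\<in>Z. [:-z, 1:])) < n"
      using degree_prod_linear[OF Z(1)] Z(3) by auto
    let ?q = "smult s (\<Prod>z\<in>Z. [:-z, 1:])"
    have nz: "?q * lagpoly n \<theta> \<noteq> 0" using Z(1,3) by auto
    have "(LINT y|lagm \<theta>. poly (?q * lagpoly n \<theta>) y) > 0"
      using nz Z(4) by (intro poly_nonneg_integral_pos[OF th]) (auto simp: mult_ac)
    then show False using lagpoly_orthogonal[OF th d] unfolding ip_def poly_mult by simp
  qed
  also have "card Z \<le> card ?X" by (rule card_mono[OF fin Z(2)])
  finally show "card {y. 0 < y \<and> laguerre n \<theta> y = 0} = n" using le by (simp add: poly_lagpoly)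
  show "finite {y. 0 < y \<and> laguerre n \<theta> y = 0}" using fin by (simp add: poly_lagpoly)
qed

text \<open>The derivative is minus the polynomial of degree one less with parameter \<theta> + 1,
  inductively between 0 and its value at 0. The raising relation at 0 compares that value with the
  starting height, so the descent cannot reach 0 within the stated range.\<close>

lemma lagpoly_positive_near_0:
  assumes "\<theta> > -1" "0 \<le> y" "real n * y < \<theta> + 1"
  shows "0 < poly (lagpoly n \<theta>) y \<and> poly (lagpoly n \<theta>) y \<le> poly (lagpoly n \<theta>) 0"
  using assms
proof (induction n arbitrary: \<theta> y)
  case (Suc n)
  let ?L = "poly (lagpoly (Suc n) \<theta>)" and ?K = "poly (lagpoly n (\<theta> + 1))"
  have IH: "0 < ?K t \<and> ?K t \<le> ?K 0" if "0 \<le> t" "t \<le> y" for t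
  proof (rule Suc.IH)
    have "real n * t \<le> real (Suc n) * y" using that by (intro mult_mono) auto
    then show "real n * t < \<theta> + 1 + 1" using Suc.prems by simp
  qed (use Suc.prems that in auto)
  have L0: "real (Suc n) * ?L 0 = (\<theta> + 1) * ?K 0"
  proof -
    have "real (Suc n) * ?L 0 = poly (smult (real (Suc n)) (lagpoly (Suc n) \<theta>)) 0" by simp
    also have "\<dots> = (\<theta> + 1) * ?K 0" unfolding lagpoly_Suc by (simp add: poly_adjoint algebra_simps)
    finally show ?thesis .
  qed
  show ?case
  proof (cases "y = 0")
    case True
    then show ?thesis using L0 IH[of 0] Suc.prems
      by (metis add.commute dual_order.refl mult_pos_pos of_nat_0_less_iff less_add_iff1 zero_less_Suc zero_less_mult_pos neg_less_iff_less minus_less_iff real_0_less_add_iff)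
  next
    case False
    then have y: "y > 0" using Suc.prems by simp
    obtain t where t: "0 < t" "t < y" "?L y - ?L 0 = (y - 0) * poly (pderiv (lagpoly (Suc n) \<theta>)) t"
      using poly_MVT[OF y, of "lagpoly (Suc n) \<theta>"] by blast
    have eq: "?L y = ?L 0 - y * ?K t" using t(3) by (simp add: pderiv_lagpoly)
    have K: "0 < ?K t" "?K t \<le> ?K 0" using IH[of t] t by auto
    have "real (Suc n) * ?L y = (\<theta> + 1) * ?K 0 - real (Suc n) * y * ?K t"
      unfolding eq right_diff_distrib L0 by simp
    moreover have "real (Suc n) * y * ?K t \<le> real (Suc n) * y * ?K 0"
      using K y by (intro mult_left_mono) auto
    moreover have "real (Suc n) * y * ?K 0 < (\<theta> + 1) * ?K 0"
      using K Suc.prems by (intro mult_strict_right_mono) auto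
    ultimately have "real (Suc n) * ?L y > 0" by linarith
    then have "?L y > 0" by (simp add: zero_less_mult_iff)
    moreover have "?L y \<le> ?L 0" using eq K y by simp
    ultimately show ?thesis by simp
  qed
qed simp

text \<open>With signs normalised, the recurrence has one positive and one negative term. The factor
  2 in the claim bounds the negative one by y/2 times the current value; the threshold is exactly
  what makes \<open>y / 2 - \<theta> - 1\<close> at least twice the new degree, which reproduces the
  factor 2.\<close>

lemma lagpoly_sign_large:
  assumes "\<theta> > -1" "4 * real (Suc n) + 2 * \<theta> + 2 \<le> y"
  shows "0 < (-1) ^ n * poly (lagpoly n (\<theta> + 1)) y \<and>
    2 * ((-1) ^ n * poly (lagpoly n (\<theta> + 1)) y) \<le> (-1) ^ Suc n * poly (lagpoly (Suc n) \<theta>) y"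
  using assms
proof (induction n arbitrary: \<theta>)
  case 0
  have "poly (smult (real (Suc 0)) (lagpoly (Suc 0) \<theta>)) y = \<theta> + 1 - y"
    unfolding lagpoly_Suc by (simp add: poly_adjoint)
  then show ?case using 0 by simp
next
  case (Suc n)
  define s1 where "s1 = (-1) ^ Suc n * poly (lagpoly (Suc n) (\<theta> + 1)) y"
  define s0 where "s0 = (-1) ^ n * poly (lagpoly n (\<theta> + 2)) y"
  define s2 where "s2 = (-1) ^ Suc (Suc n) * poly (lagpoly (Suc (Suc n)) \<theta>) y"
  have t2: "\<theta> + 1 + 1 = \<theta> + 2" by simp
  have IH: "0 < s0" "2 * s0 \<le> s1"
    using Suc.IH[of "\<theta> + 1"] Suc.prems unfolding t2 s1_def s0_def by auto
  have "real (Suc (Suc n)) * poly (lagpoly (Suc (Suc n)) \<theta>) y = poly (smult (real (Suc (Suc n))) (lagpoly (Suc (Suc n)) \<theta>)) y" by simp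
  also have "\<dots> = (\<theta> + 1 - y) * poly (lagpoly (Suc n) (\<theta> + 1)) y - y * poly (lagpoly n (\<theta> + 2)) y"
    unfolding lagpoly_Suc by (simp add: poly_adjoint pderiv_lagpoly t2 algebra_simps)
  finally have L: "real (Suc (Suc n)) * poly (lagpoly (Suc (Suc n)) \<theta>) y = \<dots>" .
  have s: "s2 = (-1) ^ n * poly (lagpoly (Suc (Suc n)) \<theta>) y" "s1 = - ((-1) ^ n * poly (lagpoly (Suc n) (\<theta> + 1)) y)"
    unfolding s2_def s1_def by simp_all
  have "real (Suc (Suc n)) * s2 = (-1) ^ n * (real (Suc (Suc n)) * poly (lagpoly (Suc (Suc n)) \<theta>) y)"
    unfolding s by (rule mult.left_commute)
  also have "\<dots> = (y - \<theta> - 1) * s1 - y * s0"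
    unfolding L s s0_def by algebra
  finally have "real (Suc (Suc n)) * s2 = (y - \<theta> - 1) * s1 - y * s0" .
  moreover have "(y - \<theta> - 1) * s1 - y * s0 \<ge> (y - \<theta> - 1) * s1 - y * (s1 / 2)"
  proof -
    have "y \<ge> 0" using Suc.prems by simp
    then have "y * s0 \<le> y * (s1 / 2)" using IH by (intro mult_left_mono) auto
    then show ?thesis by simp
  qed
  moreover have "(y - \<theta> - 1) * s1 - y * (s1 / 2) = (y / 2 - \<theta> - 1) * s1" by (simp add: algebra_simps)
  moreover have "(y / 2 - \<theta> - 1) * s1 \<ge> (2 * real (Suc (Suc n))) * s1"
    using Suc.prems IH by (intro mult_right_mono) auto
  ultimately have "(2 * real (Suc (Suc n))) * s1 \<le> real (Suc (Suc n)) * s2" by linarith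
  then have "real (Suc (Suc n)) * (2 * s1) \<le> real (Suc (Suc n)) * s2" by (simp only: mult_ac)
  then have "2 * s1 \<le> s2" by (subst (asm) mult_le_cancel_left_pos) auto
  then show ?case using IH unfolding s1_def s2_def by simp
qed

text \<open>Lower bounds of order 1/n and upper bounds of order n are all that is needed to make the
  number of relevant dyadic intervals logarithmic.\<close>

lemma laguerre_zero_bounds:
  assumes th: "\<theta> > -1" and y: "0 < y" "laguerre (Suc n) \<theta> y = 0"
  shows "(\<theta> + 1) / real (Suc n) \<le> y" "y \<le> 4 * real (Suc n) + 2 * \<theta> + 2"
proof -
  show "(\<theta> + 1) / real (Suc n) \<le> y"
  proof (rule ccontr)
    assume "\<not> ?thesis"
    then have "real (Suc n) * y < \<theta> + 1" by (simp add: field_simps)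
    then show False using lagpoly_positive_near_0[OF th, of y "Suc n"] y by (simp add: poly_lagpoly)
  qed
  show "y \<le> 4 * real (Suc n) + 2 * \<theta> + 2"
    using lagpoly_sign_large[OF th, of n y] y by (force simp: poly_lagpoly)
qed

lemma poly_projection:
  assumes th: "\<theta> > -1" and u: "u \<in> L2 (lagm \<theta>)"
  shows "\<exists>p. degree p \<le> M \<and> (\<forall>q. degree q \<le> M \<longrightarrow> ip (lagm \<theta>) (\<lambda>y. u y - poly p y) (poly q) = 0)"
proof (induction M)
  let ?N = "lagm \<theta>"
  have PL: "poly p \<in> L2 ?N" for p by (rule poly_L2[OF th])
  \<comment> \<open>One Gram-Schmidt step in the direction of the Laguerre polynomial of degree
    \<open>n\<close>. For \<open>n = 0\<close> the orthogonality premise is vacuous, so the base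
    case is an instance too.\<close>
  have step: "\<exists>p'. degree p' \<le> n \<and> (\<forall>q. degree q \<le> n \<longrightarrow> ip ?N (\<lambda>y. u y - poly p' y) (poly q) = 0)"
    if p: "degree p \<le> n" and orth: "\<And>q. degree q < n \<Longrightarrow> ip ?N (\<lambda>y. u y - poly p y) (poly q) = 0" for p n
  proof -
    let ?L = "lagpoly n \<theta>"
    have uL: "(\<lambda>y. u y - poly p y) \<in> L2 ?N" by (rule L2_diff[OF u PL])
    have LL: "ip ?N (poly ?L) (poly ?L) > 0" by (rule ip_poly_self_pos[OF th]) simp
    define c where "c = ip ?N (\<lambda>y. u y - poly p y) (poly ?L) / ip ?N (poly ?L) (poly ?L)"
    define p' where "p' = p + smult c ?L"
    have ipp': "ip ?N (\<lambda>y. u y - poly p' y) (poly q) = ip ?N (\<lambda>y. u y - poly p y) (poly q) - c * ip ?N (poly q) (poly ?L)" for q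
    proof -
      have "ip ?N (\<lambda>y. u y - poly p' y) (poly q) = ip ?N (poly q) (\<lambda>y. (u y - poly p y) - c * poly ?L y)"
        by (simp add: p'_def ip_commute[of ?N _ "poly q"] algebra_simps)
      then show ?thesis
        by (simp add: ip_diff[OF PL uL L2_cmult[OF PL]] ip_cmult ip_commute[of ?N _ "poly q"])
    qed
    have L0: "ip ?N (\<lambda>y. u y - poly p' y) (poly ?L) = 0"
      unfolding ipp' using LL by (simp add: c_def)
    have u'L: "(\<lambda>y. u y - poly p' y) \<in> L2 ?N" by (rule L2_diff[OF u PL])
    have "ip ?N (\<lambda>y. u y - poly p' y) (poly q) = 0" if q: "degree q \<le> n" for q
    proof -
      define a where "a = coeff q n / coeff ?L n"
      define r where "r = q - smult a ?L"
      have cn: "coeff ?L n \<noteq> 0" using lagpoly_nonzero[of n \<theta>] by (metis degree_lagpoly leading_coeff_0_iff)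
      have r0: "coeff r n = 0" using cn by (simp add: r_def a_def)
      have rd: "degree r \<le> n" unfolding r_def using q by (intro degree_diff_le) auto
      have rz: "r = 0 \<or> degree r < n" using rd r0 by (metis leading_coeff_0_iff le_neq_implies_less)
      have z: "ip ?N (\<lambda>y. u y - poly p' y) (poly r) = 0"
      proof (cases "r = 0")
        case False
        then have "degree r < n" using rz by simp
        then show ?thesis unfolding ipp' using orth lagpoly_orthogonal[OF th] by simp
      qed (simp add: ip_def)
      have "poly q = (\<lambda>y. poly r y + a * poly ?L y)" by (auto simp: r_def)
      then show ?thesis using z L0 by (simp add: ip_add[OF u'L PL L2_cmult[OF PL]] ip_cmult)
    qed
    moreover have "degree p' \<le> n" unfolding p'_def using p by (intro degree_add_le) auto
    ultimately show ?thesis by blast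
  qed
  case 0
  show ?case using step[of 0 0] by simp
  case (Suc M)
  then obtain p where p: "degree p \<le> M" "\<And>q. degree q \<le> M \<Longrightarrow> ip ?N (\<lambda>y. u y - poly p y) (poly q) = 0" by blast
  show ?case using step[of p "Suc M"] p by (simp add: less_Suc_eq_le)
qed

section \<open>Gauss--Laguerre quadrature\<close>

definition lagrange :: "real set \<Rightarrow> real \<Rightarrow> real poly" where
  "lagrange Z z = (\<Prod>r\<in>Z - {z}. smult (1 / (z - r)) [:-r, 1:])"

definition node_poly :: "real set \<Rightarrow> real poly" where
  "node_poly Z = (\<Prod>z\<in>Z. [:-z, 1:])"

text \<open>The Christoffel numbers, written with the square of the Lagrange polynomial so that
  nonnegativity is immediate.\<close>

definition christoffel :: "real set \<Rightarrow> real \<Rightarrow> real \<Rightarrow> real" where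
  "christoffel Z \<theta> z = (LINT y|lagm \<theta>. (poly (lagrange Z z) y)\<^sup>2)"

lemma poly_lagrange:
  assumes "finite Z" "z \<in> Z" "w \<in> Z"
  shows "poly (lagrange Z z) w = (if w = z then 1 else 0)"
proof (cases "w = z")
  case True
  then show ?thesis
    by (auto simp: lagrange_def poly_prod diff_divide_distrib[symmetric] intro!: prod.neutral)
next
  case False
  then have "w \<in> Z - {z}" using assms by simp
  then show ?thesis using assms(1) False by (auto simp: lagrange_def poly_prod intro!: prod_zero)
qed

lemma degree_lagrange:
  assumes "finite Z" "z \<in> Z"
  shows "degree (lagrange Z z) < card Z"
proof -
  have "degree (lagrange Z z) \<le> (\<Sum>r\<in>Z - {z}. degree (smult (1 / (z - r)) [:-r, 1:]))"
    unfolding lagrange_def using degree_prod_sum_le[of "Z - {z}" "\<lambda>r. smult (1 / (z - r)) [:-r, 1:]"] assms(1) by (simp add: comp_def)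
  also have "\<dots> \<le> (\<Sum>r\<in>Z - {z}. 1)" by (intro sum_mono) auto
  also have "\<dots> = card Z - 1" using assms by simp
  also have "\<dots> < card Z" using assms card_gt_0_iff[of Z] by (intro diff_less) auto
  finally show ?thesis .
qed

lemma poly_eq_0_on_nodes:
  fixes p :: "real poly"
  assumes "degree p < card Z" "\<And>z. z \<in> Z \<Longrightarrow> poly p z = 0"
  shows "p = 0"
proof (rule ccontr)
  assume "p \<noteq> 0"
  have "card Z \<le> card {y. poly p y = 0}"
    by (rule card_mono) (use assms(2) poly_roots_finite[OF \<open>p \<noteq> 0\<close>] in auto)
  also have "\<dots> \<le> degree p" by (rule card_poly_roots_bound[OF \<open>p \<noteq> 0\<close>])
  finally show False using assms(1) by simp
qed

lemma lagrange_exact: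
  assumes Z: "finite Z" and p: "degree p < card Z"
  shows "(\<Sum>z\<in>Z. smult (poly p z) (lagrange Z z)) = p"
proof -
  have "p - (\<Sum>z\<in>Z. smult (poly p z) (lagrange Z z)) = 0"
  proof (rule poly_eq_0_on_nodes)
    have "degree (\<Sum>z\<in>Z. smult (poly p z) (lagrange Z z)) < card Z"
      using p degree_lagrange[OF Z] by (intro degree_sum_less) (auto intro: le_less_trans[OF degree_smult_le])
    then show "degree (p - (\<Sum>z\<in>Z. smult (poly p z) (lagrange Z z))) < card Z" using p by (rule degree_diff_less[rotated])
    fix w assume w: "w \<in> Z"
    have "poly (\<Sum>z\<in>Z. smult (poly p z) (lagrange Z z)) w = (\<Sum>z\<in>Z. if w = z then poly p z else 0)"
        by (auto simp: poly_sum poly_lagrange[OF Z _ w] intro!: sum.cong)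
    then show "poly (p - (\<Sum>z\<in>Z. smult (poly p z) (lagrange Z z))) w = 0"
      using w Z by simp
  qed
  then show ?thesis by simp
qed

section \<open>Division that preserves nonnegative coefficients\<close>

definition nonneg_coeffs :: "real poly \<Rightarrow> bool" where
  "nonneg_coeffs p \<longleftrightarrow> (\<forall>i. coeff p i \<ge> 0)"

lemma nonneg_coeffs_poly: "nonneg_coeffs p \<Longrightarrow> x \<ge> 0 \<Longrightarrow> poly p x \<ge> 0"
  unfolding poly_altdef nonneg_coeffs_def by (intro sum_nonneg) auto

text \<open>By the Horner scheme the coefficients of the quotient are values at \<open>z\<close> of
  tails of \<open>p\<close>, and each tail has nonnegative coefficients.\<close>

lemma nonneg_coeffs_synthetic_div:
  assumes "nonneg_coeffs p" "z \<ge> 0"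
  shows "nonneg_coeffs (synthetic_div p z)"
  using assms(1)
proof (induction p)
  case (pCons a p)
  have "nonneg_coeffs p" unfolding nonneg_coeffs_def
  proof
    fix i show "coeff p i \<ge> 0" using pCons.prems unfolding nonneg_coeffs_def by (metis coeff_pCons_Suc)
  qed
  with pCons.IH nonneg_coeffs_poly[OF this assms(2)] show ?case
    by (auto simp: nonneg_coeffs_def coeff_pCons split: nat.split)
qed (simp add: nonneg_coeffs_def)

text \<open>A list and not a set, so that nodes may be repeated.\<close>

definition list_poly :: "real list \<Rightarrow> real poly" where
  "list_poly zs = prod_list (map (\<lambda>z. [:-z, 1:]) zs)"

lemma degree_list_poly: "degree (list_poly zs) \<le> length zs"
proof (induction zs)
  case (Cons z zs)
  then show ?case using degree_mult_le[of "[:-z, 1:]" "list_poly zs"]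
    by (simp add: list_poly_def del: mult_pCons_left)
qed (simp add: list_poly_def)

text \<open>Newton form of Hermite interpolation: \<open>r\<close> interpolates \<open>p\<close> at
  the listed nodes, and the quotient arises from \<open>p\<close> by synthetic division at each node
  in turn.\<close>

lemma division_nonneg_coeffs:
  assumes "nonneg_coeffs p" "\<And>z. z \<in> set zs \<Longrightarrow> z \<ge> 0"
  shows "\<exists>q r. nonneg_coeffs q \<and> p = list_poly zs * q + r \<and> (zs \<noteq> [] \<longrightarrow> degree r < length zs) \<and> (zs = [] \<longrightarrow> r = 0)"
  using assms(2)
proof (induction zs)
  case Nil
  show ?case using assms(1) by (intro exI[of _ p] exI[of _ 0]) (simp add: list_poly_def)
next
  case (Cons z zs)
  then obtain q r where qr: "nonneg_coeffs q" "p = list_poly zs * q + r" "zs \<noteq> [] \<longrightarrow> degree r < length zs" "zs = [] \<longrightarrow> r = 0"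
    by auto
  define q' where "q' = synthetic_div q z"
  have q': "nonneg_coeffs q'" unfolding q'_def using nonneg_coeffs_synthetic_div[OF qr(1), of z] Cons.prems by simp
  have q: "q = [:-z, 1:] * q' + [:poly q z:]"
    unfolding q'_def by (rule synthetic_div_correct'[symmetric])
  have "p = list_poly (z # zs) * q' + (smult (poly q z) (list_poly zs) + r)"
  proof -
    have "p = list_poly zs * ([:-z, 1:] * q' + [:poly q z:]) + r" using qr(2) q by simp
    moreover have "list_poly zs * [:poly q z:] = smult (poly q z) (list_poly zs)" by simp
    ultimately show ?thesis
      unfolding list_poly_def list.map prod_list.Cons by (simp only: distrib_left add.assoc mult_ac)
  qed
  moreover have "degree (smult (poly q z) (list_poly zs) + r) < length (z # zs)"
    using degree_list_poly[of zs] qr(3,4)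
    by (intro degree_add_less) (auto intro: le_less_trans[OF degree_smult_le] simp: le_imp_less_Suc)
  ultimately show ?case using q' by blast
qed

text \<open>The same division in the variable \<open>x = 1 / (a + y)\<close>: each factor \<open>x - c\<close> with
  \<open>c = 1 / (a + z)\<close> equals \<open>- (y - z) * x * c\<close>, so every node contributes a sign.\<close>

lemma division_nonneg_coeffs_inverse:
  assumes "nonneg_coeffs p" "a > 0" "\<And>z. z \<in> set zs \<Longrightarrow> z \<ge> 0"
  shows "\<exists>q r. nonneg_coeffs q \<and> (\<forall>y>0. poly p (1 / (a + y)) = (-1) ^ length zs * poly (list_poly zs) y * poly q (1 / (a + y)) + poly r y) \<and>
    (zs \<noteq> [] \<longrightarrow> degree r < length zs) \<and> (zs = [] \<longrightarrow> r = 0)"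
  using assms(3)
proof (induction zs)
  case Nil
  show ?case using assms(1) by (intro exI[of _ p] exI[of _ 0]) (simp add: list_poly_def)
next
  case (Cons z zs)
  then obtain q r where qr: "nonneg_coeffs q"
      "\<And>y. y > 0 \<Longrightarrow> poly p (1 / (a + y)) = (-1) ^ length zs * poly (list_poly zs) y * poly q (1 / (a + y)) + poly r y"
      "zs \<noteq> [] \<longrightarrow> degree r < length zs" "zs = [] \<longrightarrow> r = 0"
    by auto
  define c where "c = 1 / (a + z)"
  have z: "z \<ge> 0" using Cons.prems by simp
  have c: "c \<ge> 0" using z assms(2) by (simp add: c_def)
  define q' where "q' = synthetic_div q c"
  have q': "nonneg_coeffs q'" unfolding q'_def by (rule nonneg_coeffs_synthetic_div[OF qr(1) c])
  \<comment> \<open>The polynomial \<open>c * x * q'(x)\<close>: it takes up the factor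
    \<open>x * c\<close> left over when \<open>x - c\<close> is rewritten through
    \<open>y - z\<close>.\<close>
  define q2 where "q2 = smult c (pCons 0 q')"
  have q2: "nonneg_coeffs q2" using q' c by (auto simp: q2_def nonneg_coeffs_def coeff_pCons split: nat.split)
  define r2 where "r2 = smult ((-1) ^ length zs * poly q c) (list_poly zs) + r"
  have "poly p (1 / (a + y)) = (-1) ^ length (z # zs) * poly (list_poly (z # zs)) y * poly q2 (1 / (a + y)) + poly r2 y"
    if y: "y > 0" for y
  proof -
    define x where "x = 1 / (a + y)"
    have "x - c = - ((y - z) * x * c)"
    proof -
      have "a + y \<noteq> 0" "a + z \<noteq> 0" using y z assms(2) by auto
      then show ?thesis unfolding x_def c_def by (simp add: divide_simps)
    qed
    moreover have "poly q x = (x - c) * poly q' x + poly q c"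
      using arg_cong[OF synthetic_div_correct'[of c q, symmetric], of "\<lambda>p. poly p x"]
      by (simp add: q'_def algebra_simps)
    ultimately have "poly q x = - ((y - z) * x * c) * poly q' x + poly q c" by simp
    then have qx: "poly q x = - ((y - z) * poly q2 x) + poly q c" by (simp add: q2_def)
    have lp: "poly (list_poly (z # zs)) y = (y - z) * poly (list_poly zs) y"
      by (simp add: list_poly_def algebra_simps)
    have sgn: "(-1) ^ length (z # zs) = - ((-1) ^ length zs :: real)" by simp
    have "e * P * (- (w * k) + l) + m = - e * (w * P) * k + (e * l * P + m)" for e P w k l m :: real
      by algebra
    then show ?thesis
      unfolding qr(2)[OF y] unfolding x_def[symmetric] unfolding qx r2_def lp sgn poly_add poly_smult .
  qed
  moreover have "degree r2 < length (z # zs)"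
    unfolding r2_def using degree_list_poly[of zs] qr(3,4)
    by (intro degree_add_less) (auto intro: le_less_trans[OF degree_smult_le] simp: le_imp_less_Suc)
  ultimately show ?case using q2 by blast
qed

text \<open>The antiderivative is \<open>(y / (a + y)) powr (\<theta> + 1) / (\<theta> + 1)\<close>,
  which increases from 0 towards 1/(\<theta> + 1). The bound is thus uniform in \<open>a\<close>,
  and this integrand serves as the common majorant for the exponential and the rational test
  functions.\<close>

lemma powr_quotient_integral:
  fixes a :: real
  assumes th: "\<theta> > -1" and a: "a > 0"
  shows "(\<lambda>y. a * y powr \<theta> * (a + y) powr (- \<theta> - 2)) absolutely_integrable_on {0<..}"
    "integral {0<..} (\<lambda>y. a * y powr \<theta> * (a + y) powr (- \<theta> - 2)) \<le> 1 / (\<theta> + 1)"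
proof -
  let ?f = "\<lambda>y. a * y powr \<theta> * (a + y) powr (- \<theta> - 2)"
  let ?F = "\<lambda>y. 1 / (\<theta> + 1) * (y / (a + y)) powr (\<theta> + 1)"
  have cont: "continuous_on {0<..} ?f" using a by (intro continuous_intros) (auto intro!: continuous_intros)
  have le: "integral {s..t} ?f \<le> 1 / (\<theta> + 1)" if st: "0 < s" "s \<le> t" for s t
  proof -
    have "(?f has_integral ?F t - ?F s) {s..t}"
    proof (rule has_integral_real_derivative[OF st(2)])
      fix y assume y: "s \<le> y" "y \<le> t"
      then have yp: "y > 0" using st by simp
      have "((\<lambda>y. y / (a + y)) has_real_derivative (1 * (a + y) - y * (0 + 1)) / ((a + y) * (a + y))) (at y)"
        using yp a by (intro DERIV_divide DERIV_add DERIV_const DERIV_ident) auto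
      then have "((\<lambda>y. y / (a + y)) has_real_derivative a / (a + y)\<^sup>2) (at y)"
        by (simp add: power2_eq_square)
      then have "(?F has_real_derivative 1 / (\<theta> + 1) * ((\<theta> + 1) * (y / (a + y)) powr (\<theta> + 1 - of_nat 1) * (a / (a + y)\<^sup>2))) (at y)"
        using yp a by (intro DERIV_cmult DERIV_fun_powr) auto
      moreover have "1 / (\<theta> + 1) * ((\<theta> + 1) * (y / (a + y)) powr (\<theta> + 1 - of_nat 1) * (a / (a + y)\<^sup>2)) = ?f y"
      proof -
        have c: "1 / (\<theta> + 1) * ((\<theta> + 1) * p * q) = p * q" for p q using th by (simp add: field_simps)
        have "(a + y) powr (- \<theta> - 2) = 1 / ((a + y) powr \<theta> * (a + y)\<^sup>2)"
          using yp a powr_realpow[of "a + y" 2] by (simp add: powr_diff powr_minus field_simps)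
        then show ?thesis unfolding c using yp a by (simp add: powr_divide)
      qed
      ultimately show "(?F has_real_derivative ?f y) (at y)" by simp
    qed
    then have "integral {s..t} ?f = ?F t - ?F s" by (rule integral_unique)
    also have "\<dots> \<le> ?F t" using th by simp
    also have "\<dots> \<le> 1 / (\<theta> + 1) * 1"
    proof (intro mult_left_mono)
      have "(t / (a + t)) powr (\<theta> + 1) \<le> 1 powr (\<theta> + 1)"
        using st a th by (intro powr_mono2) auto
      then show "(t / (a + t)) powr (\<theta> + 1) \<le> 1" by simp
    qed (use th in auto)
    finally show ?thesis by simp
  qed
  have loc: "?f absolutely_integrable_on {s..t}" if "0 < s" for s t
    by (rule absolutely_integrable_continuous_real, rule continuous_on_subset[OF cont]) (use that in auto)
  have "?f absolutely_integrable_on {0<..} \<and> integral {0<..} ?f \<le> 1 / (\<theta> + 1)"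
  proof (rule conjI)
    have l: "integral {1 / real (Suc n)..real (Suc n)} ?f \<le> 1 / (\<theta> + 1)" for n
      by (rule le) (auto simp: field_simps)
    have nn: "?f y \<ge> 0" for y using a by simp
    show "?f absolutely_integrable_on {0<..}" "integral {0<..} ?f \<le> 1 / (\<theta> + 1)"
      using nonneg_abs_integrable_exhaust[OF nn loc l tendsto_const] by blast+
  qed
  then show "?f absolutely_integrable_on {0<..}" "integral {0<..} ?f \<le> 1 / (\<theta> + 1)" by blast+
qed

section \<open>Quadrature and interpolation at the Laguerre zeros\<close>

locale laguerre_nodes =
  fixes \<theta> :: real and n :: nat and Z :: "real set"
  assumes theta: "\<theta> > -1" and n_pos: "n > 0" and Z_def: "Z = {y. 0 < y \<and> laguerre n \<theta> y = 0}"
begin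

lemma finite_Z: "finite Z" and card_Z: "card Z = n"
  using card_laguerre_zeros[OF theta, of n] by (auto simp: Z_def)

lemma Z_pos: "z \<in> Z \<Longrightarrow> z > 0" by (simp add: Z_def)

abbreviation "\<omega> \<equiv> christoffel Z \<theta>"

lemma weight_nonneg: "\<omega> z \<ge> 0" by (simp add: christoffel_def)

lemma degree_node_poly: "degree (node_poly Z) = n"
  using degree_prod_linear[OF finite_Z] card_Z by (simp add: node_poly_def)

lemma node_poly_0: "poly (node_poly Z) z = 0" if "z \<in> Z"
  using finite_Z that by (auto simp: node_poly_def poly_prod intro!: prod_zero)

lemma node_poly_orthogonal:
  assumes "degree p < n"
  shows "(LINT y|lagm \<theta>. poly (node_poly Z * p) y) = 0"
proof -
  have nz: "node_poly Z \<noteq> 0" using finite_Z by (auto simp: node_poly_def)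
  \<comment> \<open>With leading coefficients matched, the difference has degree below n but
    vanishes at all n nodes; the node polynomial is therefore a multiple of the Laguerre polynomial
    and inherits its orthogonality.\<close>
  define c where "c = lead_coeff (lagpoly n \<theta>) / lead_coeff (node_poly Z)"
  define d where "d = lagpoly n \<theta> - smult c (node_poly Z)"
  have "coeff (node_poly Z) n \<noteq> 0" using nz degree_node_poly leading_coeff_neq_0 by metis
  then have "coeff d n = 0" by (simp add: d_def c_def degree_node_poly)
  moreover have "degree d \<le> n" unfolding d_def by (intro degree_diff_le) (auto simp: degree_node_poly)
  ultimately have "d = 0 \<or> degree d < n" by (metis leading_coeff_0_iff le_neq_implies_less)
  then have "d = 0"
  proof
    assume "degree d < n"
    then show "d = 0"
      by (intro poly_eq_0_on_nodes[of d Z]) (auto simp: card_Z d_def node_poly_0 poly_lagpoly, simp add: Z_def)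
  qed simp
  then have eq: "lagpoly n \<theta> = smult c (node_poly Z)" by (simp add: d_def)
  then have "c \<noteq> 0" using lagpoly_nonzero[of n \<theta>] by auto
  have "0 = ip (lagm \<theta>) (poly p) (poly (lagpoly n \<theta>))" using lagpoly_orthogonal[OF theta assms] by simp
  also have "\<dots> = c * ip (lagm \<theta>) (poly p) (poly (node_poly Z))"
    by (simp add: eq poly_smult[abs_def] ip_cmult)
  also have "ip (lagm \<theta>) (poly p) (poly (node_poly Z)) = (LINT y|lagm \<theta>. poly (node_poly Z * p) y)"
    by (simp add: ip_def poly_mult mult.commute)
  finally show ?thesis using \<open>c \<noteq> 0\<close> by simp
qed

lemma integral_vanishing_on_nodes:
  assumes q: "degree q < 2 * n" "\<And>z. z \<in> Z \<Longrightarrow> poly q z = 0"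
  shows "(LINT y|lagm \<theta>. poly q y) = 0"
proof -
  let ?Q = "node_poly Z"
  have nz: "?Q \<noteq> 0" using finite_Z by (auto simp: node_poly_def)
  have eq: "q = ?Q * (q div ?Q) + q mod ?Q" by simp
  have "q mod ?Q = 0"
  proof (rule poly_eq_0_on_nodes[of _ Z])
    show "degree (q mod ?Q) < card Z"
      using degree_mod_less'[of ?Q q] nz degree_node_poly card_Z n_pos by (cases "q mod ?Q = 0") auto
    fix z assume z: "z \<in> Z"
    have "poly q z = poly (?Q * (q div ?Q) + q mod ?Q) z" using eq by simp
    then show "poly (q mod ?Q) z = 0" using q(2)[OF z] node_poly_0[OF z] by (simp only: poly_add poly_mult)
  qed
  then have q': "q = ?Q * (q div ?Q)" using eq by simp
  have "degree (q div ?Q) < n"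
  proof (cases "q div ?Q = 0")
    case False
    then have "degree q = n + degree (q div ?Q)"
      using nz degree_node_poly by (subst q') (simp add: degree_mult_eq)
    then show ?thesis using q(1) by simp
  qed (simp add: n_pos)
  from node_poly_orthogonal[OF this] show ?thesis using q' by simp
qed

lemma gauss_quadrature:
  assumes q: "degree q < 2 * n"
  shows "(LINT y|lagm \<theta>. poly q y) = (\<Sum>z\<in>Z. poly q z * \<omega> z)"
proof -
  \<comment> \<open>Squared Lagrange polynomials still take the values 0 and 1 at the nodes, and
    their degree 2n - 2 is within range. So \<open>q - s\<close> vanishes on the nodes and has
    integral 0, while the integral of \<open>s\<close> is the quadrature sum by the definition of
    the weights.\<close>
  define s where "s = (\<Sum>z\<in>Z. smult (poly q z) ((lagrange Z z)\<^sup>2))"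
  have "(LINT y|lagm \<theta>. poly (q - s) y) = 0"
  proof (rule integral_vanishing_on_nodes)
    have "degree ((lagrange Z z)\<^sup>2) < 2 * n" if "z \<in> Z" for z
      using degree_power_le[of "lagrange Z z" 2] degree_lagrange[OF finite_Z that] card_Z by simp
    then have "degree s < 2 * n"
      unfolding s_def using n_pos by (intro degree_sum_less) (auto intro: le_less_trans[OF degree_smult_le])
    then show "degree (q - s) < 2 * n" using q by (rule degree_diff_less[rotated])
    fix w assume w: "w \<in> Z"
    have "poly s w = (\<Sum>z\<in>Z. if w = z then poly q z else 0)"
      unfolding s_def by (auto simp: poly_sum poly_lagrange[OF finite_Z _ w] intro!: sum.cong)
    then show "poly (q - s) w = 0" using w finite_Z by simp
  qed
  moreover have "(LINT y|lagm \<theta>. poly (q - s) y) = (LINT y|lagm \<theta>. poly q y) - (LINT y|lagm \<theta>. poly s y)"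
    using poly_integrable[OF theta] by (simp add: Bochner_Integration.integral_diff)
  moreover have "(LINT y|lagm \<theta>. poly s y) = (\<Sum>z\<in>Z. poly q z * \<omega> z)"
  proof -
    have "(LINT y|lagm \<theta>. poly s y) = (LINT y|lagm \<theta>. (\<Sum>z\<in>Z. poly q z * poly ((lagrange Z z)\<^sup>2) y))"
      by (simp add: s_def poly_sum)
    also have "\<dots> = (\<Sum>z\<in>Z. (LINT y|lagm \<theta>. poly q z * poly ((lagrange Z z)\<^sup>2) y))"
      by (rule Bochner_Integration.integral_sum) (intro integrable_mult_right poly_integrable theta)
    finally show ?thesis by (simp add: christoffel_def)
  qed
  ultimately show ?thesis by simp
qed

definition interp :: "(real \<Rightarrow> real) \<Rightarrow> real poly" where
  "interp v = (\<Sum>z\<in>Z. smult (v z) (lagrange Z z))"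

lemma degree_interp: "degree (interp v) < n"
  unfolding interp_def using degree_lagrange[OF finite_Z] card_Z n_pos
  by (intro degree_sum_less) (auto intro: le_less_trans[OF degree_smult_le])

lemma poly_interp:
  assumes "z \<in> Z"
  shows "poly (interp v) z = v z"
proof -
  have "poly (interp v) z = (\<Sum>w\<in>Z. if z = w then v w else 0)"
    unfolding interp_def by (auto simp: poly_sum poly_lagrange[OF finite_Z _ assms] intro!: sum.cong)
  then show ?thesis using assms finite_Z by simp
qed

lemma interp_poly: "degree p < n \<Longrightarrow> interp (poly p) = p"
  unfolding interp_def using lagrange_exact[OF finite_Z] card_Z by simp

lemma interp_diff: "interp (\<lambda>y. u y - v y) = interp u - interp v"
  by (simp add: interp_def smult_diff_left sum_subtractf)

lemma sq_interp: "sq (lagm \<theta>) (poly (interp v)) = (\<Sum>z\<in>Z. (v z)\<^sup>2 * \<omega> z)"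
proof -
  have "degree (interp v * interp v) < 2 * n"
    using degree_mult_le[of "interp v" "interp v"] degree_interp[of v] by simp
  from gauss_quadrature[OF this] show ?thesis
    by (simp add: sq_def power2_eq_square poly_interp cong: sum.cong)
qed

text \<open>Each node is listed twice. The product is then a square, and division by it leaves a
  remainder of degree below 2n, for which the quadrature is exact.\<close>

lemma node_list: "\<exists>zs. set zs \<subseteq> Z \<and> length zs = 2 * n \<and> (\<forall>z\<in>Z. poly (list_poly zs) z = 0) \<and> (\<forall>y. poly (list_poly zs) y \<ge> 0)"
proof -
  obtain xs where xs: "set xs = Z" "distinct xs" using finite_distinct_list[OF finite_Z] by blast
  have "length xs = n" using xs card_Z distinct_card by fastforce
  moreover have "list_poly (xs @ xs) = list_poly xs * list_poly xs" by (simp add: list_poly_def)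
  moreover have "poly (list_poly xs) z = 0" if "z \<in> Z" for z
    using that unfolding xs(1)[symmetric] by (induction xs) (auto simp: list_poly_def)
  ultimately show ?thesis using xs by (intro exI[of _ "xs @ xs"]) auto
qed

text \<open>The remainder \<open>r\<close> agrees with \<open>p\<close> at the nodes and is
  integrated exactly; on the half-line it lies below \<open>p\<close> by a square times a polynomial
  with nonnegative coefficients.\<close>

lemma gauss_le_power:
  assumes p: "nonneg_coeffs p"
  shows "(\<Sum>z\<in>Z. poly p z * \<omega> z) \<le> (LINT y|lagm \<theta>. poly p y)"
proof -
  obtain zs where zs: "set zs \<subseteq> Z" "length zs = 2 * n" "\<And>z. z \<in> Z \<Longrightarrow> poly (list_poly zs) z = 0" "\<And>y. poly (list_poly zs) y \<ge> 0"
    using node_list by blast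
  have "\<And>z. z \<in> set zs \<Longrightarrow> z \<ge> 0" using zs(1) Z_pos by fastforce
  from division_nonneg_coeffs[OF p this] obtain q r where qr: "nonneg_coeffs q" "p = list_poly zs * q + r"
    and r: "zs \<noteq> [] \<longrightarrow> degree r < length zs" by blast
  have "zs \<noteq> []" using zs(2) n_pos by auto
  then have r: "degree r < 2 * n" using r zs(2) by simp
  have "(\<Sum>z\<in>Z. poly p z * \<omega> z) = (\<Sum>z\<in>Z. poly r z * \<omega> z)"
  proof (rule sum.cong[OF refl])
    fix z assume "z \<in> Z"
    then have "poly p z = poly r z" by (subst qr(2)) (simp add: zs(3))
    then show "poly p z * \<omega> z = poly r z * \<omega> z" by simp
  qed
  also have "\<dots> = (LINT y|lagm \<theta>. poly r y)" by (rule gauss_quadrature[OF r, symmetric])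
  also have "\<dots> \<le> (LINT y|lagm \<theta>. poly p y)"
  proof (rule integral_mono[OF poly_integrable[OF theta] poly_integrable[OF theta]])
    fix y assume "y \<in> space (lagm \<theta>)"
    then have "poly q y \<ge> 0" using nonneg_coeffs_poly[OF qr(1)] by simp
    then show "poly r y \<le> poly p y" using zs(4)[of y] by (subst qr(2)) simp
  qed
  finally show ?thesis .
qed

lemma gauss_le_inverse:
  assumes p: "nonneg_coeffs p" and a: "a > 0" and i: "integrable (lagm \<theta>) (\<lambda>y. poly p (1 / (a + y)))"
  shows "(\<Sum>z\<in>Z. poly p (1 / (a + z)) * \<omega> z) \<le> (LINT y|lagm \<theta>. poly p (1 / (a + y)))"
proof -
  obtain zs where zs: "set zs \<subseteq> Z" "length zs = 2 * n" "\<And>z. z \<in> Z \<Longrightarrow> poly (list_poly zs) z = 0" "\<And>y. poly (list_poly zs) y \<ge> 0"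
    using node_list by blast
  have "\<And>z. z \<in> set zs \<Longrightarrow> z \<ge> 0" using zs(1) Z_pos by fastforce
  from division_nonneg_coeffs_inverse[OF p a this] obtain q r where qr: "nonneg_coeffs q"
    "\<And>y. y > 0 \<Longrightarrow> poly p (1 / (a + y)) = (-1) ^ length zs * poly (list_poly zs) y * poly q (1 / (a + y)) + poly r y"
    and r: "zs \<noteq> [] \<longrightarrow> degree r < length zs" by blast
  \<comment> \<open>In the variable 1/(a + y) every node contributes a sign, and there are 2n of
    them.\<close>
  have "(-1) ^ length zs = (1 :: real)" by (simp add: zs(2))
  note qr = qr(1) qr(2)[unfolded this mult_1]
  have "zs \<noteq> []" using zs(2) n_pos by auto
  then have r: "degree r < 2 * n" using r zs(2) by simp
  have "(\<Sum>z\<in>Z. poly p (1 / (a + z)) * \<omega> z) = (\<Sum>z\<in>Z. poly r z * \<omega> z)"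
    by (intro sum.cong) (auto simp: qr(2) zs(3) Z_pos)
  also have "\<dots> = (LINT y|lagm \<theta>. poly r y)" by (rule gauss_quadrature[OF r, symmetric])
  also have "\<dots> \<le> (LINT y|lagm \<theta>. poly p (1 / (a + y)))"
  proof (rule integral_mono[OF poly_integrable[OF theta] i])
    fix y assume "y \<in> space (lagm \<theta>)"
    then have y: "y > 0" by simp
    then have "poly q (1 / (a + y)) \<ge> 0" using nonneg_coeffs_poly[OF qr(1)] a by simp
    then show "poly r y \<le> poly p (1 / (a + y))" using zs(4)[of y] qr(2)[OF y] by simp
  qed
  finally show ?thesis .
qed

end

section \<open>Weighted sums over the nodes\<close>

lemma exp_partial_sum_le:
  fixes x :: real
  assumes "x \<ge> 0"
  shows "(\<Sum>i<k. x ^ i / fact i) \<le> exp x"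
proof -
  have s: "(\<lambda>i. x ^ i / fact i) sums exp x"
    using exp_converges[of x] by (simp add: field_simps)
  have "(\<Sum>i<k. x ^ i / fact i) \<le> (\<Sum>i. x ^ i / fact i)"
    by (rule sum_le_suminf) (use s assms in \<open>auto simp: sums_iff\<close>)
  then show ?thesis using s by (simp add: sums_iff)
qed

text \<open>Obtained from a single term \<open>(1 + t) ^ k / fact k\<close> of the exponential
  series at 1 + t. It trades exponential decay for the power decay of the common majorant.\<close>

lemma exp_neg_le_powr:
  fixes t r :: real
  assumes t: "t \<ge> 0" and k: "r \<le> real k"
  shows "exp (- t) \<le> exp 1 * fact k * (1 + t) powr (- r)"
proof -
  have "(1 + t) ^ k / fact k \<le> (\<Sum>i<Suc k. (1 + t) ^ i / fact i)"
    using t by (intro member_le_sum) auto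
  also have "\<dots> \<le> exp (1 + t)" by (rule exp_partial_sum_le) (use t in simp)
  finally have "(1 + t) ^ k \<le> fact k * exp (1 + t)" by (simp add: field_simps)
  moreover have "(1 + t) powr r \<le> (1 + t) ^ k"
    using t k by (simp add: powr_realpow[symmetric] powr_mono)
  ultimately have "(1 + t) powr r \<le> fact k * (exp 1 * exp t)" by (simp add: exp_add)
  then have "(1 + t) powr r * exp (- t) \<le> fact k * (exp 1 * exp t) * exp (- t)"
    by (rule mult_right_mono) simp
  also have "\<dots> = exp 1 * fact k" by (simp add: exp_minus)
  finally show ?thesis using t by (simp add: powr_minus field_simps)
qed

lemma dyadic_bracket:
  fixes z :: real
  assumes "1 \<le> z" "z < 2 ^ J"
  shows "\<exists>j<J. 2 ^ j \<le> z \<and> z \<le> 2 * 2 ^ j"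
  using assms
proof (induction J)
  case (Suc J)
  show ?case
  proof (cases "z < 2 ^ J")
    case True
    then show ?thesis using Suc less_SucI by blast
  next
    case False
    then show ?thesis using Suc.prems by (intro exI[of _ J]) auto
  qed
qed simp

context laguerre_nodes
begin

text \<open>The rate 1 - 1/a leaves a decay e^(-y/a) after multiplication by the weight, hence an
  integral of order a^(\<theta> + 1). The Taylor sums of the exponential have nonnegative
  coefficients, so the quadrature inequality applies to each of them; the limit is taken in the
  finite node sum only.\<close>

lemma exp_node_sum:
  assumes a: "a \<ge> 1" and k: "\<theta> + 2 \<le> real k"
  shows "(\<Sum>z\<in>Z. exp (z * (1 - 1 / a)) * \<omega> z) \<le> exp 1 * fact k / (\<theta> + 1) * a powr (\<theta> + 1)"
proof -
  define s where "s = 1 - 1 / a"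
  have s: "s \<ge> 0" using a by (simp add: s_def)
  define C where "C = exp 1 * fact k * a powr (\<theta> + 1)"
  define p where "p K = (\<Sum>i<K. monom (s ^ i / fact i) i)" for K
  have pp: "poly (p K) y = (\<Sum>i<K. (s * y) ^ i / fact i)" for K y
    by (simp add: p_def poly_sum poly_monom power_mult_distrib)
  have nn: "nonneg_coeffs (p K)" for K
    using s unfolding p_def nonneg_coeffs_def by (auto simp: coeff_sum coeff_monom intro!: sum_nonneg)
  have bound: "wt \<theta> y * poly (p K) y \<le> C * (a * y powr \<theta> * (a + y) powr (- \<theta> - 2))" if y: "y > 0" for y K
  proof -
    have "poly (p K) y \<le> exp (s * y)" unfolding pp by (rule exp_partial_sum_le) (use s y in simp)
    then have "wt \<theta> y * poly (p K) y \<le> wt \<theta> y * exp (s * y)" by (intro mult_left_mono) auto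
    also have "\<dots> = y powr \<theta> * exp (- (y / a))"
      by (simp add: wt_def s_def mult.assoc exp_add[symmetric] algebra_simps)
    also have "\<dots> \<le> y powr \<theta> * (exp 1 * fact k * (1 + y / a) powr (- (\<theta> + 2)))"
      by (intro mult_left_mono exp_neg_le_powr) (use y a k in auto)
    also have "(1 + y / a) powr (- (\<theta> + 2)) = a powr (\<theta> + 1) * a * (a + y) powr (- \<theta> - 2)"
    proof -
      have "1 + y / a = (a + y) / a" using a by (simp add: field_simps)
      then have "(1 + y / a) powr (- (\<theta> + 2)) = (a + y) powr (- (\<theta> + 2)) / a powr (- (\<theta> + 2))"
        using a y by (simp add: powr_divide)
      also have "\<dots> = (a + y) powr (- (\<theta> + 2)) * a powr (\<theta> + 2)"
        by (subst (2) powr_minus) (simp add: field_simps)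
      also have "a powr (\<theta> + 2) = a powr (\<theta> + 1) * a"
        using a powr_add[of a "\<theta> + 1" 1] by (simp add: add.assoc)
      finally show ?thesis by (simp add: algebra_simps)
    qed
    also have "y powr \<theta> * (exp 1 * fact k * (a powr (\<theta> + 1) * a * (a + y) powr (- \<theta> - 2))) = C * (a * y powr \<theta> * (a + y) powr (- \<theta> - 2))"
      by (simp add: C_def)
    finally show ?thesis .
  qed
  note Q = powr_quotient_integral[OF theta, of a]
  have a0: "a > 0" using a by simp
  have le: "(\<Sum>z\<in>Z. poly (p K) z * \<omega> z) \<le> C * (1 / (\<theta> + 1))" for K
  proof -
    have i: "integrable (lagm \<theta>) (poly (p K))" by (rule poly_integrable[OF theta])
    have "(\<Sum>z\<in>Z. poly (p K) z * \<omega> z) \<le> (LINT y|lagm \<theta>. poly (p K) y)"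
      by (rule gauss_le_power[OF nn])
    also have "\<dots> = integral {0<..} (\<lambda>y. wt \<theta> y * poly (p K) y)" by (rule lagm_integral[OF i])
    also have "\<dots> \<le> integral {0<..} (\<lambda>y. C * (a * y powr \<theta> * (a + y) powr (- \<theta> - 2)))"
    proof (rule integral_le)
      show "(\<lambda>y. wt \<theta> y * poly (p K) y) integrable_on {0<..}"
        by (rule set_lebesgue_integral_eq_integral(1)[OF lagm_abs_integrable[OF i]])
      show "(\<lambda>y. C * (a * y powr \<theta> * (a + y) powr (- \<theta> - 2))) integrable_on {0<..}"
        by (rule integrable_on_mult_right, rule set_lebesgue_integral_eq_integral(1)[OF Q(1)[OF a0]])
    qed (use bound in auto)
    also have "\<dots> = C * integral {0<..} (\<lambda>y. a * y powr \<theta> * (a + y) powr (- \<theta> - 2))" by simp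
    also have "\<dots> \<le> C * (1 / (\<theta> + 1))" by (intro mult_left_mono Q(2)[OF a0]) (simp add: C_def)
    finally show ?thesis .
  qed
  have "(\<lambda>K. \<Sum>z\<in>Z. poly (p K) z * \<omega> z) \<longlonglongrightarrow> (\<Sum>z\<in>Z. exp (s * z) * \<omega> z)"
  proof (intro tendsto_sum tendsto_mult tendsto_const)
    fix z
    have "(\<lambda>i. (s * z) ^ i / fact i) sums exp (s * z)"
      using exp_converges[of "s * z"] by (simp add: field_simps)
    then show "(\<lambda>K. poly (p K) z) \<longlonglongrightarrow> exp (s * z)" unfolding pp sums_def .
  qed
  then have "(\<Sum>z\<in>Z. exp (s * z) * \<omega> z) \<le> C * (1 / (\<theta> + 1))"
    by (rule LIMSEQ_le_const2) (use le in auto)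
  then show ?thesis by (simp add: C_def s_def mult.commute)
qed

text \<open>The counterpart for small nodes, where e^(-y) is replaced by 1. The exponent
  \<open>k\<close> is at least \<theta> + 2, so that \<open>(a / (a + y)) ^ k\<close> falls below
  the common majorant.\<close>

lemma inverse_node_sum:
  assumes a: "a > 0" and k: "\<theta> + 2 \<le> real k"
  shows "(\<Sum>z\<in>Z. (a / (a + z)) ^ k * \<omega> z) \<le> 1 / (\<theta> + 1) * a powr (\<theta> + 1)"
proof -
  define p where "p = monom (a ^ k) k"
  have pp: "poly p (1 / (a + y)) = (a / (a + y)) ^ k" for y
    by (simp add: p_def poly_monom power_divide)
  have nn: "nonneg_coeffs p" using a by (simp add: p_def nonneg_coeffs_def)
  have c: "continuous_on {0<..} (\<lambda>y. (a / (a + y)) ^ k)"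
    using a by (intro continuous_intros) auto
  have m: "(\<lambda>y. (a / (a + y)) ^ k) \<in> borel_measurable (lagm \<theta>)"
    using continuous_measurable_pos[OF c] by simp
  have "integrable (lagm \<theta>) (\<lambda>y. 1 :: real)" using lagm_power_integrable[OF theta, of 0] by simp
  then have i: "integrable (lagm \<theta>) (\<lambda>y. (a / (a + y)) ^ k)"
  proof (rule Bochner_Integration.integrable_bound[OF _ m])
    show "AE y in lagm \<theta>. norm ((a / (a + y)) ^ k) \<le> norm (1 :: real)"
      using a by (intro AE_I2) (auto intro!: power_le_one)
  qed
  have bound: "wt \<theta> y * (a / (a + y)) ^ k \<le> a powr (\<theta> + 1) * (a * y powr \<theta> * (a + y) powr (- \<theta> - 2))" if y: "y > 0" for y
  proof -
    have "(a / (a + y)) ^ k = (a / (a + y)) powr real k" using a y by (simp add: powr_realpow)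
    also have "\<dots> \<le> (a / (a + y)) powr (\<theta> + 2)" using a y k by (intro powr_mono') auto
    also have "\<dots> = a powr (\<theta> + 2) / (a + y) powr (\<theta> + 2)" using a y by (simp add: powr_divide)
    also have "\<dots> = a powr (\<theta> + 1) * a * (a + y) powr (- (\<theta> + 2))"
      using a powr_add[of a "\<theta> + 1" 1] powr_minus_divide[of "a + y" "\<theta> + 2"] by (simp add: add.assoc)
    finally have "wt \<theta> y * (a / (a + y)) ^ k \<le> y powr \<theta> * (a powr (\<theta> + 1) * a * (a + y) powr (- \<theta> - 2))"
      using y a by (intro mult_mono) (auto simp: wt_def)
    then show ?thesis by (simp add: mult_ac)
  qed
  note Q = powr_quotient_integral[OF theta a]
  have "(\<Sum>z\<in>Z. (a / (a + z)) ^ k * \<omega> z) \<le> (LINT y|lagm \<theta>. (a / (a + y)) ^ k)"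
    using gauss_le_inverse[OF nn a, unfolded pp, OF i] .
  also have "\<dots> = integral {0<..} (\<lambda>y. wt \<theta> y * (a / (a + y)) ^ k)" by (rule lagm_integral[OF i])
  also have "\<dots> \<le> integral {0<..} (\<lambda>y. a powr (\<theta> + 1) * (a * y powr \<theta> * (a + y) powr (- \<theta> - 2)))"
  proof (rule integral_le)
    show "(\<lambda>y. wt \<theta> y * (a / (a + y)) ^ k) integrable_on {0<..}"
      by (rule set_lebesgue_integral_eq_integral(1)[OF lagm_abs_integrable[OF i]])
    show "(\<lambda>y. a powr (\<theta> + 1) * (a * y powr \<theta> * (a + y) powr (- \<theta> - 2))) integrable_on {0<..}"
      by (rule integrable_on_mult_right, rule set_lebesgue_integral_eq_integral(1)[OF Q(1)])
  qed (use bound in auto)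
  also have "\<dots> = a powr (\<theta> + 1) * integral {0<..} (\<lambda>y. a * y powr \<theta> * (a + y) powr (- \<theta> - 2))" by simp
  also have "\<dots> \<le> a powr (\<theta> + 1) * (1 / (\<theta> + 1))" by (intro mult_left_mono Q(2)) simp
  finally show ?thesis by (simp add: mult.commute)
qed

text \<open>Each summand is dominated by the majorant of one dyadic interval, hence by the sum over
  all of them. After exchanging the sums, the powers of the dyadic end point cancel, and every
  \<open>j\<close> costs the same constant.\<close>

lemma node_sum_le:
  assumes k: "\<theta> + 2 \<le> real k" and J: "\<And>z. z \<in> Z \<Longrightarrow> z < 2 ^ J" "\<And>z. z \<in> Z \<Longrightarrow> 1 / z < 2 ^ J"
  shows "(\<Sum>z\<in>Z. \<omega> z / wt (\<theta> + 1) z) \<le>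
    real J * (exp 2 * (exp 1 * fact k / (\<theta> + 1)) + exp 1 * 2 powr (\<theta> + 1) * 2 ^ k / (\<theta> + 1))"
proof -
  let ?b = "\<lambda>j. (2::real) ^ j" and ?a = "\<lambda>j. 1 / (2::real) ^ j"
  \<comment> \<open>Majorant on [2^j, 2^(j+1)]: there z / 2^j is at most 2, so lowering the rate of
    the exponential from 1 to 1 - 2^(-j) costs at most e^2.\<close>
  define E where "E j z = exp 2 * (?b j powr (- (\<theta> + 1)) * exp (z * (1 - 1 / ?b j)))" for j z
  \<comment> \<open>Majorant on [2^(-j-1), 2^(-j)], with a = 2^(-j): e bounds e^z, the power of 2
    with exponent \<theta> + 1 comes from z >= a/2, and 2^k from a/(a + z) >= 1/2.\<close>
  define R where "R j z = exp 1 * 2 powr (\<theta> + 1) * 2 ^ k * (?a j powr (- (\<theta> + 1)) * (?a j / (?a j + z)) ^ k)" for j z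
  have E0: "E j z \<ge> 0" for j z by (simp add: E_def)
  have R0: "R j z \<ge> 0" if "z \<in> Z" for j z using Z_pos[OF that] by (auto simp: R_def intro!: mult_nonneg_nonneg)
  have main: "1 / wt (\<theta> + 1) z \<le> (\<Sum>j<J. E j z + R j z)" if z: "z \<in> Z" for z
  proof -
    have zp: "z > 0" by (rule Z_pos[OF z])
    have w: "1 / wt (\<theta> + 1) z = z powr (- (\<theta> + 1)) * exp z"
      unfolding wt_def powr_minus exp_minus by (simp add: field_simps)
    have "\<exists>j<J. 1 / wt (\<theta> + 1) z \<le> E j z + R j z"
    proof (cases "z \<ge> 1")
      case True
      then obtain j where j: "j < J" "?b j \<le> z" "z \<le> 2 * ?b j"
        using dyadic_bracket[OF _ J(1)[OF z]] by blast
      have "z powr (- (\<theta> + 1)) \<le> ?b j powr (- (\<theta> + 1))"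
        using j theta by (intro powr_mono2') auto
      moreover have "exp z \<le> exp 2 * exp (z * (1 - 1 / ?b j))"
      proof -
        have "z \<le> 2 + z * (1 - 1 / ?b j)" using j(3) by (simp add: field_simps)
        then show ?thesis by (simp add: exp_add[symmetric])
      qed
      ultimately have "z powr (- (\<theta> + 1)) * exp z \<le> ?b j powr (- (\<theta> + 1)) * (exp 2 * exp (z * (1 - 1 / ?b j)))"
        by (intro mult_mono) auto
      then have "1 / wt (\<theta> + 1) z \<le> E j z" unfolding w E_def by (simp only: mult_ac)
      then show ?thesis using j(1) R0[OF z, of j] by force
    next
      case False
      then have "1 \<le> 1 / z" using zp by simp
      then obtain j where j: "j < J" "?b j \<le> 1 / z" "1 / z \<le> 2 * ?b j"
        using dyadic_bracket[OF _ J(2)[OF z]] by blast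
      have a: "z \<le> ?a j" "?a j / 2 \<le> z" using j zp by (auto simp: field_simps)
      have ap: "?a j > 0" by simp
      have "z powr (- (\<theta> + 1)) \<le> (?a j / 2) powr (- (\<theta> + 1))"
        using a theta ap by (intro powr_mono2') auto
      also have "\<dots> = ?a j powr (- (\<theta> + 1)) / 2 powr (- (\<theta> + 1))"
        by (rule powr_divide)
      also have "\<dots> = 2 powr (\<theta> + 1) * ?a j powr (- (\<theta> + 1))"
        unfolding powr_minus[of 2] by (simp only: divide_inverse inverse_inverse_eq mult.commute)
      finally have 1: "z powr (- (\<theta> + 1)) \<le> 2 powr (\<theta> + 1) * ?a j powr (- (\<theta> + 1))" .
      have 2: "exp z \<le> exp 1" using False by simp
      have "1 / 2 \<le> ?a j / (?a j + z)" using a zp ap by (simp add: divide_simps)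
      then have "(1 / 2) ^ k \<le> (?a j / (?a j + z)) ^ k" by (rule power_mono) simp
      then have 3: "1 \<le> 2 ^ k * (?a j / (?a j + z)) ^ k" by (simp add: power_divide field_simps)
      have "z powr (- (\<theta> + 1)) * exp z \<le> (2 powr (\<theta> + 1) * ?a j powr (- (\<theta> + 1))) * exp 1"
        by (intro mult_mono 1 2) auto
      also have "\<dots> \<le> (2 powr (\<theta> + 1) * ?a j powr (- (\<theta> + 1))) * exp 1 * (2 ^ k * (?a j / (?a j + z)) ^ k)"
        using mult_left_mono[OF 3, of "(2 powr (\<theta> + 1) * ?a j powr (- (\<theta> + 1))) * exp 1"] by simp
      finally have "1 / wt (\<theta> + 1) z \<le> R j z" unfolding w R_def by (simp only: mult_ac)
      then show ?thesis using j(1) E0[of j z] by force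
    qed
    then obtain j where "j < J" "1 / wt (\<theta> + 1) z \<le> E j z + R j z" by blast
    moreover have "E j z + R j z \<le> (\<Sum>j<J. E j z + R j z)"
      using \<open>j < J\<close> E0 R0[OF z] by (intro member_le_sum) (auto intro: add_nonneg_nonneg)
    ultimately show ?thesis by linarith
  qed
  have "(\<Sum>z\<in>Z. \<omega> z / wt (\<theta> + 1) z) \<le> (\<Sum>z\<in>Z. \<omega> z * (\<Sum>j<J. E j z + R j z))"
  proof (rule sum_mono)
    fix z assume "z \<in> Z"
    from mult_left_mono[OF main[OF this] weight_nonneg[of z]]
    show "\<omega> z / wt (\<theta> + 1) z \<le> \<omega> z * (\<Sum>j<J. E j z + R j z)" by simp
  qed
  also have "\<dots> = (\<Sum>j<J. (\<Sum>z\<in>Z. \<omega> z * E j z) + (\<Sum>z\<in>Z. \<omega> z * R j z))"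
    unfolding sum_distrib_left by (subst sum.swap) (simp only: distrib_left sum.distrib)
  also have "\<dots> \<le> (\<Sum>j<J. exp 2 * (exp 1 * fact k / (\<theta> + 1)) + exp 1 * 2 powr (\<theta> + 1) * 2 ^ k / (\<theta> + 1))"
  proof (intro sum_mono add_mono)
    fix j
    have c: "x powr (- (\<theta> + 1)) * x powr (\<theta> + 1) = 1" if "x > 0" for x :: real
      using that by (simp add: powr_add[symmetric])
    have "(\<Sum>z\<in>Z. \<omega> z * E j z) = exp 2 * ?b j powr (- (\<theta> + 1)) * (\<Sum>z\<in>Z. exp (z * (1 - 1 / ?b j)) * \<omega> z)"
      unfolding E_def sum_distrib_left by (intro sum.cong) (simp_all only: mult_ac)
    also have "\<dots> \<le> exp 2 * ?b j powr (- (\<theta> + 1)) * (exp 1 * fact k / (\<theta> + 1) * ?b j powr (\<theta> + 1))"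
      by (intro mult_left_mono exp_node_sum k) auto
    also have "\<dots> = exp 2 * (exp 1 * fact k / (\<theta> + 1)) * (?b j powr (- (\<theta> + 1)) * ?b j powr (\<theta> + 1))"
      by (simp only: mult_ac)
    also have "\<dots> = exp 2 * (exp 1 * fact k / (\<theta> + 1))" by (subst c) auto
    finally show "(\<Sum>z\<in>Z. \<omega> z * E j z) \<le> exp 2 * (exp 1 * fact k / (\<theta> + 1))" .
    have "(\<Sum>z\<in>Z. \<omega> z * R j z) = exp 1 * 2 powr (\<theta> + 1) * 2 ^ k * ?a j powr (- (\<theta> + 1)) * (\<Sum>z\<in>Z. (?a j / (?a j + z)) ^ k * \<omega> z)"
      unfolding R_def sum_distrib_left by (intro sum.cong) (simp_all only: mult_ac)
    also have "\<dots> \<le> exp 1 * 2 powr (\<theta> + 1) * 2 ^ k * ?a j powr (- (\<theta> + 1)) * (1 / (\<theta> + 1) * ?a j powr (\<theta> + 1))"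
      by (intro mult_left_mono inverse_node_sum k) auto
    also have "\<dots> = exp 1 * 2 powr (\<theta> + 1) * 2 ^ k * (1 / (\<theta> + 1)) * (?a j powr (- (\<theta> + 1)) * ?a j powr (\<theta> + 1))"
      by (simp only: mult_ac)
    also have "\<dots> = exp 1 * 2 powr (\<theta> + 1) * 2 ^ k / (\<theta> + 1)" by (subst c) auto
    finally show "(\<Sum>z\<in>Z. \<omega> z * R j z) \<le> exp 1 * 2 powr (\<theta> + 1) * 2 ^ k / (\<theta> + 1)" .
  qed
  also have "\<dots> = real J * (exp 2 * (exp 1 * fact k / (\<theta> + 1)) + exp 1 * 2 powr (\<theta> + 1) * 2 ^ k / (\<theta> + 1))" by simp
  finally show ?thesis .
qed

end

lemma node_sum_log:
  assumes th: "\<theta> > -1"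
  shows "\<exists>C>0. \<forall>M\<ge>2. \<forall>Z. Z = {y. 0 < y \<and> laguerre (M + 1) \<theta> y = 0} \<longrightarrow>
    (\<Sum>z\<in>Z. christoffel Z \<theta> z / wt (\<theta> + 1) z) \<le> C * ln (real M)"
proof -
  obtain k :: nat where k: "\<theta> + 2 \<le> real k" using real_arch_simple by blast
  define D where "D = exp 2 * (exp 1 * fact k / (\<theta> + 1)) + exp 1 * 2 powr (\<theta> + 1) * 2 ^ k / (\<theta> + 1)"
  have "0 < exp 2 * (exp 1 * fact k / (\<theta> + 1))" "0 < exp 1 * 2 powr (\<theta> + 1) * 2 ^ k / (\<theta> + 1)"
    using th by simp_all
  then have D: "D > 0" unfolding D_def by linarith
  \<comment> \<open>The largest zero is at most (2 \<theta> + 6)(M + 1) and the reciprocal of the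
    smallest at most (M + 1)/(\<theta> + 1). The values 2 \<theta> + 7 and 2/(\<theta> + 1) are
    rounded up to make the inequalities for the dyadic range strict.\<close>
  define K where "K = max (2 * \<theta> + 7) (2 / (\<theta> + 1))"
  have K: "K \<ge> 5" "2 * \<theta> + 7 \<le> K" "2 / (\<theta> + 1) \<le> K" using th by (auto simp: K_def)
  have "(\<Sum>z\<in>Z. christoffel Z \<theta> z / wt (\<theta> + 1) z) \<le> (log 2 K + 3) * D / ln 2 * ln (real M)"
    if M: "M \<ge> 2" and Z: "Z = {y. 0 < y \<and> laguerre (M + 1) \<theta> y = 0}" for M Z
  proof -
    interpret laguerre_nodes \<theta> "M + 1" Z by unfold_locales (use th Z in auto)
    define x where "x = K * real (M + 1)"
    have x: "x \<ge> 1" unfolding x_def using K(1) mult_mono[of 1 K 1 "real (M + 1)"] by simp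
    define J where "J = nat \<lceil>log 2 x\<rceil>"
    have lx: "log 2 x \<ge> 0" using x by simp
    have J1: "log 2 x \<le> real J" "real J \<le> log 2 x + 1" using lx by (auto simp: J_def)
    have xJ: "x \<le> 2 ^ J"
      using J1(1) x by (simp add: log_le_iff powr_realpow)
    have Jb: "z < 2 ^ J" "1 / z < 2 ^ J" if z: "z \<in> Z" for z
    proof -
      have zp: "z > 0" "laguerre (Suc M) \<theta> z = 0" using z Z by auto
      note b = laguerre_zero_bounds[OF th zp]
      have "z \<le> 4 * real (Suc M) + (2 * \<theta> + 2) * 1" using b(2) by simp
      also have "\<dots> \<le> 4 * real (Suc M) + (2 * \<theta> + 2) * real (Suc M)"
        using th by (intro add_left_mono mult_left_mono) auto
      also have "\<dots> = (2 * \<theta> + 6) * real (Suc M)" by (simp add: algebra_simps)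
      also have "\<dots> < K * real (Suc M)" using K(2) by (intro mult_strict_right_mono) auto
      finally show "z < 2 ^ J" using xJ by (simp add: x_def)
      have "1 / z \<le> real (Suc M) / (\<theta> + 1)" using b(1) zp th by (simp add: field_simps)
      also have "\<dots> = 1 / (\<theta> + 1) * real (Suc M)" by simp
      also have "\<dots> < K * real (Suc M)"
      proof (intro mult_strict_right_mono)
        have "0 < 1 / (\<theta> + 1)" using th by simp
        then show "1 / (\<theta> + 1) < K" using K(3) by linarith
      qed auto
      finally show "1 / z < 2 ^ J" using xJ by (simp add: x_def)
    qed
    have "log 2 x = log 2 K + log 2 (real (M + 1))" unfolding x_def using K(1) by (subst log_mult) auto
    also have "log 2 (real (M + 1)) \<le> log 2 (2 * real M)" using M by (subst log_le_cancel_iff) auto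
    also have "log 2 (2 * real M) = 1 + log 2 (real M)" using M by (subst log_mult) auto
    finally have "real J \<le> log 2 K + 2 + log 2 (real M)" using J1(2) by simp
    \<comment> \<open>M >= 2 gives log 2 M >= 1, which turns the additive constant into a multiple
      of the logarithm.\<close>
    also have "\<dots> \<le> (log 2 K + 2) * log 2 (real M) + log 2 (real M)"
    proof -
      have "log 2 K \<ge> 0" using K(1) by simp
      moreover have "log 2 (real M) \<ge> 1" using M by (subst le_log_iff) auto
      ultimately have "(log 2 K + 2) * 1 \<le> (log 2 K + 2) * log 2 (real M)" by (intro mult_left_mono) auto
      then show ?thesis by simp
    qed
    also have "\<dots> = (log 2 K + 3) * log 2 (real M)" by (simp add: algebra_simps)
    finally have J2: "real J \<le> (log 2 K + 3) * log 2 (real M)" .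
    have "(\<Sum>z\<in>Z. christoffel Z \<theta> z / wt (\<theta> + 1) z) \<le> real J * D"
      unfolding D_def by (rule node_sum_le[OF k Jb])
    also have "\<dots> \<le> (log 2 K + 3) * log 2 (real M) * D" using J2 D by (intro mult_right_mono) auto
    also have "\<dots> = (log 2 K + 3) * D / ln 2 * ln (real M)" by (simp add: log_def)
    finally show ?thesis .
  qed
  moreover have "(log 2 K + 3) * D / ln 2 > 0"
    using K(1) D by (intro divide_pos_pos mult_pos_pos add_nonneg_pos) auto
  ultimately show ?thesis by blast
qed

text \<open>A weighted Sobolev bound for \<open>f = v^2 * wt (\<theta> + 1)\<close>: a point below y
  where \<open>f\<close> is small by averaging, then integration of \<open>f'\<close> up to y. The
  constant \<theta> + 3 is 2 from the averaging plus \<theta> + 1 from the derivative of the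
  weight.\<close>

lemma pointwise_bound:
  assumes th: "\<theta> > -1" and v: "ac_deriv v v'"
    and vL: "v \<in> L2 (lagm \<theta>)" and vL': "v' \<in> L2 (lagm (\<theta> + 1))" and y: "y > 0"
  shows "(v y)\<^sup>2 * wt (\<theta> + 1) y \<le> sq (lagm (\<theta> + 1)) v' + (\<theta> + 3) * sq (lagm \<theta>) v"
proof -
  let ?S = "sq (lagm \<theta>) v" and ?S' = "sq (lagm (\<theta> + 1)) v'"
  have cv: "continuous_on {0<..} v" by (rule ac_deriv_continuous[OF v])
  define f where "f t = (v t * v t) * wt (\<theta> + 1) t" for t
  define f' where "f' t = (v' t * v t + v t * v' t) * wt (\<theta> + 1) t + (v t * v t) * ((\<theta> + 1 - t) * wt \<theta> t)" for t
  have wt1: "ac_deriv (wt (\<theta> + 1)) (\<lambda>t. (\<theta> + 1 - t) * wt \<theta> t)"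
    by (rule ac_deriv_C1[OF wt_deriv1]) (auto intro!: continuous_intros wt_continuous)
  have f: "ac_deriv f f'"
    unfolding f_def f'_def by (rule ac_deriv_mult[OF ac_deriv_mult[OF v v] wt1])
  have cf: "continuous_on {0<..} f" by (rule ac_deriv_continuous[OF f])
  note i1 = L2_integrable_Icc[OF vL] and i2 = L2_integrable_Icc[OF vL']
    and S1 = L2_integral_Icc_le[OF vL] and S2 = L2_integral_Icc_le[OF vL']
  \<comment> \<open>The minimum over [y/2, y] lies below the average, and \<open>f t / t\<close> is
    the density \<open>wt \<theta> t * (v t)^2\<close> of the squared norm of
    \<open>v\<close>.\<close>
  obtain x where x: "x \<in> {y/2..y}" "\<And>t. t \<in> {y/2..y} \<Longrightarrow> f x \<le> f t"
    using continuous_attains_inf[of "{y/2..y}" f] continuous_on_subset[OF cf, of "{y/2..y}"] y by force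
  have f0: "f t \<ge> 0" for t by (simp add: f_def)
  have "f x / 2 = integral {y/2..y} (\<lambda>_. f x / y)" using y by (simp add: field_simps)
  also have "\<dots> \<le> integral {y/2..y} (\<lambda>t. wt \<theta> t * (v t)\<^sup>2)"
  proof (rule integral_le)
    fix t assume t: "t \<in> {y/2..y}"
    then have tp: "t > 0" using y by auto
    have "f x / y \<le> f t / t" using x(2)[OF t] t tp f0[of x] by (intro frac_le) auto
    also have "\<dots> = wt \<theta> t * (v t)\<^sup>2" using tp by (simp add: f_def wt_plus1 power2_eq_square)
    finally show "f x / y \<le> wt \<theta> t * (v t)\<^sup>2" .
  qed (use i1[of "y/2" y] y in auto)
  also have "\<dots> \<le> ?S" by (rule S1) (use y in simp)
  finally have fx: "f x \<le> 2 * ?S" by simp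
  have xp: "x > 0" "x \<le> y" using x(1) y by auto
  have "f y - f x = integral {x..y} f'" by (rule ac_derivD(2)[OF f xp])
  also have "\<dots> \<le> integral {x..y} (\<lambda>t. wt (\<theta> + 1) t * (v' t)\<^sup>2 + (\<theta> + 1) * (wt \<theta> t * (v t)\<^sup>2))"
  proof (rule integral_le)
    fix t assume "t \<in> {x..y}"
    then have tp: "t > 0" using xp by auto
    \<comment> \<open>The decay of e^(-t) contributes \<open>- v^2 * wt (\<theta> + 1)\<close> to
      \<open>f'\<close>. This cancels the \<open>v^2\<close> part of the estimate of the cross term,
      which would otherwise carry one power of t too many.\<close>
    have "2 * (v t * v' t) * wt (\<theta> + 1) t \<le> ((v t)\<^sup>2 + (v' t)\<^sup>2) * wt (\<theta> + 1) t"
      using sum_squares_bound[of "v t" "v' t"] by (intro mult_right_mono) (auto simp: mult.assoc)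
    moreover have "f' t = 2 * (v t * v' t) * wt (\<theta> + 1) t + (v t)\<^sup>2 * ((\<theta> + 1) * wt \<theta> t) - (v t)\<^sup>2 * wt (\<theta> + 1) t"
      unfolding f'_def wt_plus1[OF tp] by (simp add: algebra_simps power2_eq_square)
    ultimately show "f' t \<le> wt (\<theta> + 1) t * (v' t)\<^sup>2 + (\<theta> + 1) * (wt \<theta> t * (v t)\<^sup>2)"
      by (simp add: algebra_simps)
  qed (use ac_derivD(3)[OF f xp] i1[OF xp(1)] i2[OF xp(1)] in \<open>auto intro!: integrable_add integrable_on_mult_right\<close>)
  also have "\<dots> = integral {x..y} (\<lambda>t. wt (\<theta> + 1) t * (v' t)\<^sup>2) + (\<theta> + 1) * integral {x..y} (\<lambda>t. wt \<theta> t * (v t)\<^sup>2)"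
    using i1[OF xp(1)] i2[OF xp(1)] by (subst integral_add) (auto intro!: integrable_on_mult_right)
  also have "\<dots> \<le> ?S' + (\<theta> + 1) * ?S"
    using S1[OF xp(1), of y] S2[OF xp(1), of y] th by (intro add_mono mult_left_mono) auto
  finally have "f y \<le> ?S' + (\<theta> + 3) * ?S" using fx by (simp add: algebra_simps)
  then show ?thesis by (simp add: f_def power2_eq_square)
qed

section \<open>The interpolation error in the variable \<open>y\<close>\<close>

text \<open>Interpolation reproduces \<open>p\<close>, so subtracting \<open>p\<close> leaves the
  error unchanged; the norm of the interpolant of the residual is its quadrature sum.\<close>

lemma interpolation_error_split:
  assumes "laguerre_nodes \<theta> n Z" and u: "u \<in> L2 (lagm \<theta>)" and p: "degree p < n"
  defines "v \<equiv> \<lambda>y. u y - poly p y"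
  shows "sqrt (sq (lagm \<theta>) (\<lambda>y. poly (laguerre_nodes.interp Z u) y - u y))
    \<le> sqrt (sq (lagm \<theta>) v) + sqrt (\<Sum>z\<in>Z. (v z)\<^sup>2 * christoffel Z \<theta> z)"
proof -
  interpret laguerre_nodes \<theta> n Z by fact
  have vL: "v \<in> L2 (lagm \<theta>)" unfolding v_def by (rule L2_diff[OF u poly_L2[OF theta]])
  have "interp v = interp u - p" unfolding v_def interp_diff interp_poly[OF p] ..
  then have "(\<lambda>y. poly (interp u) y - u y) = (\<lambda>y. poly (interp v) y + (- 1) * v y)" by (auto simp: v_def)
  then have "sqrt (sq (lagm \<theta>) (\<lambda>y. poly (interp u) y - u y)) \<le> sqrt (sq (lagm \<theta>) (poly (interp v))) + sqrt (sq (lagm \<theta>) (\<lambda>y. (- 1) * v y))"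
    using L2_triangle[OF poly_L2[OF theta] L2_cmult[OF vL, of "-1"]] by simp
  then show ?thesis unfolding sq_cmult sq_interp by simp
qed

lemma higher_pderiv_degree_le:
  fixes p :: "real poly"
  assumes "degree p \<le> M"
  shows "degree ((pderiv ^^ k) p) + k \<le> M \<or> (pderiv ^^ k) p = 0"
proof (induction k)
  case (Suc k)
  show ?case
  proof (cases "degree ((pderiv ^^ k) p) = 0")
    case True
    then show ?thesis by (simp add: pderiv_eq_0_iff)
  next
    case False
    then show ?thesis using Suc by (auto simp: degree_pderiv)
  qed
qed (use assms in simp)

text \<open>The residual of the orthogonal projection stays orthogonal to polynomials of decreasing
  degree under differentiation, so the spectral gap applies at each order.\<close>

lemma projection_residual:
  fixes U :: "nat \<Rightarrow> real \<Rightarrow> real"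
  assumes th: "\<theta> > -1" and m: "1 \<le> m" "m \<le> M + 1"
    and U: "\<And>k. k < m \<Longrightarrow> ac_deriv (U k) (U (Suc k))"
    and UL: "\<And>k. k \<le> m \<Longrightarrow> U k \<in> L2 (lagm (\<theta> + real k))"
  shows "\<exists>p v'. degree p \<le> M \<and> ac_deriv (\<lambda>y. U 0 y - poly p y) v' \<and> v' \<in> L2 (lagm (\<theta> + 1)) \<and>
    sq (lagm \<theta>) (\<lambda>y. U 0 y - poly p y) \<le> fact (M + 1 - m) / fact M * sq (lagm (\<theta> + real m)) (U m) \<and>
    sq (lagm (\<theta> + 1)) v' \<le> fact (M + 1 - m) / fact M * sq (lagm (\<theta> + real m)) (U m)"
proof -
  have "U 0 \<in> L2 (lagm \<theta>)" using UL[of 0] by simp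
  from poly_projection[OF th this, of M] obtain p where p: "degree p \<le> M"
    "\<And>q. degree q \<le> M \<Longrightarrow> ip (lagm \<theta>) (\<lambda>y. U 0 y - poly p y) (poly q) = 0" by blast
  define P where "P k = (pderiv ^^ k) p" for k
  define v where "v k = (\<lambda>y. U k y - poly (P k) y)" for k
  have thk: "\<theta> + real k > -1" for k using th by linarith
  have vac: "ac_deriv (v k) (v (Suc k))" if "k < m" for k
    using ac_deriv_diff[OF U[OF that] poly_ac_deriv[of "P k"]] by (simp add: v_def P_def)
  have vL: "v k \<in> L2 (lagm (\<theta> + real k))" if "k \<le> m" for k
    unfolding v_def by (rule L2_diff[OF UL[OF that] poly_L2[OF thk]])
  have S: "\<theta> + real (Suc k) = \<theta> + real k + 1" for k by simp
  have orth: "k \<le> m \<longrightarrow> degree q + k \<le> M \<longrightarrow> ip (lagm (\<theta> + real k)) (v k) (poly q) = 0" for k q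
  proof (induction k arbitrary: q)
    case 0
    then show ?case using p(2) by (simp add: v_def P_def)
  next
    case (Suc k)
    show ?case
    proof (intro impI)
      assume k: "Suc k \<le> m" "degree q + Suc k \<le> M"
      have "ip (lagm (\<theta> + real (Suc k))) (v (Suc k)) (poly q) = ip (lagm (\<theta> + real k)) (v k) (poly (adjoint (\<theta> + real k) q))"
        unfolding S using k vL[of "Suc k", unfolded S] by (intro ip_deriv[OF thk vac vL]) auto
      also have "\<dots> = 0" using Suc.IH[of "adjoint (\<theta> + real k) q"] k degree_adjoint[of "\<theta> + real k" q] by simp
      finally show "ip (lagm (\<theta> + real (Suc k))) (v (Suc k)) (poly q) = 0" .
    qed
  qed
  have gap: "(real (M - k) + 1) * sq (lagm (\<theta> + real k)) (v k) \<le> sq (lagm (\<theta> + real (Suc k))) (v (Suc k))"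
    if k: "k < m" for k
    unfolding S
  proof (rule laguerre_gap[OF thk vac[OF k] vL vL[of "Suc k", unfolded S]])
    fix q :: "real poly" assume "degree q \<le> M - k"
    then show "ip (lagm (\<theta> + real k)) (v k) (poly q) = 0" using orth[of k q] k m by auto
  qed (use k in auto)
  \<comment> \<open>The gaps M, M - 1, ..., M + 2 - m multiply to M!/(M + 1 - m)!. The chain starts
    at \<open>v 1\<close>; \<open>v 0\<close> obeys the same bound because its own gap M + 1 is at
    least 1.\<close>
  have chain: "1 \<le> j \<longrightarrow> j \<le> m \<longrightarrow> fact M * sq (lagm (\<theta> + 1)) (v 1) \<le> fact (M + 1 - j) * sq (lagm (\<theta> + real j)) (v j)" for j
  proof (induction j)
    case (Suc j)
    show ?case
    proof (intro impI)
      assume j: "1 \<le> Suc j" "Suc j \<le> m"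
      show "fact M * sq (lagm (\<theta> + 1)) (v 1) \<le> fact (M + 1 - Suc j) * sq (lagm (\<theta> + real (Suc j))) (v (Suc j))"
      proof (cases "j = 0")
        case False
        then have "fact M * sq (lagm (\<theta> + 1)) (v 1) \<le> fact (M + 1 - j) * sq (lagm (\<theta> + real j)) (v j)"
          using Suc.IH j by simp
        also have "M + 1 - j = Suc (M - j)" using j m by simp
        then have "fact (M + 1 - j) * sq (lagm (\<theta> + real j)) (v j) = fact (M - j) * ((real (M - j) + 1) * sq (lagm (\<theta> + real j)) (v j))"
          by (simp add: algebra_simps)
        also have "\<dots> \<le> fact (M - j) * sq (lagm (\<theta> + real (Suc j))) (v (Suc j))"
          by (intro mult_left_mono gap) (use j in auto)
        finally show ?thesis by simp
      qed simp
    qed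
  qed simp
  \<comment> \<open>Pythagoras: the m-th derivative of \<open>p\<close> has degree at most M - m, or
    is 0 when m = M + 1, and \<open>v m\<close> is orthogonal to it.\<close>
  have top: "sq (lagm (\<theta> + real m)) (v m) \<le> sq (lagm (\<theta> + real m)) (U m)"
  proof -
    have "U m = (\<lambda>y. v m y + poly (P m) y)" by (simp add: v_def)
    moreover have "ip (lagm (\<theta> + real m)) (v m) (poly (P m)) = 0"
      using higher_pderiv_degree_le[OF p(1), of m] orth[of m "P m"] by (auto simp: P_def ip_def)
    ultimately have "sq (lagm (\<theta> + real m)) (U m) = sq (lagm (\<theta> + real m)) (v m) + sq (lagm (\<theta> + real m)) (poly (P m))"
      using sq_add[OF vL[of m] poly_L2[OF thk]] by simp
    then show ?thesis by simp
  qed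
  have "fact M * sq (lagm (\<theta> + 1)) (v 1) \<le> fact (M + 1 - m) * sq (lagm (\<theta> + real m)) (U m)"
  proof (rule order_trans)
    show "fact M * sq (lagm (\<theta> + 1)) (v 1) \<le> fact (M + 1 - m) * sq (lagm (\<theta> + real m)) (v m)"
      using chain[of m] m by blast
    show "fact (M + 1 - m) * sq (lagm (\<theta> + real m)) (v m) \<le> fact (M + 1 - m) * sq (lagm (\<theta> + real m)) (U m)"
      by (intro mult_left_mono top) simp
  qed
  then have b1: "sq (lagm (\<theta> + 1)) (v 1) \<le> fact (M + 1 - m) / fact M * sq (lagm (\<theta> + real m)) (U m)"
    by (simp add: field_simps)
  have "sq (lagm \<theta>) (v 0) \<le> (real M + 1) * sq (lagm \<theta>) (v 0)"
    using mult_right_mono[of 1 "real M + 1" "sq (lagm \<theta>) (v 0)"] by simp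
  also have "\<dots> \<le> sq (lagm (\<theta> + 1)) (v 1)" using gap[of 0] m by simp
  finally have b0: "sq (lagm \<theta>) (v 0) \<le> fact (M + 1 - m) / fact M * sq (lagm (\<theta> + real m)) (U m)" using b1 by simp
  show ?thesis
    using p(1) vac[of 0] vL[of 1] b0 b1 m by (intro exI[of _ p] exI[of _ "v 1"]) (simp add: v_def P_def)
qed

lemma interpolation_error_log:
  assumes th: "\<theta> > -1"
  shows "\<exists>C>0. \<forall>M Z m U. 2 \<le> M \<longrightarrow> Z = {y. 0 < y \<and> laguerre (M + 1) \<theta> y = 0} \<longrightarrow> 1 \<le> m \<longrightarrow> m \<le> M + 1 \<longrightarrow>
    (\<forall>k<m. ac_deriv (U k) (U (Suc k))) \<longrightarrow> (\<forall>k\<le>m. U k \<in> L2 (lagm (\<theta> + real k))) \<longrightarrow>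
    sqrt (sq (lagm \<theta>) (\<lambda>y. poly (laguerre_nodes.interp Z (U 0)) y - U 0 y)) \<le>
      C * sqrt (fact (M + 1 - m) / fact M) * (sqrt (ln (real M)) * sqrt (sq (lagm (\<theta> + real m)) (U m)))"
proof -
  obtain C where C: "C > 0" "\<And>M Z. 2 \<le> M \<Longrightarrow> Z = {y. 0 < y \<and> laguerre (M + 1) \<theta> y = 0} \<Longrightarrow>
    (\<Sum>z\<in>Z. christoffel Z \<theta> z / wt (\<theta> + 1) z) \<le> C * ln (real M)"
    using node_sum_log[OF th] by blast
  \<comment> \<open>The first summand pays for the residual itself, whose bound has no logarithm, by
    ln M >= ln 2. In the second, \<theta> + 4 is 1 + (\<theta> + 3) from
    \<open>pointwise_bound\<close> with both norms at most \<open>A\<close>.\<close>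
  define K where "K = 1 / sqrt (ln 2) + sqrt ((\<theta> + 4) * C)"
  have main: "sqrt (sq (lagm \<theta>) (\<lambda>y. poly (laguerre_nodes.interp Z (U 0)) y - U 0 y)) \<le>
      K * sqrt (fact (M + 1 - m) / fact M) * (sqrt (ln (real M)) * sqrt (sq (lagm (\<theta> + real m)) (U m)))"
    if M: "2 \<le> M" and Z: "Z = {y. 0 < y \<and> laguerre (M + 1) \<theta> y = 0}" and m: "1 \<le> m" "m \<le> M + 1"
      and U: "\<And>k. k < m \<Longrightarrow> ac_deriv (U k) (U (Suc k))" and UL: "\<And>k. k \<le> m \<Longrightarrow> U k \<in> L2 (lagm (\<theta> + real k))"
    for M Z m and U :: "nat \<Rightarrow> real \<Rightarrow> real"
  proof -
    interpret laguerre_nodes \<theta> "M + 1" Z by unfold_locales (use th Z in auto)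
    define A where "A = fact (M + 1 - m) / fact M * sq (lagm (\<theta> + real m)) (U m)"
    have A: "A \<ge> 0" by (simp add: A_def)
    obtain p v' where p: "degree p \<le> M" "ac_deriv (\<lambda>y. U 0 y - poly p y) v'" "v' \<in> L2 (lagm (\<theta> + 1))"
      "sq (lagm \<theta>) (\<lambda>y. U 0 y - poly p y) \<le> A" "sq (lagm (\<theta> + 1)) v' \<le> A"
      using projection_residual[OF th m U UL] unfolding A_def by blast
    define v where "v = (\<lambda>y. U 0 y - poly p y)"
    have u0: "U 0 \<in> L2 (lagm \<theta>)" using UL[of 0] by simp
    have vL: "v \<in> L2 (lagm \<theta>)" unfolding v_def by (rule L2_diff[OF u0 poly_L2[OF th]])
    have pw: "(v z)\<^sup>2 * \<omega> z \<le> (\<theta> + 4) * A * (\<omega> z / wt (\<theta> + 1) z)" if z: "z \<in> Z" for z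
    proof -
      have zp: "z > 0" by (rule Z_pos[OF z])
      have "(v z)\<^sup>2 * wt (\<theta> + 1) z \<le> sq (lagm (\<theta> + 1)) v' + (\<theta> + 3) * sq (lagm \<theta>) v"
        by (rule pointwise_bound[OF th _ vL p(3) zp]) (use p(2) v_def in simp)
      also have "\<dots> \<le> A + (\<theta> + 3) * A" using p(4,5) th v_def by (intro add_mono mult_left_mono) auto
      finally have "(v z)\<^sup>2 * wt (\<theta> + 1) z \<le> (\<theta> + 4) * A" by (simp add: algebra_simps)
      then have "(v z)\<^sup>2 \<le> (\<theta> + 4) * A / wt (\<theta> + 1) z" using wt_pos[OF zp, of "\<theta> + 1"] by (simp add: field_simps)
      from mult_right_mono[OF this weight_nonneg[of z]] show ?thesis by simp
    qed
    have "(\<Sum>z\<in>Z. (v z)\<^sup>2 * \<omega> z) \<le> (\<theta> + 4) * A * (\<Sum>z\<in>Z. \<omega> z / wt (\<theta> + 1) z)"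
      unfolding sum_distrib_left by (rule sum_mono[OF pw])
    also have "\<dots> \<le> (\<theta> + 4) * A * (C * ln (real M))"
      using C(2)[OF M Z] A th by (intro mult_left_mono) auto
    finally have n1: "(\<Sum>z\<in>Z. (v z)\<^sup>2 * \<omega> z) \<le> ((\<theta> + 4) * C) * (ln (real M) * A)" by (simp add: mult_ac)
    have l: "ln 2 \<le> ln (real M)" using M by simp
    have l2: "sqrt (ln 2) > 0" by simp
    have "sqrt A = 1 / sqrt (ln 2) * (sqrt (ln 2) * sqrt A)" using l2 by simp
    also have "\<dots> \<le> 1 / sqrt (ln 2) * (sqrt (ln (real M)) * sqrt A)"
      using l A by (intro mult_left_mono mult_right_mono) auto
    finally have n0: "sqrt A \<le> 1 / sqrt (ln 2) * (sqrt (ln (real M)) * sqrt A)" .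
    have "sqrt (sq (lagm \<theta>) (\<lambda>y. poly (interp (U 0)) y - U 0 y)) \<le> sqrt (sq (lagm \<theta>) v) + sqrt (\<Sum>z\<in>Z. (v z)\<^sup>2 * \<omega> z)"
      unfolding v_def
      using interpolation_error_split[OF laguerre_nodes_axioms u0, of p] p(1) by simp
    also have "\<dots> \<le> sqrt A + sqrt (((\<theta> + 4) * C) * (ln (real M) * A))"
      using p(4) v_def n1 by (intro add_mono real_sqrt_le_mono) auto
    also have "\<dots> \<le> K * (sqrt (ln (real M)) * sqrt A)"
    proof -
      have "sqrt (((\<theta> + 4) * C) * (ln (real M) * A)) = sqrt ((\<theta> + 4) * C) * (sqrt (ln (real M)) * sqrt A)"
        by (simp only: real_sqrt_mult mult.assoc)
      then show ?thesis using n0 unfolding K_def distrib_right[of "1 / sqrt (ln 2)"] by linarith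
    qed
    also have "\<dots> = K * sqrt (fact (M + 1 - m) / fact M) * (sqrt (ln (real M)) * sqrt (sq (lagm (\<theta> + real m)) (U m)))"
      unfolding A_def real_sqrt_mult by (simp only: mult_ac)
    finally show ?thesis .
  qed
  show ?thesis
  proof (intro exI[of _ K] conjI allI impI, goal_cases)
    case 1
    show ?case unfolding K_def using C th by (intro add_pos_nonneg) auto
  next
    case (2 M Z m U)
    note main' = main[where M = M and Z = Z and m = m and U = U, OF 2(1-4)]
    show ?case
      by (rule main'; rule 2(5)[rule_format] 2(6)[rule_format]; assumption)
  qed
qed

section \<open>The pinned Poincare inequality and the two-node case\<close>

lemma continuous_quotient_bounded:
  fixes f g :: "real \<Rightarrow> real"
  assumes "continuous_on {0<..} f" "continuous_on {0<..} g" "a > 0" "\<And>y. y > 0 \<Longrightarrow> g y > 0"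
  shows "\<exists>K. \<forall>y\<in>{a..b}. f y \<le> K * g y"
proof -
  have "continuous_on {a..b} (\<lambda>y. f y / g y)"
  proof (intro continuous_on_divide continuous_on_subset[OF assms(1)] continuous_on_subset[OF assms(2)] ballI)
    fix y assume "y \<in> {a..b}"
    then have "g y > 0" using assms(3,4) by simp
    then show "g y \<noteq> 0" by simp
  qed (use assms(3) in auto)
  then have "bounded ((\<lambda>y. f y / g y) ` {a..b})"
    by (intro compact_imp_bounded compact_continuous_image) auto
  then obtain K where K: "\<And>y. y \<in> {a..b} \<Longrightarrow> \<bar>f y / g y\<bar> \<le> K"
    unfolding bounded_iff by (metis image_eqI real_norm_def)
  have "f y \<le> K * g y" if "y \<in> {a..b}" for y
  proof -
    have "g y > 0" using assms(3,4) that by simp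
    then show ?thesis using K[OF that] by (simp add: abs_le_iff field_simps)
  qed
  then show ?thesis by blast
qed

text \<open>A Hardy-type inequality. Multiply \<open>g^2\<close> by the mass \<open>H\<close> to the
  left of the point (below 1), or by \<open>T\<close>, minus the mass to its right (above 1): the
  derivative is \<open>wt \<theta> * g^2\<close> plus a cross term. The boundary term vanishes at 1
  and has the favourable sign at the outer end. Both values of \<open>r\<close> occur later:
  \<theta> for the step to the first derivative, \<theta> + 1 for the step to the second.\<close>

lemma pinned_poincare:
  assumes th: "\<theta> > -1"
  shows "\<exists>C>0. \<forall>g g' r. ac_deriv g g' \<longrightarrow> g 1 = 0 \<longrightarrow> g \<in> L2 (lagm \<theta>) \<longrightarrow> (r = \<theta> \<or> r = \<theta> + 1) \<longrightarrow> g' \<in> L2 (lagm r) \<longrightarrow>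
    sq (lagm \<theta>) g \<le> C * sq (lagm r) g'"
proof -
  define H :: "real \<Rightarrow> real" where "H y = (LINT t|lagm \<theta>. indicator {..y} t)" for y
  define W where "W = (LINT t|lagm \<theta>. (1::real))"
  have one: "integrable (lagm \<theta>) (\<lambda>_. 1 :: real)" using lagm_power_integrable[OF th, of 0] by simp
  have ii: "integrable (lagm \<theta>) (indicator X :: real \<Rightarrow> real)" if "X \<in> sets borel" for X
    using lagm_integrable_indicator[OF one that] by simp
  have H_ac: "ac_deriv H (wt \<theta>)"
    using ac_deriv_cumulative[OF one] unfolding H_def by simp
  define T where "T y = H y - W" for y
  have T_ac: "ac_deriv T (wt \<theta>)" unfolding T_def by (rule ac_deriv_minus_const[OF H_ac])
  have T_tail: "T y = - (LINT t|lagm \<theta>. indicator {y<..} t)" for y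
  proof -
    have "H y + (LINT t|lagm \<theta>. indicator {y<..} t) = (LINT t|lagm \<theta>. indicator {..y} t + indicator {y<..} t)"
      unfolding H_def by (rule Bochner_Integration.integral_add[symmetric]) (auto intro!: ii)
    also have "\<dots> = W" unfolding W_def
      by (intro Bochner_Integration.integral_cong) (auto simp: indicator_def)
    finally show ?thesis by (simp add: T_def)
  qed
  have H0: "H y \<ge> 0" and T0: "T y \<le> 0" for y
    unfolding T_tail unfolding H_def by (auto intro!: Bochner_Integration.integral_nonneg)
  note cH = ac_deriv_continuous[OF H_ac] and cT = ac_deriv_continuous[OF T_ac]
  \<comment> \<open>The head bound stops at (\<theta> + 1)/2 and the tail bound starts at 2
    \<bar>\<theta>\<bar>; compactness bridges what is left up to 1, and from 1 on.\<close>
  have "\<exists>K. \<forall>y\<in>{(\<theta> + 1) / 2..1}. H y \<le> K * wt (\<theta> + 1) y"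
    by (rule continuous_quotient_bounded[OF cH wt_continuous]) (use th wt_pos in auto)
  then obtain K1 where K1: "\<And>y. y \<in> {(\<theta> + 1) / 2..1} \<Longrightarrow> H y \<le> K1 * wt (\<theta> + 1) y" by blast
  have "\<exists>K. \<forall>y\<in>{1..max 1 (2 * \<bar>\<theta>\<bar>)}. - T y \<le> K * wt \<theta> y"
    by (rule continuous_quotient_bounded[OF continuous_on_minus[OF cT] wt_continuous]) (use wt_pos in auto)
  then obtain K2 where K2: "\<And>y. y \<in> {1..max 1 (2 * \<bar>\<theta>\<bar>)} \<Longrightarrow> - T y \<le> K2 * wt \<theta> y" by blast
  define K where "K = max 1 (max (max K1 (2 / (\<theta> + 1))) (max K2 2))"
  have K: "K \<ge> 1" "K1 \<le> K" "2 / (\<theta> + 1) \<le> K" "K2 \<le> K" "2 \<le> K" by (auto simp: K_def)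
  have Hb: "H y \<le> K * wt (\<theta> + 1) y" if y: "0 < y" "y \<le> 1" for y
  proof (cases "y \<le> (\<theta> + 1) / 2")
    case True
    have "H y \<le> 2 / (\<theta> + 1) * wt (\<theta> + 1) y" unfolding H_def by (rule lagm_head_mass[OF th y(1) True])
    also have "\<dots> \<le> K * wt (\<theta> + 1) y" by (intro mult_right_mono K) auto
    finally show ?thesis .
  next
    case False
    then have "H y \<le> K1 * wt (\<theta> + 1) y" using K1[of y] y by simp
    also have "\<dots> \<le> K * wt (\<theta> + 1) y" by (intro mult_right_mono K) auto
    finally show ?thesis .
  qed
  have Tb: "- T y \<le> K * wt \<theta> y" if y: "1 \<le> y" for y
  proof (cases "y \<le> max 1 (2 * \<bar>\<theta>\<bar>)")
    case True
    then have "- T y \<le> K2 * wt \<theta> y" using K2[of y] y by simp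
    also have "\<dots> \<le> K * wt \<theta> y" by (intro mult_right_mono K) auto
    finally show ?thesis .
  next
    case False
    then have "- T y \<le> 2 * wt \<theta> y" unfolding T_tail using lagm_tail_mass[OF th, of y] y by simp
    also have "\<dots> \<le> K * wt \<theta> y" by (intro mult_right_mono K) auto
    finally show ?thesis .
  qed
  have main: "sq (lagm \<theta>) g \<le> (8 * K\<^sup>2) * sq (lagm r) g'"
    if g: "ac_deriv g g'" and g1: "g 1 = 0" and gL: "g \<in> L2 (lagm \<theta>)" and r: "r = \<theta> \<or> r = \<theta> + 1" and gL': "g' \<in> L2 (lagm r)"
    for g g' r
  proof -
    note i1 = L2_integrable_Icc[OF gL] and i2 = L2_integrable_Icc[OF gL'] and S2 = L2_integral_Icc_le[OF gL']
    \<comment> \<open>Young's inequality scaled so that half of the left-hand integral can be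
      absorbed; the assumption on \<open>h\<close> passes the rest to the weight of the
      derivative.\<close>
    have young: "\<bar>2 * (x * x') * h\<bar> \<le> w * x\<^sup>2 / 2 + 2 * K\<^sup>2 * (w' * x'\<^sup>2)"
      if w: "w > 0" "h\<^sup>2 \<le> K\<^sup>2 * w * w'" for x x' h w w' :: real
    proof -
      have "0 \<le> (w * \<bar>x\<bar> - 2 * \<bar>x'\<bar> * \<bar>h\<bar>)\<^sup>2" by simp
      also have "\<dots> = w\<^sup>2 * x\<^sup>2 - 4 * w * \<bar>x\<bar> * \<bar>x'\<bar> * \<bar>h\<bar> + 4 * x'\<^sup>2 * h\<^sup>2"
        by (simp add: power2_diff power_mult_distrib)
      also have "\<dots> \<le> w\<^sup>2 * x\<^sup>2 - 4 * w * \<bar>x\<bar> * \<bar>x'\<bar> * \<bar>h\<bar> + 4 * x'\<^sup>2 * (K\<^sup>2 * w * w')"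
        using w(2) by (intro add_left_mono mult_left_mono) auto
      also have "\<dots> = 2 * w * (w * x\<^sup>2 / 2 + 2 * K\<^sup>2 * (w' * x'\<^sup>2) - \<bar>2 * (x * x') * h\<bar>)"
        by (simp add: abs_mult algebra_simps power2_eq_square)
      finally show ?thesis using w(1) by (simp add: zero_le_mult_iff)
    qed
    have part: "integral {s..u} (\<lambda>t. wt \<theta> t * (g t)\<^sup>2) \<le> 4 * K\<^sup>2 * sq (lagm r) g'"
      if su: "0 < s" "s \<le> u" and h: "ac_deriv h (wt \<theta>)" and bd: "(g u)\<^sup>2 * h u \<le> (g s)\<^sup>2 * h s"
        and hb: "\<And>t. s \<le> t \<Longrightarrow> t \<le> u \<Longrightarrow> (h t)\<^sup>2 \<le> K\<^sup>2 * wt \<theta> t * wt r t" for s u h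
    proof -
      let ?I = "integral {s..u} (\<lambda>t. wt \<theta> t * (g t)\<^sup>2)"
      note ac = ac_deriv_mult[OF ac_deriv_mult[OF g g] h]
      have ig: "(\<lambda>t. (g' t * g t + g t * g' t) * h t + g t * g t * wt \<theta> t) integrable_on {s..u}"
        by (rule ac_derivD(3)[OF ac su])
      have "integral {s..u} (\<lambda>t. (g' t * g t + g t * g' t) * h t + g t * g t * wt \<theta> t) = (g u)\<^sup>2 * h u - (g s)\<^sup>2 * h s"
        using ac_derivD(2)[OF ac su] by (simp add: power2_eq_square)
      also have "\<dots> \<le> 0" using bd by simp
      finally have le0: "integral {s..u} (\<lambda>t. (g' t * g t + g t * g' t) * h t + g t * g t * wt \<theta> t) \<le> 0" .
      have "?I - integral {s..u} (\<lambda>t. (g' t * g t + g t * g' t) * h t + g t * g t * wt \<theta> t)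
          = integral {s..u} (\<lambda>t. wt \<theta> t * (g t)\<^sup>2 - ((g' t * g t + g t * g' t) * h t + g t * g t * wt \<theta> t))"
        by (rule integral_diff[symmetric, OF i1[OF su(1)] ig])
      also have "\<dots> \<le> integral {s..u} (\<lambda>t. 1 / 2 * (wt \<theta> t * (g t)\<^sup>2) + 2 * K\<^sup>2 * (wt r t * (g' t)\<^sup>2))"
      proof (rule integral_le)
        show "(\<lambda>t. wt \<theta> t * (g t)\<^sup>2 - ((g' t * g t + g t * g' t) * h t + g t * g t * wt \<theta> t)) integrable_on {s..u}"
          by (rule integrable_diff[OF i1[OF su(1)] ig])
        show "(\<lambda>t. 1 / 2 * (wt \<theta> t * (g t)\<^sup>2) + 2 * K\<^sup>2 * (wt r t * (g' t)\<^sup>2)) integrable_on {s..u}"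
          by (intro integrable_add integrable_on_mult_right i1 i2 su(1))
        fix t assume t: "t \<in> {s..u}"
        then have "\<bar>2 * (g t * g' t) * h t\<bar> \<le> wt \<theta> t * (g t)\<^sup>2 / 2 + 2 * K\<^sup>2 * (wt r t * (g' t)\<^sup>2)"
          using su hb[of t] by (intro young wt_pos) auto
        moreover have "wt \<theta> t * (g t)\<^sup>2 - ((g' t * g t + g t * g' t) * h t + g t * g t * wt \<theta> t) = - (2 * (g t * g' t) * h t)"
          by (simp add: algebra_simps power2_eq_square)
        ultimately show "wt \<theta> t * (g t)\<^sup>2 - ((g' t * g t + g t * g' t) * h t + g t * g t * wt \<theta> t)
            \<le> 1 / 2 * (wt \<theta> t * (g t)\<^sup>2) + 2 * K\<^sup>2 * (wt r t * (g' t)\<^sup>2)"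
          by linarith
      qed
      also have "\<dots> = 1 / 2 * ?I + 2 * K\<^sup>2 * integral {s..u} (\<lambda>t. wt r t * (g' t)\<^sup>2)"
        using i1[OF su(1)] i2[OF su(1)] by (subst integral_add) (auto intro!: integrable_on_mult_right)
      also have "\<dots> \<le> 1 / 2 * ?I + 2 * K\<^sup>2 * sq (lagm r) g'"
        by (intro add_left_mono mult_left_mono S2 su(1)) simp
      finally show ?thesis using le0 by linarith
    qed
    have left: "integral {a..1} (\<lambda>t. wt \<theta> t * (g t)\<^sup>2) \<le> 4 * K\<^sup>2 * sq (lagm r) g'" if a: "0 < a" "a \<le> 1" for a
    proof (rule part[OF a H_ac])
      show "(g 1)\<^sup>2 * H 1 \<le> (g a)\<^sup>2 * H a" using g1 H0 by simp
      fix t assume t: "a \<le> t" "t \<le> 1"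
      then have tp: "t > 0" using a by simp
      have "(H t)\<^sup>2 \<le> (K * wt (\<theta> + 1) t)\<^sup>2" by (rule power_mono[OF Hb[OF tp t(2)] H0])
      also have "\<dots> = K\<^sup>2 * (wt \<theta> t)\<^sup>2 * t\<^sup>2" by (simp add: wt_plus1[OF tp] power_mult_distrib)
      \<comment> \<open>For t <= 1 both t^2 <= 1 and t^2 <= t hold, which covers the two values of
        \<open>r\<close>.\<close>
      also have "\<dots> \<le> K\<^sup>2 * wt \<theta> t * wt r t"
      proof -
        have "t\<^sup>2 \<le> t" using t tp by (simp add: power2_eq_square mult_left_le)
        moreover from this have "t\<^sup>2 \<le> 1" using t by simp
        ultimately have "t\<^sup>2 * wt \<theta> t \<le> wt r t"
          using r wt_plus1[OF tp, of \<theta>] mult_right_mono[of "t\<^sup>2" 1 "wt \<theta> t"] mult_right_mono[of "t\<^sup>2" t "wt \<theta> t"] by auto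
        then have "(K\<^sup>2 * wt \<theta> t) * (t\<^sup>2 * wt \<theta> t) \<le> (K\<^sup>2 * wt \<theta> t) * wt r t"
          by (intro mult_left_mono) auto
        then show ?thesis by (simp add: power2_eq_square mult_ac)
      qed
      finally show "(H t)\<^sup>2 \<le> K\<^sup>2 * wt \<theta> t * wt r t" .
    qed
    have right: "integral {1..b} (\<lambda>t. wt \<theta> t * (g t)\<^sup>2) \<le> 4 * K\<^sup>2 * sq (lagm r) g'" if b: "1 \<le> b" for b
    proof (rule part[OF _ b T_ac])
      show "(g b)\<^sup>2 * T b \<le> (g 1)\<^sup>2 * T 1" using g1 T0[of b] by (simp add: mult_nonneg_nonpos)
      fix t assume t: "1 \<le> t" "t \<le> b"
      then have tp: "t > 0" by simp
      have "(T t)\<^sup>2 \<le> (K * wt \<theta> t)\<^sup>2" using power_mono[OF Tb[OF t(1)], of 2] T0[of t] by simp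
      also have "\<dots> = K\<^sup>2 * wt \<theta> t * wt \<theta> t" by (simp add: power2_eq_square)
      also have "\<dots> \<le> K\<^sup>2 * wt \<theta> t * wt r t"
      proof (intro mult_left_mono)
        show "wt \<theta> t \<le> wt r t" using r wt_plus1[OF tp, of \<theta>] mult_right_mono[of 1 t "wt \<theta> t"] t by auto
      qed auto
      finally show "(T t)\<^sup>2 \<le> K\<^sup>2 * wt \<theta> t * wt r t" .
    qed simp
    have "integral {0<..} (\<lambda>t. wt \<theta> t * (g t)\<^sup>2) \<le> 8 * K\<^sup>2 * sq (lagm r) g'"
    proof (rule integral_exhaust_le[OF L2_abs_integrable[OF gL]])
      fix a b :: real assume ab: "0 < a" "a \<le> b"
      have "integral {a..b} (\<lambda>t. wt \<theta> t * (g t)\<^sup>2) \<le> integral {min a 1..max b 1} (\<lambda>t. wt \<theta> t * (g t)\<^sup>2)"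
        by (rule integral_subset_le) (use ab i1 in auto)
      also have "\<dots> = integral {min a 1..1} (\<lambda>t. wt \<theta> t * (g t)\<^sup>2) + integral {1..max b 1} (\<lambda>t. wt \<theta> t * (g t)\<^sup>2)"
        by (rule Henstock_Kurzweil_Integration.integral_combine[symmetric]) (use ab i1 in auto)
      also have "\<dots> \<le> 4 * K\<^sup>2 * sq (lagm r) g' + 4 * K\<^sup>2 * sq (lagm r) g'"
        by (intro add_mono left right) (use ab in auto)
      finally show "integral {a..b} (\<lambda>t. wt \<theta> t * (g t)\<^sup>2) \<le> 8 * K\<^sup>2 * sq (lagm r) g'" by linarith
    qed
    then show ?thesis unfolding L2_sq_eq[OF gL] .
  qed
  show ?thesis
    by (intro exI[of _ "8 * K\<^sup>2"] conjI allI impI main) (use K(1) in auto)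
qed

lemma pinned_pointwise_bound:
  assumes z: "z > 0"
  shows "\<exists>C\<ge>0. \<forall>v v'. ac_deriv v v' \<longrightarrow> v 1 = 0 \<longrightarrow> v \<in> L2 (lagm \<theta>) \<longrightarrow> v' \<in> L2 (lagm \<theta>) \<longrightarrow>
    (v z)\<^sup>2 \<le> C * (sq (lagm \<theta>) v + sq (lagm \<theta>) v')"
proof -
  define a where "a = min z 1"
  define b where "b = max z 1"
  have ab: "0 < a" "a \<le> b" using z by (auto simp: a_def b_def)
  have "\<exists>K. \<forall>y\<in>{a..b}. 1 \<le> K * wt \<theta> y"
    by (rule continuous_quotient_bounded[OF continuous_on_const wt_continuous ab(1) wt_pos])
  then obtain K where K: "\<And>y. y \<in> {a..b} \<Longrightarrow> 1 \<le> K * wt \<theta> y" by blast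
  have "K * wt \<theta> a \<ge> 1" using K[of a] ab by simp
  then have K0: "K \<ge> 0" using wt_pos[OF ab(1), of \<theta>] by (smt (verit) mult_nonpos_nonneg)
  have "(v z)\<^sup>2 \<le> K * (sq (lagm \<theta>) v + sq (lagm \<theta>) v')"
    if v: "ac_deriv v v'" and v1: "v 1 = 0" and vL: "v \<in> L2 (lagm \<theta>)" and vL': "v' \<in> L2 (lagm \<theta>)" for v v'
  proof -
    let ?h = "\<lambda>t. wt \<theta> t * (v t)\<^sup>2 + wt \<theta> t * (v' t)\<^sup>2"
    note i1 = L2_integrable_Icc[OF vL ab(1), of b] and i2 = L2_integrable_Icc[OF vL' ab(1), of b]
    note ac = ac_deriv_mult[OF v v]
    let ?g = "\<lambda>t. v' t * v t + v t * v' t"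
    have h: "?h integrable_on {a..b}" by (rule integrable_add[OF i1 i2])
    \<comment> \<open>One of \<open>a\<close>, \<open>b\<close> is 1, where \<open>v\<close>
      vanishes, and the other is \<open>z\<close>; the absolute value covers both orders.\<close>
    have "(v z)\<^sup>2 = \<bar>v b * v b - v a * v a\<bar>"
      using v1 by (auto simp: a_def b_def min_def max_def power2_eq_square)
    also have "\<dots> = norm (integral {a..b} ?g)" using ac_derivD(2)[OF ac ab] by simp
    also have "\<dots> \<le> integral {a..b} (\<lambda>t. K * ?h t)"
    proof (rule integral_norm_bound_integral)
      show "?g integrable_on {a..b}" by (rule ac_derivD(3)[OF ac ab])
      show "(\<lambda>t. K * ?h t) integrable_on {a..b}" by (rule integrable_on_mult_right[OF h])
      fix t assume t: "t \<in> {a..b}"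
      have "norm (?g t) = 2 * \<bar>v t\<bar> * \<bar>v' t\<bar>" by (simp add: abs_mult)
      also have "\<dots> \<le> 1 * ((v t)\<^sup>2 + (v' t)\<^sup>2)" using sum_squares_bound[of "\<bar>v t\<bar>" "\<bar>v' t\<bar>"] by simp
      also have "\<dots> \<le> (K * wt \<theta> t) * ((v t)\<^sup>2 + (v' t)\<^sup>2)" using K[OF t] by (intro mult_right_mono) auto
      finally show "norm (?g t) \<le> K * ?h t" by (simp add: algebra_simps)
    qed
    also have "\<dots> = K * integral {a..b} ?h" by simp
    also have "\<dots> \<le> K * (sq (lagm \<theta>) v + sq (lagm \<theta>) v')"
      unfolding integral_add[OF i1 i2]
      by (intro mult_left_mono add_mono L2_integral_Icc_le vL vL' ab K0)
    finally show ?thesis .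
  qed
  then show ?thesis using K0 by blast
qed

text \<open>For M = 1 only the norm with weight index \<theta> + m - 1 is available. The comparison
  polynomial is the Taylor polynomial at 1, whose residual and its derivative vanish there as the
  pinned inequality requires. There are just two fixed nodes, so constants may depend on
  them.\<close>

lemma interpolation_error_two_nodes:
  assumes th: "\<theta> > -1"
  shows "\<exists>C>0. \<forall>Z m U. Z = {y. 0 < y \<and> laguerre 2 \<theta> y = 0} \<longrightarrow> (m = 1 \<or> m = 2) \<longrightarrow>
    (\<forall>k<m. ac_deriv (U k) (U (Suc k))) \<longrightarrow> U 0 \<in> L2 (lagm \<theta>) \<longrightarrow> (\<forall>k\<in>{1..m}. U k \<in> L2 (lagm (\<theta> + real k - 1))) \<longrightarrow>
    sqrt (sq (lagm \<theta>) (\<lambda>y. poly (laguerre_nodes.interp Z (U 0)) y - U 0 y)) \<le>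
      C * sqrt (sq (lagm (\<theta> + real m - 1)) (U m))"
proof -
  define Z where "Z = {y. 0 < y \<and> laguerre 2 \<theta> y = 0}"
  interpret laguerre_nodes \<theta> 2 Z by unfold_locales (use th Z_def in auto)
  obtain C where C: "C > 0" "\<And>g g' r. ac_deriv g g' \<Longrightarrow> g 1 = 0 \<Longrightarrow> g \<in> L2 (lagm \<theta>) \<Longrightarrow> (r = \<theta> \<or> r = \<theta> + 1) \<Longrightarrow> g' \<in> L2 (lagm r) \<Longrightarrow>
    sq (lagm \<theta>) g \<le> C * sq (lagm r) g'"
    using pinned_poincare[OF th] by blast
  have "\<forall>z\<in>Z. \<exists>D\<ge>0. \<forall>v v'. ac_deriv v v' \<longrightarrow> v 1 = 0 \<longrightarrow> v \<in> L2 (lagm \<theta>) \<longrightarrow> v' \<in> L2 (lagm \<theta>) \<longrightarrow>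
    (v z)\<^sup>2 \<le> D * (sq (lagm \<theta>) v + sq (lagm \<theta>) v')"
    using pinned_pointwise_bound Z_pos by blast
  then obtain D where D: "\<And>z v v'. z \<in> Z \<Longrightarrow> ac_deriv v v' \<Longrightarrow> v 1 = 0 \<Longrightarrow> v \<in> L2 (lagm \<theta>) \<Longrightarrow> v' \<in> L2 (lagm \<theta>) \<Longrightarrow>
    (v z)\<^sup>2 \<le> D z * (sq (lagm \<theta>) v + sq (lagm \<theta>) v')" and D0: "\<And>z. z \<in> Z \<Longrightarrow> D z \<ge> 0"
    by metis
  define E where "E = (\<Sum>z\<in>Z. D z * \<omega> z)"
  have E0: "E \<ge> 0" unfolding E_def by (intro sum_nonneg mult_nonneg_nonneg D0 weight_nonneg)
  \<comment> \<open>Large enough for the residual and for the residual together with its derivative,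
    in both cases: C and C + 1 for m = 1, C^2 and C^2 + C for m = 2.\<close>
  define B where "B = C * (1 + C) + 1 + C"
  have B: "C \<le> B" "C * C \<le> B" "C * C + C \<le> B" "C + 1 \<le> B" "B > 0"
    using C(1) mult_pos_pos[OF C(1) C(1)] unfolding B_def distrib_left mult_1_right by linarith+
  define F where "F = sqrt B + sqrt (E * B)"
  have main: "sqrt (sq (lagm \<theta>) (\<lambda>y. poly (interp (U 0)) y - U 0 y)) \<le> F * sqrt (sq (lagm (\<theta> + real m - 1)) (U m))"
    if m: "m = 1 \<or> m = 2" and U: "\<And>k. k < m \<Longrightarrow> ac_deriv (U k) (U (Suc k))" and U0: "U 0 \<in> L2 (lagm \<theta>)"
      and UL: "\<And>k. k \<in> {1..m} \<Longrightarrow> U k \<in> L2 (lagm (\<theta> + real k - 1))" for m and U :: "nat \<Rightarrow> real \<Rightarrow> real"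
  proof -
    let ?R = "sq (lagm (\<theta> + real m - 1)) (U m)"
    have "\<exists>p v'. degree p < 2 \<and> ac_deriv (\<lambda>y. U 0 y - poly p y) v' \<and> U 0 1 - poly p 1 = 0 \<and> v' \<in> L2 (lagm \<theta>) \<and>
      sq (lagm \<theta>) (\<lambda>y. U 0 y - poly p y) \<le> B * ?R \<and> sq (lagm \<theta>) (\<lambda>y. U 0 y - poly p y) + sq (lagm \<theta>) v' \<le> B * ?R"
      using m
    proof
      assume m1: "m = 1"
      \<comment> \<open>Taylor polynomial of degree 0 at the point 1.\<close>
      define p where "p = [:U 0 1:]"
      have R: "?R = sq (lagm \<theta>) (U 1)" by (simp add: m1)
      have U1: "U 1 \<in> L2 (lagm \<theta>)" using UL[of 1] m1 by simp
      have ac: "ac_deriv (\<lambda>y. U 0 y - poly p y) (U 1)"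
        using ac_deriv_minus_const[OF U[of 0], of "U 0 1"] m1 by (simp add: p_def)
      have b: "sq (lagm \<theta>) (\<lambda>y. U 0 y - poly p y) \<le> C * ?R"
        unfolding R by (rule C(2)[OF ac _ L2_diff[OF U0 poly_L2[OF th]] _ U1]) (auto simp: p_def)
      have "C * ?R \<le> B * ?R" "C * ?R + ?R \<le> B * ?R"
        using mult_right_mono[OF B(1), of ?R] mult_right_mono[OF B(4), of ?R] by (auto simp: distrib_right)
      then show ?thesis using ac U1 b R
        by (intro exI[of _ p] exI[of _ "U 1"]) (auto simp: p_def)
    next
      assume m2: "m = 2"
      \<comment> \<open>Taylor polynomial of degree 1 at the point 1; \<open>U 1\<close> is
        continuous here, so its value at 1 is meaningful. The pinned inequality is used twice, first
        for the derivative and then for the residual.\<close>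
      define p where "p = [:U 0 1 - U 1 1, U 1 1:]"
      have "\<theta> + real m - 1 = \<theta> + 1" by (simp add: m2)
      then have R: "?R = sq (lagm (\<theta> + 1)) (U 2)" by (simp only: m2)
      have U1: "U 1 \<in> L2 (lagm \<theta>)" using UL[of 1] m2 by simp
      have U2: "U 2 \<in> L2 (lagm (\<theta> + 1))"
        using UL[of m] unfolding \<open>\<theta> + real m - 1 = \<theta> + 1\<close> by (simp add: m2)
      define g where "g y = U 1 y - U 1 1" for y
      have gL: "g \<in> L2 (lagm \<theta>)"
        using L2_diff[OF U1 poly_L2[OF th, of "[:U 1 1:]"]] by (simp add: g_def[abs_def])
      have acg: "ac_deriv g (U 2)"
        using ac_deriv_minus_const[OF U[of 1], of "U 1 1"] m2 by (simp add: g_def[abs_def] numeral_2_eq_2)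
      have bg: "sq (lagm \<theta>) g \<le> C * ?R" unfolding R
        by (rule C(2)[OF acg _ gL _ U2]) (auto simp: g_def)
      have ac: "ac_deriv (\<lambda>y. U 0 y - poly p y) g"
        using ac_deriv_diff[OF U[of 0] poly_ac_deriv[of p]] m2 by (simp add: p_def g_def[abs_def] pderiv_pCons)
      have "sq (lagm \<theta>) (\<lambda>y. U 0 y - poly p y) \<le> C * sq (lagm \<theta>) g"
        by (rule C(2)[OF ac _ L2_diff[OF U0 poly_L2[OF th]] _ gL]) (auto simp: p_def)
      also have "\<dots> \<le> C * (C * ?R)" using bg C(1) by (intro mult_left_mono) auto
      finally have b: "sq (lagm \<theta>) (\<lambda>y. U 0 y - poly p y) \<le> C * C * ?R" by simp
      have "C * C * ?R \<le> B * ?R" "C * C * ?R + C * ?R \<le> B * ?R"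
        using mult_right_mono[OF B(2), of ?R] mult_right_mono[OF B(3), of ?R] by (auto simp: distrib_right)
      then show ?thesis using ac gL b bg
        by (intro exI[of _ p] exI[of _ g]) (auto simp: p_def)
    qed
    then obtain p v' where p: "degree p < 2" "ac_deriv (\<lambda>y. U 0 y - poly p y) v'" "U 0 1 - poly p 1 = 0" "v' \<in> L2 (lagm \<theta>)"
      "sq (lagm \<theta>) (\<lambda>y. U 0 y - poly p y) \<le> B * ?R" "sq (lagm \<theta>) (\<lambda>y. U 0 y - poly p y) + sq (lagm \<theta>) v' \<le> B * ?R" by blast
    define v where "v = (\<lambda>y. U 0 y - poly p y)"
    have vL: "v \<in> L2 (lagm \<theta>)" unfolding v_def by (rule L2_diff[OF U0 poly_L2[OF th]])
    have "(\<Sum>z\<in>Z. (v z)\<^sup>2 * \<omega> z) \<le> (\<Sum>z\<in>Z. D z * \<omega> z * (B * ?R))"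
    proof (rule sum_mono)
      fix z assume z: "z \<in> Z"
      have "(v z)\<^sup>2 \<le> D z * (sq (lagm \<theta>) v + sq (lagm \<theta>) v')"
        by (rule D[OF z _ _ vL p(4)]) (use p v_def in auto)
      also have "\<dots> \<le> D z * (B * ?R)" using p(6) by (intro mult_left_mono D0[OF z]) (simp add: v_def)
      finally have "(v z)\<^sup>2 * \<omega> z \<le> D z * (B * ?R) * \<omega> z" by (rule mult_right_mono[OF _ weight_nonneg])
      then show "(v z)\<^sup>2 * \<omega> z \<le> D z * \<omega> z * (B * ?R)" by (simp only: mult_ac)
    qed
    also have "\<dots> = E * B * ?R" by (simp add: E_def sum_distrib_right mult.assoc)
    finally have n: "(\<Sum>z\<in>Z. (v z)\<^sup>2 * \<omega> z) \<le> E * B * ?R" .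
    have "sqrt (sq (lagm \<theta>) (\<lambda>y. poly (interp (U 0)) y - U 0 y)) \<le> sqrt (sq (lagm \<theta>) v) + sqrt (\<Sum>z\<in>Z. (v z)\<^sup>2 * \<omega> z)"
      unfolding v_def by (rule interpolation_error_split[OF laguerre_nodes_axioms U0 p(1)])
    also have "\<dots> \<le> sqrt (B * ?R) + sqrt (E * B * ?R)"
      using p(5) n by (intro add_mono real_sqrt_le_mono) (auto simp: v_def)
    also have "\<dots> = F * sqrt ?R" by (simp add: F_def real_sqrt_mult distrib_right)
    finally show ?thesis .
  qed
  show ?thesis
  proof (intro exI[of _ F] conjI allI impI, goal_cases)
    case 1
    show ?case unfolding F_def using B(5) E0 by (intro add_pos_nonneg) auto
  next
    case (2 Z' m U)
    then have "Z' = Z" by (simp add: Z_def)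
    note main' = main[where m = m and U = U, OF 2(2) _ 2(4)]
    show ?case unfolding \<open>Z' = Z\<close>
      by (rule main'; rule 2(3)[rule_format] 2(5)[rule_format]; assumption)
  qed
qed

section \<open>Weak derivatives\<close>

definition flat :: "real poly \<Rightarrow> real \<Rightarrow> real" where
  "flat p x = (if x > 0 then poly p (1 / x) * exp (- (1 / x)) else 0)"

lemma poly_exp_tendsto_0: "((\<lambda>t::real. poly p t * exp (- t)) \<longlongrightarrow> 0) at_top"
proof -
  have "((\<lambda>t. \<Sum>i\<le>degree p. coeff p i * (t ^ i / exp t)) \<longlongrightarrow> (\<Sum>i\<le>degree p. coeff p i * 0)) at_top"
    by (intro tendsto_sum tendsto_mult tendsto_const tendsto_power_div_exp_0)
  then show ?thesis
    by (simp add: poly_altdef sum_distrib_right exp_minus divide_inverse mult.assoc)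
qed

text \<open>Differentiating p(1/x) e^(-1/x) gives x^(-2) (p - p')(1/x) e^(-1/x), so the family is
  closed under differentiation. At 0 the exponential beats every polynomial in 1/x.\<close>

lemma flat_deriv: "(flat p has_real_derivative flat ([:0, 0, 1:] * (p - pderiv p)) x) (at x)"
proof -
  let ?q = "[:0, 0, 1:] * (p - pderiv p)"
  consider "x > 0" | "x < 0" | "x = 0" by linarith
  then show ?thesis
  proof cases
    case 1
    have i: "((\<lambda>x. 1 / x) has_real_derivative - (1 / x\<^sup>2)) (at x)"
      using 1 by (auto intro!: derivative_eq_intros simp: power2_eq_square)
    have "((\<lambda>x. poly p (1 / x) * exp (- (1 / x))) has_real_derivative
        (poly (pderiv p) (1 / x) * - (1 / x\<^sup>2)) * exp (- (1 / x)) + (exp (- (1 / x)) * - (- (1 / x\<^sup>2))) * poly p (1 / x)) (at x)"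
      by (intro DERIV_mult DERIV_chain2[OF poly_DERIV i] DERIV_chain2[OF DERIV_exp] DERIV_minus i)
    then have "((\<lambda>x. poly p (1 / x) * exp (- (1 / x))) has_real_derivative flat ?q x) (at x)"
      by (rule DERIV_cong) (use 1 in \<open>simp add: flat_def power2_eq_square field_simps\<close>)
    then show ?thesis
      by (rule has_field_derivative_transform_within_open[where S="{0<..}"]) (use 1 in \<open>auto simp: flat_def\<close>)
  next
    case 2
    have "((\<lambda>_. 0) has_real_derivative flat ?q x) (at x)" using 2 by (simp add: flat_def)
    then show ?thesis
      by (rule has_field_derivative_transform_within_open[where S="{..<0}"]) (use 2 in \<open>auto simp: flat_def\<close>)
  next
    case 3
    have "((\<lambda>h. flat p h / h) \<longlongrightarrow> 0) (at 0)"
      unfolding filterlim_at_split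
    proof
      have "eventually (\<lambda>h::real. flat p h / h = 0) (at_left 0)"
        by (auto simp: eventually_at_filter flat_def)
      then show "((\<lambda>h. flat p h / h) \<longlongrightarrow> 0) (at_left 0)" by (rule tendsto_eventually)
      have "((\<lambda>h::real. poly ([:0, 1:] * p) (inverse h) * exp (- inverse h)) \<longlongrightarrow> 0) (at_right 0)"
        by (rule filterlim_compose[OF poly_exp_tendsto_0 filterlim_inverse_at_top_right])
      moreover have "eventually (\<lambda>h. poly ([:0, 1:] * p) (inverse h) * exp (- inverse h) = flat p h / h) (at_right (0::real))"
        by (auto simp: eventually_at_filter flat_def divide_inverse)
      ultimately show "((\<lambda>h. flat p h / h) \<longlongrightarrow> 0) (at_right 0)"
        by (rule Lim_transform_eventually)
    qed
    then have "(flat p has_real_derivative 0) (at 0)"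
      unfolding DERIV_def by (simp add: flat_def)
    then show ?thesis using 3 by (simp add: flat_def)
  qed
qed

text \<open>Two flat factors facing each other give bumps supported in a bounded interval. Admitting
  sums makes the class closed under differentiation, so smoothness of every order follows from a
  single derivative rule.\<close>

inductive bump_sum :: "(real \<Rightarrow> real) \<Rightarrow> bool" where
  base: "bump_sum (\<lambda>x. flat p (a * x + b) * flat q (c * x + d))"
| add: "bump_sum f \<Longrightarrow> bump_sum g \<Longrightarrow> bump_sum (\<lambda>x. f x + g x)"

lemma bump_sum_deriv:
  assumes "bump_sum f"
  shows "\<exists>g. bump_sum g \<and> (\<forall>x. (f has_real_derivative g x) (at x))"
  using assms
proof induction
  case (base p a b q c d)
  define p' where "p' = smult a ([:0, 0, 1:] * (p - pderiv p))"
  define q' where "q' = smult c ([:0, 0, 1:] * (q - pderiv q))"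
  have fl: "flat (smult r s) y = r * flat s y" for r s y by (simp add: flat_def)
  have lin: "((\<lambda>x. r * x + s) has_real_derivative r) (at x)" for r s x :: real
    by (auto intro!: derivative_eq_intros)
  have "((\<lambda>x. flat p (a * x + b) * flat q (c * x + d)) has_real_derivative
      (flat ([:0, 0, 1:] * (p - pderiv p)) (a * x + b) * a) * flat q (c * x + d) +
      (flat ([:0, 0, 1:] * (q - pderiv q)) (c * x + d) * c) * flat p (a * x + b)) (at x)" for x
    by (intro DERIV_mult DERIV_chain2[OF flat_deriv lin])
  then have "((\<lambda>x. flat p (a * x + b) * flat q (c * x + d)) has_real_derivative
      flat p' (a * x + b) * flat q (c * x + d) + flat p (a * x + b) * flat q' (c * x + d)) (at x)" for x
    unfolding p'_def q'_def fl by (rule DERIV_cong) (simp add: algebra_simps)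
  then show ?case by (intro exI conjI allI) (rule bump_sum.add[OF bump_sum.base bump_sum.base])
next
  case (add f g)
  then obtain f' g' where "bump_sum f'" "bump_sum g'" "\<And>x. (f has_real_derivative f' x) (at x)" "\<And>x. (g has_real_derivative g' x) (at x)"
    by blast
  then show ?case by (intro exI[of _ "\<lambda>x. f' x + g' x"]) (auto intro: bump_sum.add DERIV_add)
qed

lemma bump_sum_smooth:
  assumes "bump_sum f"
  shows "(deriv ^^ k) f differentiable (at x)"
proof -
  have "bump_sum ((deriv ^^ k) f)"
  proof (induction k)
    case (Suc k)
    then obtain g where g: "bump_sum g" "\<And>x. ((deriv ^^ k) f has_real_derivative g x) (at x)"
      using bump_sum_deriv by blast
    then have "deriv ((deriv ^^ k) f) = g" by (auto intro: DERIV_imp_deriv)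
    then show ?case using g by simp
  qed (use assms in simp)
  then show ?thesis using bump_sum_deriv unfolding real_differentiable_def by blast
qed

lemma bump_sum_continuous: "bump_sum f \<Longrightarrow> continuous_on S f"
  using bump_sum_deriv by (meson DERIV_isCont continuous_at_imp_continuous_on)

text \<open>The vanishing integral brings the primitive back to 0 beyond the support, and its higher
  derivatives are those of \<psi>.\<close>

lemma test_function_primitive:
  assumes psi: "bump_sum \<psi>" and lh: "0 < lo" "lo \<le> hi" and out: "\<And>x. x \<notin> {lo..hi} \<Longrightarrow> \<psi> x = 0"
    and z: "integral {lo..hi} \<psi> = 0"
  shows "\<exists>\<phi>. test_function \<phi> \<and> (\<forall>x. (\<phi> has_real_derivative \<psi> x) (at x)) \<and> (\<forall>x. x \<notin> {lo<..<hi} \<longrightarrow> \<phi> x = 0)"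
proof -
  \<comment> \<open>Starting at \<open>lo - 1\<close> keeps \<open>lo\<close> in the interior, so
    that the derivative there is two-sided.\<close>
  define \<phi> where "\<phi> x = integral {lo - 1..x} \<psi>" for x
  have c: "continuous_on S \<psi>" for S by (rule bump_sum_continuous[OF psi])
  have int: "\<psi> integrable_on {a..b}" for a b by (rule integrable_continuous_real[OF c])
  have low: "\<phi> x = 0" if "x \<le> lo" for x
  proof -
    have "\<psi> lo = 0"
    proof -
      have "((\<lambda>x. \<psi> x) \<longlongrightarrow> \<psi> lo) (at_left lo)"
        using c[of UNIV] by (metis UNIV_I continuous_on_def filterlim_at_split open_UNIV at_within_open)
      moreover have "((\<lambda>x. \<psi> x) \<longlongrightarrow> 0) (at_left lo)"
        by (rule tendsto_eventually) (auto simp: eventually_at_filter out)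
      ultimately show ?thesis using tendsto_unique trivial_limit_at_left_real by blast
    qed
    then have "\<psi> t = 0" if "t \<in> {lo - 1..x}" for t
      using that \<open>x \<le> lo\<close> out[of t] by (cases "t = lo") auto
    then have "integral {lo - 1..x} \<psi> = integral {lo - 1..x} (\<lambda>_. 0)" by (intro integral_cong) auto
    then show ?thesis by (simp add: \<phi>_def)
  qed
  have high: "\<phi> x = 0" if "x \<ge> hi" for x
  proof -
    have "\<phi> x = \<phi> lo + (integral {lo..hi} \<psi> + integral {hi..x} \<psi>)"
      unfolding \<phi>_def using that lh
      by (simp add: Henstock_Kurzweil_Integration.integral_combine int)
    moreover have "integral {hi..x} \<psi> = integral {hi<..x} \<psi>"
      by (rule integral_spike_set) (auto intro: negligible_subset[OF negligible_sing[of hi]])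
    moreover have "integral {hi<..x} \<psi> = integral {hi<..x} (\<lambda>_. 0)" by (intro integral_cong) (auto simp: out)
    ultimately show ?thesis using z low[of lo] by simp
  qed
  have der: "(\<phi> has_real_derivative \<psi> x) (at x)" for x
  proof (cases "x < lo")
    case True
    have "((\<lambda>_. 0) has_real_derivative \<psi> x) (at x)" using out[of x] True by simp
    then show ?thesis
      by (rule has_field_derivative_transform_within_open[where S="{..<lo}"]) (use True low in auto)
  next
    case False
    have "(\<phi> has_real_derivative \<psi> x) (at x within {lo - 1..x + 1})"
      unfolding \<phi>_def by (rule integral_has_real_derivative[OF c]) (use False in auto)
    then show ?thesis using False by (simp add: at_within_Icc_at)
  qed
  have out0: "\<phi> x = 0" if "x \<notin> {lo<..<hi}" for x using that low[of x] high[of x] by (auto simp: not_less)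
  have sub: "{x. \<phi> x \<noteq> 0} \<subseteq> {lo..hi}"
  proof
    fix x assume "x \<in> {x. \<phi> x \<noteq> 0}"
    then have "x \<in> {lo<..<hi}" using out0 by blast
    then show "x \<in> {lo..hi}" by simp
  qed
  have cl: "closure {x. \<phi> x \<noteq> 0} \<subseteq> {lo..hi}" by (rule closure_minimal[OF sub]) simp
  have "test_function \<phi>"
    unfolding test_function_def
  proof (intro conjI allI)
    fix k x
    show "(deriv ^^ k) \<phi> differentiable (at x)"
    proof (cases k)
      case 0
      then show ?thesis using der unfolding real_differentiable_def by auto
    next
      case (Suc j)
      have "deriv \<phi> = \<psi>" using der by (auto intro: DERIV_imp_deriv)
      then have "(deriv ^^ k) \<phi> = (deriv ^^ j) \<psi>" unfolding Suc by (metis funpow_Suc_right o_apply)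
      then show ?thesis using bump_sum_smooth[OF psi] by simp
    qed
    show "compact (closure {x. \<phi> x \<noteq> 0})"
      by (rule compact_Int_closed[of "{lo..hi}" "closure {x. \<phi> x \<noteq> 0}", unfolded Int_absorb1[OF cl]]) auto
    show "closure {x. \<phi> x \<noteq> 0} \<subseteq> {0<..}" using cl lh by auto
  qed
  then show ?thesis using der out0 by blast
qed

section \<open>The lemma of du Bois-Reymond\<close>

lemma ae_zero_of_integrals:
  fixes k :: "real \<Rightarrow> real"
  assumes loc: "\<And>a b. 0 < a \<Longrightarrow> a \<le> b \<Longrightarrow> k absolutely_integrable_on {a..b}"
    and z: "\<And>a b. 0 < a \<Longrightarrow> a < b \<Longrightarrow> integral {a..b} k = 0"
  shows "AE x in lebesgue. x > 0 \<longrightarrow> k x = 0"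
proof -
  have part: "AE x in lebesgue. 1 / real (Suc n) < x \<and> x < real (Suc n) \<longrightarrow> k x = 0" for n
  proof -
    define s where "s = 1 / real (Suc n)"
    define t where "t = real (Suc n)"
    have st: "0 < s" "s \<le> t" by (auto simp: s_def t_def field_simps)
    define f where "f x = (if x \<in> {s..t} then k x else 0)" for x
    have "f integrable_on cbox a b" for a b
      unfolding f_def
      using set_lebesgue_integral_eq_integral(1)[OF set_integrable_subset[OF loc[OF st], of "{s..t} \<inter> cbox a b"]]
      by (subst integrable_restrict_Int) auto
    \<comment> \<open>Lebesgue differentiation, applied after cutting \<open>k\<close> off to a
      compact interval so that it is integrable on every box.\<close>
    then obtain N where N: "negligible N" "\<And>x e. x \<notin> N \<Longrightarrow> 0 < e \<Longrightarrow>
        \<exists>d>0. \<forall>h. 0 < h \<and> h < d \<longrightarrow> norm (integral (cbox x (x + h *\<^sub>R One)) f /\<^sub>R h ^ DIM(real) - f x) < e"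
      using integrable_ccontinuous_explicit[of f] by blast
    have "k x = 0" if x: "x \<notin> N" "s < x" "x < t" for x
    proof (rule ccontr)
      assume "k x \<noteq> 0"
      then obtain d where d: "d > 0" "\<And>h. 0 < h \<Longrightarrow> h < d \<Longrightarrow> norm (integral (cbox x (x + h *\<^sub>R One)) f /\<^sub>R h ^ DIM(real) - f x) < \<bar>k x\<bar>"
        using N(2)[OF x(1), of "\<bar>k x\<bar>"] by auto
      define h where "h = min (d / 2) ((t - x) / 2)"
      have h: "0 < h" "h < d" "x + h < t" using d(1) x by (auto simp: h_def min_def field_simps)
      have "integral {x..x + h} f = integral {x..x + h} k"
        by (rule integral_cong) (use x h in \<open>auto simp: f_def\<close>)
      also have "\<dots> = 0" by (rule z) (use x st h in auto)
      finally show False using d(2)[OF h(1,2)] x by (simp add: f_def)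
    qed
    then have "{x \<in> space lebesgue. \<not> (s < x \<and> x < t \<longrightarrow> k x = 0)} \<subseteq> N" by auto
    then show ?thesis
      using N(1) unfolding s_def t_def negligible_iff_null_sets by (rule AE_I'[rotated])
  qed
  then have "AE x in lebesgue. \<forall>n. 1 / real (Suc n) < x \<and> x < real (Suc n) \<longrightarrow> k x = 0"
    by (subst AE_all_countable) blast
  then show ?thesis
  proof eventually_elim
    case (elim x)
    show ?case
    proof
      assume x: "x > 0"
      obtain n :: nat where n: "real n > x" "real n > 1 / x" using reals_Archimedean2[of "max x (1/x)"] by auto
      have "1 / real (Suc n) < x" using n x by (simp add: field_simps)
      moreover have "x < real (Suc n)" using n by simp
      ultimately show "k x = 0" using elim by blast
    qed
  qed
qed

lemma set_integral_support:
  fixes f :: "real \<Rightarrow> real"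
  assumes "0 < lo" "\<And>x. x \<notin> {lo..hi} \<Longrightarrow> f x = 0" "f absolutely_integrable_on {lo..hi}"
  shows "(LINT x:{0<..}|lebesgue. f x) = integral {lo..hi} f"
proof -
  have "(LINT x:{0<..}|lebesgue. f x) = (LINT x:{lo..hi}|lebesgue. f x)"
    unfolding set_lebesgue_integral_def
    by (rule Bochner_Integration.integral_cong) (use assms(1,2) in \<open>auto simp: indicator_def\<close>)
  then show ?thesis using set_lebesgue_integral_eq_integral(2)[OF assms(3)] by simp
qed

text \<open>With \<open>U\<close> a primitive of \<open>g\<close>, the difference
  \<open>h = u - U\<close> annihilates all derivatives of test functions, hence all bumps of mean
  zero. Correcting the mean by a reference bump shows that \<open>h - c\<close> annihilates every
  bump, and bumps approximate indicators of intervals.\<close>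

lemma weak_deriv_ac_deriv:
  assumes w: "has_weak_deriv u g"
  shows "\<exists>U. ac_deriv U g \<and> (AE x in lebesgue. x > 0 \<longrightarrow> u x = U x)"
proof -
  have ul: "u absolutely_integrable_on {a..b}" and gl: "g absolutely_integrable_on {a..b}" if "0 < a" for a b
  proof -
    have "compact {a..b}" "{a..b} \<subseteq> {0<..}" using that by auto
    then show "u absolutely_integrable_on {a..b}" "g absolutely_integrable_on {a..b}"
      using w unfolding has_weak_deriv_def locally_integrable_def by blast+
  qed
  define U where "U x = (if x \<ge> 1 then integral {1..x} g else - integral {x..1} g)" for x
  have gi: "g integrable_on {a..b}" if "0 < a" for a b
    using gl[OF that] by (rule set_lebesgue_integral_eq_integral(1))
  have U: "ac_deriv U g"
    unfolding ac_deriv_def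
  proof (intro allI impI conjI)
    fix a b :: real assume ab: "0 < a" "a \<le> b"
    show "g absolutely_integrable_on {a..b}" by (rule gl[OF ab(1)])
    note c = Henstock_Kurzweil_Integration.integral_combine[where f=g]
    consider "1 \<le> a" | "a < 1" "1 \<le> b" | "b < 1" by linarith
    then show "U b - U a = integral {a..b} g"
    proof cases
      case 1
      then show ?thesis using c[of 1 a b] ab gi[of 1 b] by (simp add: U_def)
    next
      case 2
      then show ?thesis using c[of a 1 b] ab gi[of a b] by (simp add: U_def)
    next
      case 3
      then show ?thesis using c[of a b 1] ab gi[of a 1] by (simp add: U_def)
    qed
  qed
  have cU: "continuous_on {0<..} U" by (rule ac_deriv_continuous[OF U])
  define h where "h x = u x - U x" for x
  have hl: "h absolutely_integrable_on {a..b}" if "0 < a" for a b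
    unfolding h_def
    by (intro set_integral_diff(1) ul that absolutely_integrable_continuous_real continuous_on_subset[OF cU])
       (use that in auto)
  have key: "integral {lo..hi} (\<lambda>x. h x * \<psi> x) = 0"
    if psi: "bump_sum \<psi>" and lh: "0 < lo" "lo \<le> hi" and out: "\<And>x. x \<notin> {lo..hi} \<Longrightarrow> \<psi> x = 0"
      and z: "integral {lo..hi} \<psi> = 0" for \<psi> lo hi
  proof -
    obtain \<phi> where \<phi>: "test_function \<phi>" "\<And>x. (\<phi> has_real_derivative \<psi> x) (at x)" "\<And>x. x \<notin> {lo<..<hi} \<Longrightarrow> \<phi> x = 0"
      using test_function_primitive[OF psi lh out z] by blast
    have d: "deriv \<phi> = \<psi>" using \<phi>(2) by (auto intro: DERIV_imp_deriv)
    have ac: "ac_deriv \<phi> \<psi>" by (rule ac_deriv_C1[OF \<phi>(2) bump_sum_continuous[OF psi]])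
    have cphi: "continuous_on S \<phi>" for S using \<phi>(2) by (meson DERIV_isCont continuous_at_imp_continuous_on)
    have cpsi: "continuous_on S \<psi>" for S by (rule bump_sum_continuous[OF psi])
    have i1: "(\<lambda>x. u x * \<psi> x) absolutely_integrable_on {lo..hi}"
      by (rule abs_int_mult_continuous[OF ul[OF lh(1)] cpsi])
    have i2: "(\<lambda>x. g x * \<phi> x) absolutely_integrable_on {lo..hi}"
      by (rule abs_int_mult_continuous[OF gl[OF lh(1)] cphi])
    have i3: "(\<lambda>x. U x * \<psi> x) absolutely_integrable_on {lo..hi}"
      by (intro absolutely_integrable_continuous_real continuous_intros cpsi continuous_on_subset[OF cU]) (use lh in auto)
    have "(LINT x:{0<..}|lebesgue. u x * deriv \<phi> x) = - (LINT x:{0<..}|lebesgue. g x * \<phi> x)"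
      using w \<phi>(1) unfolding has_weak_deriv_def by blast
    moreover have "(LINT x:{0<..}|lebesgue. u x * deriv \<phi> x) = integral {lo..hi} (\<lambda>x. u x * \<psi> x)"
      unfolding d by (rule set_integral_support[OF lh(1) _ i1]) (simp add: out)
    moreover have "(LINT x:{0<..}|lebesgue. g x * \<phi> x) = integral {lo..hi} (\<lambda>x. g x * \<phi> x)"
      by (rule set_integral_support[OF lh(1) _ i2]) (auto intro: \<phi>(3))
    ultimately have 1: "integral {lo..hi} (\<lambda>x. u x * \<psi> x) = - integral {lo..hi} (\<lambda>x. g x * \<phi> x)" by simp
    have "integral {lo..hi} (\<lambda>x. g x * \<phi> x + U x * \<psi> x) = 0"
      using ac_derivD(2)[OF ac_deriv_mult[OF U ac] lh] \<phi>(3)[of lo] \<phi>(3)[of hi] by simp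
    then have 2: "integral {lo..hi} (\<lambda>x. g x * \<phi> x) + integral {lo..hi} (\<lambda>x. U x * \<psi> x) = 0"
      using integral_add[OF set_lebesgue_integral_eq_integral(1)[OF i2] set_lebesgue_integral_eq_integral(1)[OF i3]] by simp
    have "integral {lo..hi} (\<lambda>x. h x * \<psi> x) = integral {lo..hi} (\<lambda>x. u x * \<psi> x) - integral {lo..hi} (\<lambda>x. U x * \<psi> x)"
      unfolding h_def left_diff_distrib
      by (rule integral_diff[OF set_lebesgue_integral_eq_integral(1)[OF i1] set_lebesgue_integral_eq_integral(1)[OF i3]])
    then show ?thesis using 1 2 by simp
  qed
  \<comment> \<open>The reference bump, supported in [1, 2], used to cancel means.\<close>
  define \<psi>0 where "\<psi>0 x = flat 1 (1 * x + (- 1)) * flat 1 (- 1 * x + 2)" for x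
  have b0: "bump_sum \<psi>0" unfolding \<psi>0_def by (rule bump_sum.base)
  have out0: "\<psi>0 x = 0" if "x \<notin> {1..2}" for x using that by (auto simp: \<psi>0_def flat_def)
  have pos0: "integral {1..2} \<psi>0 > 0"
  proof -
    have ge: "\<psi>0 x \<ge> 0" for x by (simp add: \<psi>0_def flat_def)
    have "integral {1..2} \<psi>0 \<noteq> 0"
    proof
      assume "integral {1..2} \<psi>0 = 0"
      then have "\<psi>0 (3/2) = 0"
        using integral_eq_0_iff[of 1 2 \<psi>0] ge bump_sum_continuous[OF b0] by simp
      then show False by (simp add: \<psi>0_def flat_def)
    qed
    moreover have "integral {1..2} \<psi>0 \<ge> 0"
      by (rule integral_nonneg[OF integrable_continuous_real[OF bump_sum_continuous[OF b0]]]) (use ge in auto)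
    ultimately show ?thesis by simp
  qed
  \<comment> \<open>The only possible constant value of \<open>h\<close>, found by testing against
    the reference bump.\<close>
  define c where "c = integral {1..2} (\<lambda>x. h x * \<psi>0 x) / integral {1..2} \<psi>0"
  have hc: "(\<lambda>x. h x - c) absolutely_integrable_on {a..b}" if "0 < a" for a b
    by (intro set_integral_diff(1) hl that absolutely_integrable_continuous_real continuous_intros)
  have zero: "integral {a..b} (\<lambda>x. h x - c) = 0" if ab: "0 < a" "a < b" for a b
  proof -
    define lo where "lo = min a 1"
    define hi where "hi = max b 2"
    have lh: "0 < lo" "lo \<le> hi" using ab by (auto simp: lo_def hi_def)
    have restrict: "integral {lo..hi} f = integral {s..t} f"
      if "lo \<le> s" "t \<le> hi" "\<And>x. x \<notin> {s..t} \<Longrightarrow> f x = 0" for f :: "real \<Rightarrow> real" and s t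
    proof -
      have "integral {lo..hi} f = integral {lo..hi} (\<lambda>x. if x \<in> {s..t} then f x else 0)"
        by (intro integral_cong) (use that in auto)
      also have "\<dots> = integral ({s..t} \<inter> {lo..hi}) f" by (rule integral_restrict_Int)
      also have "{s..t} \<inter> {lo..hi} = {s..t}" using that by auto
      finally show ?thesis .
    qed
    \<comment> \<open>Bumps supported in (a, b) and bounded by 1, which tend to the indicator of (a,
      b) as the slopes grow.\<close>
    define \<psi> where "\<psi> n x = flat 1 (real (Suc n) * x + - real (Suc n) * a) * flat 1 (- real (Suc n) * x + real (Suc n) * b)" for n x
    have psi_alt: "\<psi> n x = flat 1 (real (Suc n) * (x - a)) * flat 1 (real (Suc n) * (b - x))" for n x
      by (simp add: \<psi>_def algebra_simps)
    have bn: "bump_sum (\<psi> n)" for n unfolding \<psi>_def by (rule bump_sum.base)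
    have outn: "\<psi> n x = 0" if "x \<notin> {a<..<b}" for n x
      using that by (auto simp: psi_alt flat_def zero_less_mult_iff not_less)
    have zn: "integral {lo..hi} (\<lambda>x. (h x - c) * \<psi> n x) = 0" for n
    proof -
      \<comment> \<open>\<open>k\<close> makes the mean of \<eta> vanish. The factor
        \<open>- k\<close> is written inside \<open>flat\<close> so that \<eta> matches the
        generators of \<open>bump_sum\<close>.\<close>
      define k where "k = integral {lo..hi} (\<psi> n) / integral {1..2} \<psi>0"
      define \<eta> where "\<eta> x = \<psi> n x + flat (smult (- k) 1) (1 * x + (- 1)) * flat 1 (- 1 * x + 2)" for x
      have chi: "\<eta> x = \<psi> n x - k * \<psi>0 x" for x by (simp add: \<eta>_def \<psi>0_def flat_def)
      have "bump_sum \<eta>" unfolding \<eta>_def by (intro bump_sum.add bn bump_sum.base)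
      moreover have out: "\<eta> x = 0" if "x \<notin> {lo..hi}" for x
      proof -
        have "x \<notin> {a<..<b}" "x \<notin> {1..2}" using that by (auto simp: lo_def hi_def)
        then show ?thesis using outn[of x n] out0[of x] by (simp add: chi)
      qed
      moreover have i: "\<psi> n integrable_on {lo..hi}" "\<psi>0 integrable_on {lo..hi}"
        by (intro integrable_continuous_real bump_sum_continuous bn b0)+
      moreover have r0: "integral {lo..hi} \<psi>0 = integral {1..2} \<psi>0"
        by (rule restrict) (auto simp: lo_def hi_def out0)
      moreover have "integral {lo..hi} \<eta> = 0"
        unfolding chi using i r0 pos0 by (subst integral_diff) (auto intro: integrable_on_mult_right simp: k_def)
      ultimately have "integral {lo..hi} (\<lambda>x. h x * \<eta> x) = 0" using key[OF _ lh] by blast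
      moreover have ih: "(\<lambda>x. h x * \<psi> n x) integrable_on {lo..hi}" "(\<lambda>x. h x * \<psi>0 x) integrable_on {lo..hi}"
        by (intro set_lebesgue_integral_eq_integral(1) abs_int_mult_continuous hl lh bump_sum_continuous bn b0)+
      moreover have "integral {lo..hi} (\<lambda>x. h x * \<eta> x) = integral {lo..hi} (\<lambda>x. h x * \<psi> n x - k * (h x * \<psi>0 x))"
        by (intro integral_cong) (simp add: chi algebra_simps)
      moreover have "\<dots> = integral {lo..hi} (\<lambda>x. h x * \<psi> n x) - k * integral {lo..hi} (\<lambda>x. h x * \<psi>0 x)"
        using ih by (subst integral_diff) (auto intro: integrable_on_mult_right)
      moreover have "integral {lo..hi} (\<lambda>x. h x * \<psi>0 x) = integral {1..2} (\<lambda>x. h x * \<psi>0 x)"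
        by (rule restrict) (auto simp: lo_def hi_def out0)
      ultimately have "integral {lo..hi} (\<lambda>x. h x * \<psi> n x) = k * integral {1..2} (\<lambda>x. h x * \<psi>0 x)" by simp
      also have "\<dots> = c * integral {lo..hi} (\<psi> n)" using pos0 by (simp add: k_def c_def)
      finally have "integral {lo..hi} (\<lambda>x. h x * \<psi> n x) - integral {lo..hi} (\<lambda>x. c * \<psi> n x) = 0" by simp
      then show ?thesis
        using integral_diff[OF ih(1) integrable_on_mult_right[OF i(1), of c]] by (simp add: left_diff_distrib)
    qed
    have le1: "\<bar>flat 1 y\<bar> \<le> 1" for y by (simp add: flat_def)
    have lim: "(\<lambda>n. flat 1 (real (Suc n) * y)) \<longlonglongrightarrow> 1" if y: "y > 0" for y
    proof -
      have "(\<lambda>n. exp (- (1 / real (Suc n) * (1 / y)))) \<longlonglongrightarrow> exp (- (0 * (1 / y)))"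
        by (intro tendsto_intros LIMSEQ_Suc[OF lim_1_over_n])
      moreover have "exp (- (1 / real (Suc n) * (1 / y))) = flat 1 (real (Suc n) * y)" for n
        using y by (simp add: flat_def)
      ultimately show ?thesis by simp
    qed
    have "(\<lambda>n. LINT x|lebesgue. indicator {lo..hi} x *\<^sub>R ((h x - c) * \<psi> n x)) \<longlonglongrightarrow>
        (LINT x|lebesgue. indicator {a<..<b} x *\<^sub>R (h x - c))"
    proof (rule integral_dominated_convergence[where w = "\<lambda>x. norm (indicator {lo..hi} x *\<^sub>R (h x - c))"])
      have "(\<lambda>x. h x - c) absolutely_integrable_on {a<..<b}"
        by (rule set_integrable_subset[OF hc[OF ab(1), of b]]) auto
      then show "(\<lambda>x. indicator {a<..<b} x *\<^sub>R (h x - c)) \<in> borel_measurable lebesgue"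
        unfolding set_integrable_def by (rule borel_measurable_integrable)
      have "(\<lambda>x. (h x - c) * \<psi> n x) absolutely_integrable_on {lo..hi}" for n
        by (rule abs_int_mult_continuous[OF hc[OF lh(1)] bump_sum_continuous[OF bn]])
      then show "(\<lambda>x. indicator {lo..hi} x *\<^sub>R ((h x - c) * \<psi> n x)) \<in> borel_measurable lebesgue" for n
        unfolding set_integrable_def by (rule borel_measurable_integrable)
      show "integrable lebesgue (\<lambda>x. norm (indicator {lo..hi} x *\<^sub>R (h x - c)))"
        using hc[OF lh(1), of hi] unfolding set_integrable_def by (rule integrable_norm)
      show "AE x in lebesgue. norm (indicator {lo..hi} x *\<^sub>R ((h x - c) * \<psi> n x)) \<le> norm (indicator {lo..hi} x *\<^sub>R (h x - c))" for n
      proof (rule AE_I2)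
        fix x
        have "\<bar>\<psi> n x\<bar> \<le> 1 * 1" unfolding psi_alt abs_mult by (intro mult_mono le1) auto
        then have "\<bar>h x - c\<bar> * \<bar>\<psi> n x\<bar> \<le> \<bar>h x - c\<bar> * 1" by (intro mult_left_mono) auto
        then show "norm (indicator {lo..hi} x *\<^sub>R ((h x - c) * \<psi> n x)) \<le> norm (indicator {lo..hi} x *\<^sub>R (h x - c))"
          by (simp add: abs_mult indicator_def)
      qed
      show "AE x in lebesgue. (\<lambda>n. indicator {lo..hi} x *\<^sub>R ((h x - c) * \<psi> n x)) \<longlonglongrightarrow> indicator {a<..<b} x *\<^sub>R (h x - c)"
      proof (rule AE_I2)
        fix x
        show "(\<lambda>n. indicator {lo..hi} x *\<^sub>R ((h x - c) * \<psi> n x)) \<longlonglongrightarrow> indicator {a<..<b} x *\<^sub>R (h x - c)"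
        proof (cases "x \<in> {a<..<b}")
          case True
          then have "(\<lambda>n. \<psi> n x) \<longlonglongrightarrow> 1 * 1"
            unfolding psi_alt by (intro tendsto_mult lim) auto
          then have "(\<lambda>n. 1 *\<^sub>R ((h x - c) * \<psi> n x)) \<longlonglongrightarrow> 1 *\<^sub>R ((h x - c) * (1 * 1))"
            by (intro tendsto_intros)
          moreover have "x \<in> {lo..hi}" using True by (auto simp: lo_def hi_def)
          ultimately show ?thesis using True by simp
        next
          case False
          then show ?thesis using outn[OF False] by simp
        qed
      qed
    qed
    moreover have "(LINT x|lebesgue. indicator {lo..hi} x *\<^sub>R ((h x - c) * \<psi> n x)) = 0" for n
      using set_lebesgue_integral_eq_integral(2)[OF abs_int_mult_continuous[OF hc[OF lh(1)] bump_sum_continuous[OF bn]], of hi n] zn[of n]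
      unfolding set_lebesgue_integral_def by simp
    ultimately have "(LINT x|lebesgue. indicator {a<..<b} x *\<^sub>R (h x - c)) = 0"
      by (simp only: LIMSEQ_const_iff)
    moreover have "(\<lambda>x. h x - c) absolutely_integrable_on {a<..<b}"
      by (rule set_integrable_subset[OF hc[OF ab(1), of b]]) auto
    ultimately have "integral {a<..<b} (\<lambda>x. h x - c) = 0"
      using set_lebesgue_integral_eq_integral(2) unfolding set_lebesgue_integral_def by metis
    then show ?thesis by (simp only: integral_open_interval_real)
  qed
  have "AE x in lebesgue. x > 0 \<longrightarrow> h x - c = 0"
    by (rule ae_zero_of_integrals[OF hc zero])
  then have "AE x in lebesgue. x > 0 \<longrightarrow> u x = U x - (- c)"
    by eventually_elim (auto simp: h_def)
  then show ?thesis using ac_deriv_minus_const[OF U, of "- c"] by blast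
qed

lemma continuous_AE_eq:
  fixes f g :: "real \<Rightarrow> real"
  assumes "continuous_on {0<..} f" "continuous_on {0<..} g" "AE x in lebesgue. x > 0 \<longrightarrow> f x = g x" "x > 0"
  shows "f x = g x"
proof (rule ccontr)
  assume ne: "f x \<noteq> g x"
  let ?S = "{y \<in> {0<..}. f y - g y \<in> - {0}}"
  have "continuous_on {0<..} (\<lambda>y. f y - g y)" by (intro continuous_intros assms)
  then have "open ((\<lambda>y. f y - g y) -` (- {0}) \<inter> {0<..})"
    by (rule continuous_on_open_vimage[THEN iffD1, rule_format, rotated]) auto
  moreover have "(\<lambda>y. f y - g y) -` (- {0}) \<inter> {0<..} = ?S" by auto
  ultimately have op: "open ?S" by simp
  moreover have "?S \<noteq> {}" using ne assms(4) by auto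
  ultimately have "\<not> negligible ?S" by (rule open_not_negligible)
  moreover have "negligible ?S"
  proof -
    have "{y \<in> space lebesgue. \<not> (y > 0 \<longrightarrow> f y = g y)} = ?S" by auto
    moreover have "?S \<in> sets lebesgue" using op by auto
    ultimately show ?thesis
      using assms(3) AE_iff_null_sets[of ?S lebesgue] unfolding negligible_iff_null_sets
      by (auto elim!: eventually_mono)
  qed
  ultimately show False by simp
qed

section \<open>Change of variables\<close>

lemma AE_pos_negligible:
  fixes f g :: "real \<Rightarrow> real"
  assumes "AE x in lebesgue. x > 0 \<longrightarrow> f x = g x"
  shows "\<exists>N. negligible N \<and> (\<forall>x. x \<notin> N \<longrightarrow> x > 0 \<longrightarrow> f x = g x)"
  using assms by (rule AE_E3) (auto simp: negligible_iff_null_sets)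

lemma ac_deriv_cong_AE:
  assumes u: "ac_deriv u g" and eq: "\<And>x. x > 0 \<Longrightarrow> u x = u' x" and ae: "AE x in lebesgue. x > 0 \<longrightarrow> g x = g' x"
  shows "ac_deriv u' g'"
proof -
  obtain N where N: "\<And>x. x \<notin> N \<Longrightarrow> x > 0 \<Longrightarrow> g x = g' x" "negligible N"
    using AE_pos_negligible[OF ae] by blast
  show ?thesis
    unfolding ac_deriv_def
  proof (intro allI impI conjI)
    fix a b :: real assume ab: "0 < a" "a \<le> b"
    have e: "g' x = g x" if "x \<in> {a..b} - N" for x using N(1) that ab by auto
    show "g' absolutely_integrable_on {a..b}"
      by (rule absolutely_integrable_spike[OF ac_derivD(1)[OF u ab] N(2) e])
    have "integral {a..b} g' = integral {a..b} g" by (rule integral_spike[OF N(2)]) (use e in auto)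
    then show "u' b - u' a = integral {a..b} g'" using ac_derivD(2)[OF u ab] eq ab by simp
  qed
qed

lemma set_integrable_AE_pos:
  fixes f g :: "real \<Rightarrow> real"
  assumes f: "set_integrable lebesgue {0<..} f" and ae: "AE x in lebesgue. x > 0 \<longrightarrow> f x = g x"
  shows "set_integrable lebesgue {0<..} g"
proof -
  obtain N where N: "\<And>x. x \<notin> N \<Longrightarrow> x > 0 \<Longrightarrow> f x = g x" "negligible N"
    using AE_pos_negligible[OF ae] by blast
  show ?thesis by (rule absolutely_integrable_spike[OF f N(2)]) (use N(1) in auto)
qed

text \<open>The mapped derivative is differentiation divided by \<open>Y'\<close>, that is, plain
  differentiation with respect to y = \<open>Y x\<close>; \<open>X\<close> is the inverse
  substitution.\<close>

locale mapping =
  fixes \<beta> \<gamma> :: real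
  assumes beta: "-1 < \<beta>" and gamma: "0 < \<gamma>"
begin

definition Y :: "real \<Rightarrow> real" where "Y x = (\<beta> + 1) * x powr \<gamma>"
definition X :: "real \<Rightarrow> real" where "X y = (y / (\<beta> + 1)) powr (1 / \<gamma>)"
definition Y' :: "real \<Rightarrow> real" where "Y' x = (\<beta> + 1) * \<gamma> * x powr (\<gamma> - 1)"

lemma X_pos: "y > 0 \<Longrightarrow> X y > 0" and Y_pos: "x > 0 \<Longrightarrow> Y x > 0" and Y'_pos: "x > 0 \<Longrightarrow> Y' x > 0"
  using beta gamma by (auto simp: X_def Y_def Y'_def)

lemma X_Y: "x > 0 \<Longrightarrow> X (Y x) = x"
  using beta gamma by (simp add: X_def Y_def powr_powr)

lemma Y_X: "y > 0 \<Longrightarrow> Y (X y) = y"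
  using beta gamma by (simp add: X_def Y_def powr_powr)

lemma Y_deriv: "x > 0 \<Longrightarrow> (Y has_real_derivative Y' x) (at x within S)"
  unfolding Y_def Y'_def using beta gamma
  by (auto intro!: derivative_eq_intros has_real_derivative_powr[THEN DERIV_subset] simp: powr_diff)

lemma X_mono: "0 < a \<Longrightarrow> a \<le> b \<Longrightarrow> X a \<le> X b"
  unfolding X_def using beta gamma by (intro powr_mono2 divide_right_mono) auto

lemma Y_mono: "0 < a \<Longrightarrow> a \<le> b \<Longrightarrow> Y a \<le> Y b"
  unfolding Y_def using beta gamma by (intro mult_left_mono powr_mono2) auto

lemma inj_Y: "inj_on Y {0<..}"
  by (rule inj_on_inverseI[of _ X]) (simp add: X_Y)

lemma image_Y_pos: "Y ` {0<..} = {0<..}"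
proof
  show "{0<..} \<subseteq> Y ` {0<..}"
  proof
    fix y :: real assume "y \<in> {0<..}"
    then show "y \<in> Y ` {0<..}" using Y_X[of y] X_pos[of y] by (intro image_eqI[of _ _ "X y"]) auto
  qed
qed (auto simp: Y_pos)

lemma image_Y_Icc:
  assumes "0 < a" "a \<le> b"
  shows "Y ` {X a..X b} = {a..b}"
proof
  show "{a..b} \<subseteq> Y ` {X a..X b}"
  proof
    fix y assume "y \<in> {a..b}"
    then show "y \<in> Y ` {X a..X b}" using Y_X[of y] X_mono[of a y] X_mono[of y b] assms
      by (intro image_eqI[of _ _ "X y"]) auto
  qed
  show "Y ` {X a..X b} \<subseteq> {a..b}"
  proof
    fix y assume "y \<in> Y ` {X a..X b}"
    then obtain x where x: "y = Y x" "X a \<le> x" "x \<le> X b" by auto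
    have p: "X a > 0" using X_pos[OF assms(1)] .
    have "b > 0" using assms by simp
    then show "y \<in> {a..b}"
      using Y_mono[of "X a" x] Y_mono[of x "X b"] x p Y_X[OF assms(1)] Y_X[of b] by auto
  qed
qed

text \<open>A chain rule obtained by changing variables in the integral identity, since
  \<open>g\<close> is meaningful only up to null sets.\<close>

lemma ac_deriv_mapping:
  assumes u: "ac_deriv u g"
  shows "ac_deriv (\<lambda>y. u (X y)) (\<lambda>y. g (X y) / Y' (X y))"
  unfolding ac_deriv_def
proof (intro allI impI)
  fix a b :: real assume ab: "0 < a" "a \<le> b"
  let ?S = "{X a..X b}" and ?h = "\<lambda>y. g (X y) / Y' (X y)"
  have Xab: "0 < X a" "X a \<le> X b" using X_pos[OF ab(1)] X_mono[OF ab] by auto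
  have "(\<lambda>x. \<bar>Y' x\<bar> * ?h (Y x)) absolutely_integrable_on ?S \<and> integral ?S (\<lambda>x. \<bar>Y' x\<bar> * ?h (Y x)) = u (X b) - u (X a)
      \<longleftrightarrow> ?h absolutely_integrable_on Y ` ?S \<and> integral (Y ` ?S) ?h = u (X b) - u (X a)"
  proof (rule has_absolute_integral_change_of_variables_1')
    show "(Y has_real_derivative Y' x) (at x within ?S)" if "x \<in> ?S" for x
      using that Xab by (intro Y_deriv) auto
    show "inj_on Y ?S" by (rule inj_on_subset[OF inj_Y]) (use Xab in auto)
  qed auto
  moreover have e: "g x = \<bar>Y' x\<bar> * ?h (Y x)" if "x \<in> ?S" for x
  proof -
    have "x > 0" using that Xab by auto
    then show ?thesis using Y'_pos[of x] by (simp add: X_Y)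
  qed
  then have "(\<lambda>x. \<bar>Y' x\<bar> * ?h (Y x)) absolutely_integrable_on ?S" "integral ?S (\<lambda>x. \<bar>Y' x\<bar> * ?h (Y x)) = u (X b) - u (X a)"
  proof -
    have "g absolutely_integrable_on ?S \<longleftrightarrow> (\<lambda>x. \<bar>Y' x\<bar> * ?h (Y x)) absolutely_integrable_on ?S"
      by (rule set_integrable_cong[OF refl refl]) (rule e)
    then show "(\<lambda>x. \<bar>Y' x\<bar> * ?h (Y x)) absolutely_integrable_on ?S"
      using ac_derivD(1)[OF u Xab] by blast
    have "integral ?S g = integral ?S (\<lambda>x. \<bar>Y' x\<bar> * ?h (Y x))"
      by (rule integral_cong) (rule e)
    then show "integral ?S (\<lambda>x. \<bar>Y' x\<bar> * ?h (Y x)) = u (X b) - u (X a)"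
      using ac_derivD(2)[OF u Xab] by (simp only:)
  qed
  ultimately show "?h absolutely_integrable_on {a..b} \<and> u (X b) - u (X a) = integral {a..b} ?h"
    using image_Y_Icc[OF ab] by simp
qed

text \<open>The Jacobian \<open>Y'\<close> is built into the weight, so the substitution is an
  isometry onto the Laguerre-weighted space with the same index.\<close>

lemma gl_weight_eq:
  assumes "x > 0"
  shows "gl_weight r \<beta> \<gamma> x = Y' x * wt r (Y x)"
proof -
  have c: "\<beta> + 1 > 0" using beta by simp
  have "wt r (Y x) = (\<beta> + 1) powr r * x powr (\<gamma> * r) * exp (- (\<beta> + 1) * x powr \<gamma>)"
  proof -
    have "Y x powr r = (\<beta> + 1) powr r * x powr (\<gamma> * r)"
      using c assms by (simp add: Y_def powr_mult powr_powr)
    moreover have "- Y x = - (\<beta> + 1) * x powr \<gamma>" by (simp only: Y_def minus_mult_left)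
    ultimately show ?thesis by (simp only: wt_def)
  qed
  moreover have "x powr (\<gamma> * (r + 1) - 1) = x powr (\<gamma> - 1) * x powr (\<gamma> * r)"
    by (simp add: powr_add[symmetric] algebra_simps)
  moreover have "(\<beta> + 1) powr (r + 1) = (\<beta> + 1) * (\<beta> + 1) powr r"
    using c by (simp add: powr_add)
  ultimately show ?thesis by (simp only: gl_weight_def Y'_def mult_ac)
qed

text \<open>Integrability and value are coupled in one equivalence because it is applied in both
  directions: to carry membership over to y and to carry norms back to x.\<close>

lemma change_of_variables_weight:
  assumes f: "\<And>y. y > 0 \<Longrightarrow> f (X y) = h y"
  shows "(\<lambda>x. \<bar>f x\<bar>\<^sup>2 * gl_weight r \<beta> \<gamma> x) absolutely_integrable_on {0<..} \<and>
      integral {0<..} (\<lambda>x. \<bar>f x\<bar>\<^sup>2 * gl_weight r \<beta> \<gamma> x) = I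
    \<longleftrightarrow> (\<lambda>y. wt r y * (h y)\<^sup>2) absolutely_integrable_on {0<..} \<and> integral {0<..} (\<lambda>y. wt r y * (h y)\<^sup>2) = I"
proof -
  let ?k = "\<lambda>y. wt r y * (h y)\<^sup>2"
  have e: "\<bar>f x\<bar>\<^sup>2 * gl_weight r \<beta> \<gamma> x = \<bar>Y' x\<bar> * ?k (Y x)" if "x \<in> {0<..}" for x
    using that Y'_pos[of x] f[OF Y_pos[of x]] by (simp add: X_Y gl_weight_eq)
  have "(\<lambda>x. \<bar>Y' x\<bar> * ?k (Y x)) absolutely_integrable_on {0<..} \<and> integral {0<..} (\<lambda>x. \<bar>Y' x\<bar> * ?k (Y x)) = I
      \<longleftrightarrow> ?k absolutely_integrable_on Y ` {0<..} \<and> integral (Y ` {0<..}) ?k = I"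
    by (rule has_absolute_integral_change_of_variables_1') (auto intro: Y_deriv inj_Y)
  moreover have "(\<lambda>x. \<bar>f x\<bar>\<^sup>2 * gl_weight r \<beta> \<gamma> x) absolutely_integrable_on {0<..} \<longleftrightarrow> (\<lambda>x. \<bar>Y' x\<bar> * ?k (Y x)) absolutely_integrable_on {0<..}"
    by (rule set_integrable_cong[OF refl refl]) (rule e)
  moreover have "integral {0<..} (\<lambda>x. \<bar>f x\<bar>\<^sup>2 * gl_weight r \<beta> \<gamma> x) = integral {0<..} (\<lambda>x. \<bar>Y' x\<bar> * ?k (Y x))"
    by (rule integral_cong) (rule e)
  ultimately show ?thesis unfolding image_Y_pos by (simp only:)
qed

lemma weighted_L2_mapping:
  assumes "f \<in> weighted_L2 (gl_weight r \<beta> \<gamma>)" "AE x in lebesgue. x > 0 \<longrightarrow> f x = c x"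
    and "(\<lambda>y. c (X y)) \<in> borel_measurable (lebesgue_on {0<..})"
  shows "(\<lambda>y. c (X y)) \<in> L2 (lagm r)"
proof -
  have "set_integrable lebesgue {0<..} (\<lambda>x. \<bar>f x\<bar>\<^sup>2 * gl_weight r \<beta> \<gamma> x)"
    using assms(1) by (simp add: weighted_L2_def)
  then have "(\<lambda>x. \<bar>c x\<bar>\<^sup>2 * gl_weight r \<beta> \<gamma> x) absolutely_integrable_on {0<..}"
    by (rule set_integrable_AE_pos) (use assms(2) in eventually_elim, simp)
  then have "(\<lambda>y. wt r y * (c (X y))\<^sup>2) absolutely_integrable_on {0<..}"
    using change_of_variables_weight[of c "\<lambda>y. c (X y)" r] by blast
  moreover have "(\<lambda>y. (c (X y))\<^sup>2) \<in> borel_measurable (lebesgue_on {0<..})"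
    using assms(3) by (rule borel_measurable_power)
  ultimately show ?thesis using assms(3) by (simp add: L2_def lagm_integrable_iff)
qed

lemma weighted_norm_mapping:
  assumes h: "h \<in> L2 (lagm r)" and f: "\<And>y. y > 0 \<Longrightarrow> f (X y) = h y"
  shows "weighted_norm (gl_weight r \<beta> \<gamma>) f = sqrt (sq (lagm r) h)"
proof -
  have i: "integrable (lagm r) (\<lambda>y. (h y)\<^sup>2)" by (rule L2_integrable[OF h])
  have "(\<lambda>y. wt r y * (h y)\<^sup>2) absolutely_integrable_on {0<..}" "integral {0<..} (\<lambda>y. wt r y * (h y)\<^sup>2) = sq (lagm r) h"
    using lagm_abs_integrable[OF i] lagm_integral[OF i] by (auto simp: sq_def)
  then have "(\<lambda>x. \<bar>f x\<bar>\<^sup>2 * gl_weight r \<beta> \<gamma> x) absolutely_integrable_on {0<..}"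
      "integral {0<..} (\<lambda>x. \<bar>f x\<bar>\<^sup>2 * gl_weight r \<beta> \<gamma> x) = sq (lagm r) h"
    using change_of_variables_weight[where f = f and h = h, OF f] by blast+
  then show ?thesis
    unfolding weighted_norm_def using set_lebesgue_integral_eq_integral(2) by metis
qed

lemma interpolant_mapping:
  assumes th: "\<theta> > -1" and Z: "Z = {y. 0 < y \<and> laguerre (M + 1) \<theta> y = 0}" and y: "y > 0"
  shows "interpolant M \<theta> \<beta> \<gamma> v (X y) = poly (laguerre_nodes.interp Z (\<lambda>y. v (X y))) y"
proof -
  interpret laguerre_nodes \<theta> "M + 1" Z by unfold_locales (use th Z in auto)
  have c: "\<beta> + 1 > 0" using beta by simp
  let ?z = "laguerre_zero M \<theta>"
  have zs: "?z i = sorted_list_of_set Z ! i" for i by (simp add: laguerre_zero_def Z)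
  have len: "length (sorted_list_of_set Z) = M + 1" by (simp add: finite_Z card_Z)
  have bij: "bij_betw ?z {0..M} Z"
    unfolding bij_betw_def
  proof
    show "inj_on ?z {0..M}"
      unfolding zs inj_on_def using len by (auto simp: nth_eq_iff_index_eq finite_Z)
    have "?z ` {0..M} = set (sorted_list_of_set Z)"
      unfolding set_conv_nth len zs by (auto simp: less_Suc_eq_le)
    then show "?z ` {0..M} = Z" by (simp add: finite_Z)
  qed
  have node: "interp_node M \<theta> \<beta> \<gamma> i = X (?z i)" for i
    by (simp add: interp_node_def X_def)
  have zpos: "?z i > 0" if "i \<in> {0..M}" for i using bij that Z_pos unfolding bij_betw_def by auto
  \<comment> \<open>Powers \<gamma> of nodes and argument are linear in y, so the factor \<beta> + 1
    cancels in every quotient and the ordinary Lagrange basis appears.\<close>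
  have Xg: "X t powr \<gamma> = t / (\<beta> + 1)" if "t > 0" for t
    using that c gamma by (simp add: X_def powr_powr)
  have basis: "(\<Prod>r\<in>{0..M} - {i}. (X y powr \<gamma> - interp_node M \<theta> \<beta> \<gamma> r powr \<gamma>) /
      (interp_node M \<theta> \<beta> \<gamma> i powr \<gamma> - interp_node M \<theta> \<beta> \<gamma> r powr \<gamma>)) = poly (lagrange Z (?z i)) y"
    if i: "i \<in> {0..M}" for i
  proof -
    have b: "bij_betw ?z ({0..M} - {i}) (Z - {?z i})"
      using bij_betw_DiffI[OF bij bij_betw_singletonI[of ?z i "?z i"]] i bij
      by (auto simp: bij_betw_def inj_on_def)
    have "poly (lagrange Z (?z i)) y = (\<Prod>r\<in>Z - {?z i}. (y - r) / (?z i - r))"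
      unfolding lagrange_def poly_prod by (intro prod.cong) (auto simp: diff_divide_distrib)
    also have "\<dots> = (\<Prod>r\<in>{0..M} - {i}. (y - ?z r) / (?z i - ?z r))"
      by (rule prod.reindex_bij_betw[OF b, symmetric])
    also have "\<dots> = (\<Prod>r\<in>{0..M} - {i}. (X y powr \<gamma> - interp_node M \<theta> \<beta> \<gamma> r powr \<gamma>) /
      (interp_node M \<theta> \<beta> \<gamma> i powr \<gamma> - interp_node M \<theta> \<beta> \<gamma> r powr \<gamma>))"
    proof (rule prod.cong[OF refl])
      fix r assume "r \<in> {0..M} - {i}"
      then show "(y - ?z r) / (?z i - ?z r) = (X y powr \<gamma> - interp_node M \<theta> \<beta> \<gamma> r powr \<gamma>) /
          (interp_node M \<theta> \<beta> \<gamma> i powr \<gamma> - interp_node M \<theta> \<beta> \<gamma> r powr \<gamma>)"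
        using c y zpos[of r] zpos[OF i] by (simp add: node Xg diff_divide_distrib[symmetric])
    qed
    finally show ?thesis by simp
  qed
  have "interpolant M \<theta> \<beta> \<gamma> v (X y) = (\<Sum>i\<in>{0..M}. v (X (?z i)) * poly (lagrange Z (?z i)) y)"
    unfolding interpolant_def by (intro sum.cong refl) (subst basis, assumption, simp only: node)
  also have "\<dots> = (\<Sum>z\<in>Z. v (X z) * poly (lagrange Z z) y)"
    by (rule sum.reindex_bij_betw[OF bij])
  also have "\<dots> = poly (interp (\<lambda>y. v (X y))) y" by (simp add: interp_def poly_sum)
  finally show ?thesis .
qed

text \<open>For \<open>k < m\<close>, \<open>c k\<close> is the continuous representative of the \<open>k\<close>-th mapped derivative; the last one
  need not have one and is kept as it is.\<close>

lemma mapped_derivatives: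
  assumes v: "continuous_on {0<..} v"
    and wd: "\<And>k. k < m \<Longrightarrow> weakly_differentiable ((mapped_deriv \<beta> \<gamma> ^^ k) v)"
  shows "\<exists>c. c 0 = v \<and> c m = (mapped_deriv \<beta> \<gamma> ^^ m) v \<and>
    (\<forall>k\<le>m. AE x in lebesgue. x > 0 \<longrightarrow> (mapped_deriv \<beta> \<gamma> ^^ k) v x = c k x) \<and>
    (\<forall>k<m. ac_deriv (\<lambda>y. c k (X y)) (\<lambda>y. c (Suc k) (X y)))"
proof -
  let ?d = "\<lambda>k. (mapped_deriv \<beta> \<gamma> ^^ k) v"
  have hw: "has_weak_deriv (?d k) (weak_deriv (?d k))" if "k < m" for k
    using wd[OF that] unfolding weakly_differentiable_def weak_deriv_def by (rule someI_ex)
  then have "\<forall>k. \<exists>U. k < m \<longrightarrow> ac_deriv U (weak_deriv (?d k)) \<and> (AE x in lebesgue. x > 0 \<longrightarrow> ?d k x = U x)"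
    using weak_deriv_ac_deriv by blast
  then obtain U where U: "\<And>k. k < m \<Longrightarrow> ac_deriv (U k) (weak_deriv (?d k))"
    "\<And>k. k < m \<Longrightarrow> AE x in lebesgue. x > 0 \<longrightarrow> ?d k x = U k x" by metis
  define c where "c k = (if k = 0 then v else if k < m then U k else ?d k)" for k
  \<comment> \<open>For \<open>k = 0\<close> the equality must hold at every point and not just
    almost everywhere, because the interpolant reads point values of \<open>v\<close>; continuity of
    \<open>v\<close> provides this.\<close>
  have cU: "c k x = U k x" if "k < m" "x > 0" for k x
  proof (cases "k = 0")
    case True
    then show ?thesis
      using continuous_AE_eq[OF v ac_deriv_continuous[OF U(1)[OF that(1)]] _ that(2)] U(2)[OF that(1)]
      by (simp add: c_def)
  qed (use that in \<open>simp add: c_def\<close>)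
  have ae: "AE x in lebesgue. x > 0 \<longrightarrow> ?d k x = c k x" if "k \<le> m" for k
  proof (cases "k = 0 \<or> k = m")
    case True
    then show ?thesis by (auto simp: c_def)
  next
    case False
    then show ?thesis using U(2)[of k] that by (simp add: c_def)
  qed
  have ac: "ac_deriv (\<lambda>y. c k (X y)) (\<lambda>y. c (Suc k) (X y))" if k: "k < m" for k
  proof -
    \<comment> \<open>Solving the definition of the mapped derivative for the weak derivative, ready
      for the chain rule.\<close>
    have "weak_deriv (?d k) x = Y' x * ?d (Suc k) x" if "x > 0" for x
    proof -
      have "?d (Suc k) x = x powr (1 - \<gamma>) / ((\<beta> + 1) * \<gamma>) * weak_deriv (?d k) x"
        by (simp add: mapped_deriv_def)
      moreover have "x powr (\<gamma> - 1) * x powr (1 - \<gamma>) = 1" using that by (simp add: powr_add[symmetric])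
      ultimately show ?thesis using beta gamma by (simp add: Y'_def)
    qed
    moreover have "AE x in lebesgue. x > 0 \<longrightarrow> ?d (Suc k) x = c (Suc k) x" by (rule ae) (use k in simp)
    ultimately have "AE x in lebesgue. x > 0 \<longrightarrow> weak_deriv (?d k) x = Y' x * c (Suc k) x"
      by (auto elim!: eventually_mono)
    then have "ac_deriv (c k) (\<lambda>x. Y' x * c (Suc k) x)"
      by (rule ac_deriv_cong_AE[OF U(1)[OF k], rotated]) (simp add: cU[OF k])
    then have "ac_deriv (\<lambda>y. c k (X y)) (\<lambda>y. Y' (X y) * c (Suc k) (X y) / Y' (X y))"
      by (rule ac_deriv_mapping)
    then show ?thesis
    proof (rule ac_deriv_cong_AE)
      show "AE y in lebesgue. y > 0 \<longrightarrow> Y' (X y) * c (Suc k) (X y) / Y' (X y) = c (Suc k) (X y)"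
        by (rule AE_I2) (use X_pos Y'_pos in force)
    qed simp
  qed
  show ?thesis
    by (rule exI[of _ c]) (use ae ac in \<open>auto simp: c_def\<close>)
qed

end

section \<open>Transport of the two error bounds to the variable x\<close>

theorem theorem2p3:
  fixes \<mu> :: nat and \<theta> \<beta> \<gamma> :: real
  assumes "1 \<le> \<mu>" and "-1 < \<theta>" and "-1 < \<beta>" and "0 < \<gamma>" and "\<gamma> < 1"
  shows "\<exists>C::real. 0 < C \<and>
    (\<forall>M::nat. \<forall>v::real \<Rightarrow> real. 1 \<le> M \<longrightarrow> continuous_on {0<..} v \<longrightarrow>
      v \<in> mapped_sobolev \<mu> \<theta> \<beta> \<gamma> \<longrightarrow>
      mapped_deriv \<beta> \<gamma> v \<in> mapped_sobolev (\<mu> - 1) \<theta> \<beta> \<gamma> \<longrightarrow>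
      (let m = min \<mu> (M + 1); w = (mapped_deriv \<beta> \<gamma> ^^ m) v in
        weighted_norm (gl_weight \<theta> \<beta> \<gamma>) (\<lambda>x. interpolant M \<theta> \<beta> \<gamma> v x - v x)
        \<le> C * sqrt (fact (M + 1 - m) / fact M) *
          (weighted_norm (gl_weight (\<theta> + real m - 1) \<beta> \<gamma>) w
           + 2 * sqrt (ln (real M)) * weighted_norm (gl_weight (\<theta> + real m) \<beta> \<gamma>) w)))"
proof -
  note th = assms(2)
  interpret mapping \<beta> \<gamma> by unfold_locales (use assms in auto)
  obtain C1 where C1: "C1 > 0" and B1: "\<forall>M Z m U. 2 \<le> M \<longrightarrow> Z = {y. 0 < y \<and> laguerre (M + 1) \<theta> y = 0} \<longrightarrow> 1 \<le> m \<longrightarrow> m \<le> M + 1 \<longrightarrow>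
    (\<forall>k<m. ac_deriv (U k) (U (Suc k))) \<longrightarrow> (\<forall>k\<le>m. U k \<in> L2 (lagm (\<theta> + real k))) \<longrightarrow>
    sqrt (sq (lagm \<theta>) (\<lambda>y. poly (laguerre_nodes.interp Z (U 0)) y - U 0 y)) \<le>
      C1 * sqrt (fact (M + 1 - m) / fact M) * (sqrt (ln (real M)) * sqrt (sq (lagm (\<theta> + real m)) (U m)))"
    using interpolation_error_log[OF th] by blast
  obtain C2 where C2: "C2 > 0" and B2: "\<forall>Z m U. Z = {y. 0 < y \<and> laguerre 2 \<theta> y = 0} \<longrightarrow> (m = 1 \<or> m = 2) \<longrightarrow>
    (\<forall>k<m. ac_deriv (U k) (U (Suc k))) \<longrightarrow> U 0 \<in> L2 (lagm \<theta>) \<longrightarrow> (\<forall>k\<in>{1..m}. U k \<in> L2 (lagm (\<theta> + real k - 1))) \<longrightarrow>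
    sqrt (sq (lagm \<theta>) (\<lambda>y. poly (laguerre_nodes.interp Z (U 0)) y - U 0 y)) \<le>
      C2 * sqrt (sq (lagm (\<theta> + real m - 1)) (U m))"
    using interpolation_error_two_nodes[OF th] by blast
  have main: "weighted_norm (gl_weight \<theta> \<beta> \<gamma>) (\<lambda>x. interpolant M \<theta> \<beta> \<gamma> v x - v x)
        \<le> (C1 + C2) * sqrt (fact (M + 1 - m) / fact M) *
          (weighted_norm (gl_weight (\<theta> + real m - 1) \<beta> \<gamma>) ((mapped_deriv \<beta> \<gamma> ^^ m) v)
           + 2 * sqrt (ln (real M)) * weighted_norm (gl_weight (\<theta> + real m) \<beta> \<gamma>) ((mapped_deriv \<beta> \<gamma> ^^ m) v))"
    if M: "1 \<le> M" and v: "continuous_on {0<..} v" and vS: "v \<in> mapped_sobolev \<mu> \<theta> \<beta> \<gamma>"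
      and dS: "mapped_deriv \<beta> \<gamma> v \<in> mapped_sobolev (\<mu> - 1) \<theta> \<beta> \<gamma>" and m_def: "m = min \<mu> (M + 1)"
    for M m :: nat and v
  proof -
    let ?d = "\<lambda>k. (mapped_deriv \<beta> \<gamma> ^^ k) v"
    have m: "1 \<le> m" "m \<le> M + 1" "m \<le> \<mu>" using assms(1) M by (auto simp: m_def)
    have wd: "weakly_differentiable (?d k)" if "k < m" for k
    proof -
      have "Suc k \<in> {1..\<mu>}" using that m by simp
      then show ?thesis using vS unfolding mapped_sobolev_def by force
    qed
    have dL: "?d k \<in> weighted_L2 (gl_weight (\<theta> + real k) \<beta> \<gamma>)" if "k \<le> m" for k
      using vS that m unfolding mapped_sobolev_def by (cases "k = 0") auto
    \<comment> \<open>The assumption on the first mapped derivative gives the weight index one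
      lower: the k-th derivative of \<open>v\<close> is the (k - 1)-th of
      \<open>mapped_deriv \<beta> \<gamma> v\<close>.\<close>
    have dL': "?d k \<in> weighted_L2 (gl_weight (\<theta> + real k - 1) \<beta> \<gamma>)" if k: "k \<in> {1..m}" for k
    proof (cases "k = 1")
      case True
      then show ?thesis using dS unfolding mapped_sobolev_def by simp
    next
      case False
      then obtain j where j: "k = Suc j" "j \<in> {1..\<mu> - 1}" using k m by (cases k) auto
      then have "(mapped_deriv \<beta> \<gamma> ^^ j) (mapped_deriv \<beta> \<gamma> v) \<in> weighted_L2 (gl_weight (\<theta> + real j) \<beta> \<gamma>)"
        using dS unfolding mapped_sobolev_def by blast
      moreover have "\<theta> + real k - 1 = \<theta> + real j" using j(1) by simp
      ultimately show ?thesis unfolding j(1) by (simp add: funpow_swap1)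
    qed
    obtain c where c: "c 0 = v" "c m = ?d m"
      "\<And>k. k \<le> m \<Longrightarrow> AE x in lebesgue. x > 0 \<longrightarrow> ?d k x = c k x"
      "\<And>k. k < m \<Longrightarrow> ac_deriv (\<lambda>y. c k (X y)) (\<lambda>y. c (Suc k) (X y))"
      using mapped_derivatives[OF v wd] by blast
    define U where "U k y = c k (X y)" for k y
    have ac: "ac_deriv (U k) (U (Suc k))" if "k < m" for k
      using c(4)[OF that] by (simp add: U_def[abs_def])
    have meas: "U k \<in> borel_measurable (lebesgue_on {0<..})" if "k \<le> m" for k
    proof (cases "k < m")
      case True
      then show ?thesis by (rule continuous_measurable_pos[OF ac_deriv_continuous[OF ac]])
    next
      case False
      then have "k = m" using that by simp
      \<comment> \<open>The top derivative has no continuous representative at hand; it is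
        measurable as the derivative paired with the preceding one.\<close>
      then obtain j where "k = Suc j" "j < m" using m by (cases m) auto
      then show ?thesis using locally_abs_int_measurable[OF ac_derivD(1)[OF ac]] by simp
    qed
    have UL: "U k \<in> L2 (lagm (\<theta> + real k))" if "k \<le> m" for k
      using weighted_L2_mapping[OF dL[OF that] c(3)[OF that]] meas[OF that] by (simp add: U_def[abs_def])
    have UL': "U k \<in> L2 (lagm (\<theta> + real k - 1))" if k: "k \<in> {1..m}" for k
      using weighted_L2_mapping[OF dL'[OF k] c(3)] meas[of k] k by (simp add: U_def[abs_def])
    have U0: "U 0 \<in> L2 (lagm \<theta>)" using UL[of 0] by simp
    define Z where "Z = {y. 0 < y \<and> laguerre (M + 1) \<theta> y = 0}"
    define e where "e = sqrt (sq (lagm \<theta>) (\<lambda>y. poly (laguerre_nodes.interp Z (U 0)) y - U 0 y))"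
    have lhs: "weighted_norm (gl_weight \<theta> \<beta> \<gamma>) (\<lambda>x. interpolant M \<theta> \<beta> \<gamma> v x - v x) = e"
      unfolding e_def
    proof (rule weighted_norm_mapping)
      show "(\<lambda>y. poly (laguerre_nodes.interp Z (U 0)) y - U 0 y) \<in> L2 (lagm \<theta>)"
        by (rule L2_diff[OF poly_L2[OF th] U0])
      show "interpolant M \<theta> \<beta> \<gamma> v (X y) - v (X y) = poly (laguerre_nodes.interp Z (U 0)) y - U 0 y" if "y > 0" for y
        using interpolant_mapping[OF th Z_def that, of v] by (simp add: U_def[abs_def] c(1))
    qed
    define n1 where "n1 = sqrt (sq (lagm (\<theta> + real m - 1)) (U m))"
    define n2 where "n2 = sqrt (sq (lagm (\<theta> + real m)) (U m))"
    have r1: "weighted_norm (gl_weight (\<theta> + real m - 1) \<beta> \<gamma>) (?d m) = n1"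
      unfolding n1_def by (rule weighted_norm_mapping[OF UL']) (use m in \<open>auto simp: U_def c(2)\<close>)
    have r2: "weighted_norm (gl_weight (\<theta> + real m) \<beta> \<gamma>) (?d m) = n2"
      unfolding n2_def by (rule weighted_norm_mapping[OF UL]) (auto simp: U_def c(2))
    have n: "n1 \<ge> 0" "n2 \<ge> 0" by (auto simp: n1_def n2_def)
    define E where "E = sqrt (fact (M + 1 - m) / fact M :: real)"
    have E: "E \<ge> 0" by (simp add: E_def)
    have "e \<le> (C1 + C2) * E * (n1 + 2 * sqrt (ln (real M)) * n2)"
    proof (cases "M = 1")
      case True
      have m12: "m = 1 \<or> m = 2" using m True by auto
      have "e \<le> C2 * n1"
        unfolding e_def n1_def
        using B2[rule_format, of Z m U] m12 ac U0 UL' True by (simp add: Z_def numeral_2_eq_2)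
      also have "\<dots> \<le> (C1 + C2) * n1" using C1 n by (intro mult_right_mono) auto
      \<comment> \<open>For M = 1 the ratio is 1!/1! or 0!/1!, and ln 1 = 0 removes the second
        norm.\<close>
      also have "E = 1" using m12 True by (auto simp: E_def)
      then have "(C1 + C2) * n1 = (C1 + C2) * E * (n1 + 2 * sqrt (ln (real M)) * n2)" using True by simp
      finally show ?thesis .
    next
      case False
      then have M2: "2 \<le> M" using M by simp
      have s: "sqrt (ln (real M)) \<ge> 0" using M by simp
      \<comment> \<open>The logarithmic term alone bounds the error here; the first norm and the
        factor 2 only enlarge the right-hand side.\<close>
      have "e \<le> C1 * E * (sqrt (ln (real M)) * n2)"
        unfolding e_def n2_def E_def
        using B1[rule_format, of M Z m U] M2 m ac UL Z_def by blast
      also have "\<dots> \<le> (C1 + C2) * E * (n1 + 2 * sqrt (ln (real M)) * n2)"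
        using C1 C2 E n s by (intro mult_mono) auto
      finally show ?thesis .
    qed
    then show ?thesis unfolding lhs r1 r2 E_def .
  qed
  show ?thesis
    unfolding Let_def
    by (intro exI[of _ "C1 + C2"] conjI allI impI main) (use C1 C2 in auto)
qed

end
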